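(* Let $\alpha>0$ and $\beta>0$, and consider the function $z\mapsto \dfrac{\theta(\beta,z)}{\theta(\alpha,z)}$ on $\mathbb{H}$. (a) If $(\alpha,\beta)\in \mathrm{I}\cup \mathrm{III}$, then the maximum over $\mathbb{H}$ is attained at $e^{i\pi/3}$, and this maximizer is unique up to the action of the modular group. If $(\alpha,\beta)\in \mathrm{II}\cup \mathrm{IV}$, then no maximizer over $\mathbb{H}$ exists. (b) If $(\alpha,\beta)\in \mathrm{II}\cup \mathrm{IV}$, then the minimum over $\mathbb{H}$ is attained at $e^{i\pi/3}$, and this minimizer is unique up to the action of the modular group. If $(\alpha,\beta)\in \mathrm{I}\cup \mathrm{III}$, then no minimizer over $\mathbb{H}$ exists.
   Context: $\mathbb{H}=\{z\in\mathbb{C}:\operatorname{Im}(z)>0\}$. For $\alpha>0$ and $z\in\mathbb{H}$, $$\theta(\alpha,z)=\sum_{(m,n)\in\mathbb{Z}^2}e^{-\pi\alpha\frac{|mz+n|^2}{\operatorname{Im}(z)}}.$$ The regions of parameters $\alpha,\beta>0$ are $\mathrm{I}=\{(\alpha,\beta):\beta>\alpha,\ \beta\alpha>1\}$, $\mathrm{II}=\{(\alpha,\beta):\beta<\alpha,\ \beta\alpha>1\}$, $\mathrm{III}=\{(\alpha,\beta):\beta<\alpha,\ \beta\alpha<1\}$, $\mathrm{IV}=\{(\alpha,\beta):\beta>\alpha,\ \beta\alpha<1\}$. The modular group is $\mathrm{SL}_2(\mathbb{Z})$ acting on $\mathbb{H}$ by $z\mapsto\frac{az+b}{cz+d}$;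 the functions $\theta(\alpha,\cdot)$ are invariant under it. *)

theory Defs
  imports "HOL-Analysis.Analysis"
begin

definition upper_halfplane :: "complex set" where
  "upper_halfplane = {z. Im z > 0}"

definition theta :: "real \<Rightarrow> complex \<Rightarrow> real" where
  "theta \<alpha> z = (\<Sum>\<^sub>\<infinity>(m, n)\<in>(UNIV :: (int \<times> int) set).
      exp (- pi * \<alpha> * ((cmod (of_int m * z + of_int n))\<^sup>2 / Im z)))"

definition theta_ratio :: "real \<Rightarrow> real \<Rightarrow> complex \<Rightarrow> real" where
  "theta_ratio \<alpha> \<beta> z = theta \<beta> z / theta \<alpha> z"

definition region_I :: "(real \<times> real) set" where
  "region_I = {(\<alpha>, \<beta>). \<alpha> > 0 \<and> \<beta> > 0 \<and> \<beta> > \<alpha> \<and> \<beta> * \<alpha> > 1}"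

definition region_II :: "(real \<times> real) set" where
  "region_II = {(\<alpha>, \<beta>). \<alpha> > 0 \<and> \<beta> > 0 \<and> \<beta> < \<alpha> \<and> \<beta> * \<alpha> > 1}"

definition region_III :: "(real \<times> real) set" where
  "region_III = {(\<alpha>, \<beta>). \<alpha> > 0 \<and> \<beta> > 0 \<and> \<beta> < \<alpha> \<and> \<beta> * \<alpha> < 1}"

definition region_IV :: "(real \<times> real) set" where
  "region_IV = {(\<alpha>, \<beta>). \<alpha> > 0 \<and> \<beta> > 0 \<and> \<beta> > \<alpha> \<and> \<beta> * \<alpha> < 1}"

definition SL2Z :: "(int ^ 2 ^ 2) set" where
  "SL2Z = {A. det A = 1}"

definition moebius_act :: "int ^ 2 ^ 2 \<Rightarrow> complex \<Rightarrow> complex" where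
  "moebius_act A z =
     (of_int (A $ 1 $ 1) * z + of_int (A $ 1 $ 2)) / (of_int (A $ 2 $ 1) * z + of_int (A $ 2 $ 2))"

definition modular_orbit :: "complex \<Rightarrow> complex set" where
  "modular_orbit z = (\<lambda>A. moebius_act A z) ` SL2Z"

definition is_maximizer :: "(complex \<Rightarrow> real) \<Rightarrow> complex \<Rightarrow> bool" where
  "is_maximizer f z \<longleftrightarrow> is_arg_max f (\<lambda>w. w \<in> upper_halfplane) z"

definition is_minimizer :: "(complex \<Rightarrow> real) \<Rightarrow> complex \<Rightarrow> bool" where
  "is_minimizer f z \<longleftrightarrow> is_arg_min f (\<lambda>w. w \<in> upper_halfplane) z"

end

theory Submission
  imports Defs "HOL-Probability.Probability"
begin

text \<open>Write \<open>N s z\<close> for \<open>sqrt s * theta s z\<close>. Poisson summation gives \<open>N (1 / s) = N s\<close>, so in all four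
  regions the ratio or its inverse is a constant multiple of \<open>N \<beta> / N \<alpha>\<close> with \<open>1 \<le> \<alpha> < \<beta>\<close>.

  Let \<open>N'\<close> be \<open>s\<close> times the derivative of \<open>N\<close> in \<open>s\<close>, and let \<open>z = x + i y\<close>. For \<open>s > 1\<close>, first,
  \<open>N' s (x + i y) < N' s (1/2 + i y)\<close> for \<open>y \<ge> 2/3\<close> and \<open>x\<close> not congruent to \<open>1/2\<close>; second,
  \<open>N' s (1/2 + i y)\<close> is nonincreasing for \<open>y \<ge> 13/10\<close>; third, \<open>N' s z > 0\<close> for \<open>y\<^sup>2 \<ge> 3/4\<close>. Each is proved
  by isolating the leading terms of an expansion of \<open>N'\<close>: the Gaussian lattice sum, or its Poisson dual in one
  index, when \<open>y / s\<close> is small, and the Fourier series in \<open>x\<close> when \<open>y / s\<close> is large.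

  Integrated in \<open>s\<close>, the first two statements show that \<open>N \<beta> - N \<alpha>\<close> is maximised over the fundamental domain
  on the segment \<open>1/2 + i y\<close>, \<open>2/3 \<le> y \<le> 13/10\<close>. There \<open>z \<mapsto> 1 / (1 - z)\<close> leaves only its fixed point
  \<open>exp (i pi / 3)\<close>. Letting \<open>\<beta>\<close> tend to infinity, this point minimises \<open>N \<alpha>\<close>, so it maximises
  \<open>N \<beta> / N \<alpha> = 1 + (N \<beta> - N \<alpha>) / N \<alpha>\<close>. By the third statement the ratio exceeds \<open>1\<close>, but it tends to \<open>1\<close> at
  the cusp, so it has no minimum.\<close>

section \<open>Differentiation of sums and Poisson summation\<close>

text \<open>The difference \<open>N \<beta> - N \<alpha>\<close> is studied before the quotient
  because it can be treated one \<open>s\<close> at a time through \<open>N'\<close>. The price is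
  that minimality of the denominator has to be known as well. It comes from the limit:
  \<open>N \<beta>\<close> is at least \<open>sqrt \<beta>\<close> everywhere, and at the hexagonal
  point it exceeds \<open>sqrt \<beta>\<close> by at most a constant over \<open>\<beta>\<close>.
  The symmetry \<open>N (1 / s) = N s\<close> forces \<open>N'\<close> to vanish identically at
  \<open>s = 1\<close>, so near there no estimate with a fixed error survives. The Fourier bounds
  therefore extract the factor \<open>s * y - y / s\<close> from every pair of terms, dominant or
  neglected. When \<open>y / s\<close> is small and \<open>y\<close> is bounded below,
  \<open>s\<close> stays away from \<open>1\<close> and the Gaussian bounds need no such care. The
  heights \<open>2/3\<close> and \<open>13/10\<close> are tied together:
  \<open>z \<mapsto> 1 / (1 - z)\<close> sends \<open>1/2 + i y\<close> to height
  \<open>y / (1/4 + y^2)\<close>, which at \<open>y = 13/10\<close> is \<open>65/97\<close>, just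
  above \<open>2/3\<close>. This is why the comparison with real part one half must reach below the
  fundamental domain. The thresholds for \<open>y / s\<close> are numerical, placed where the error
  budgets on either side close.\<close>

lemma summable_on_int_split:
  fixes f :: "int \<Rightarrow> real"
  assumes "(\<lambda>n::nat. f (int n)) summable_on UNIV" "(\<lambda>n::nat. f (- int n)) summable_on UNIV"
  shows "f summable_on UNIV"
proof -
  have 1: "f summable_on (range int)"
    using assms(1) by (subst summable_on_reindex) (auto simp: o_def inj_on_def)
  have 2: "f summable_on (range (\<lambda>n. - int n))"
    using assms(2) by (subst summable_on_reindex) (auto simp: o_def inj_on_def)
  have "range int \<union> range (\<lambda>n. - int n) = UNIV"
  proof -
    have "x \<in> range int \<union> range (\<lambda>n. - int n)" for x :: int
      by (cases x rule: int_cases3) auto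
    then show ?thesis by blast
  qed
  then show ?thesis using summable_on_union[OF 1 2] by simp
qed

lemma summable_on_gauss_int:
  fixes c :: real assumes "c > 0"
  shows "(\<lambda>n::int. exp (- c * (of_int n)\<^sup>2)) summable_on UNIV"
proof -
  have g: "(\<lambda>n::nat. exp (- c * (of_nat n)\<^sup>2)) summable_on UNIV"
  proof (rule summable_on_comparison_test)
    have "summable (\<lambda>n::nat. exp (-c) ^ n)"
      using assms by (intro summable_geometric) auto
    then show "(\<lambda>n::nat. exp (-c) ^ n) summable_on UNIV"
      by (intro summable_nonneg_imp_summable_on) auto
    fix n :: nat
    have "real n \<le> (real n)\<^sup>2" by (metis le_square of_nat_mono of_nat_mult power2_eq_square)
    then have "c * real n \<le> c * (real n)\<^sup>2" using assms by simp
    then show "exp (- c * (of_nat n)\<^sup>2) \<le> exp (-c) ^ n"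
      by (simp add: exp_of_nat_mult[symmetric] mult.commute)
  qed auto
  show ?thesis by (rule summable_on_int_split) (use g in auto)
qed

lemma summable_on_product:
  fixes f :: "'a \<Rightarrow> real" and g :: "'b \<Rightarrow> real"
  assumes "f summable_on UNIV" "g summable_on UNIV" "\<And>a. f a \<ge> 0" "\<And>b. g b \<ge> 0"
  shows "(\<lambda>(a,b). f a * g b) summable_on UNIV"
    and "infsum (\<lambda>(a,b). f a * g b) UNIV = infsum f UNIV * infsum g UNIV"
proof -
  have *: "(\<lambda>(a,b). f a * g b) summable_on (UNIV \<times> UNIV)"
    by (rule summable_on_SigmaI[where g = "\<lambda>a. f a * infsum g UNIV"])
       (use assms in \<open>auto intro!: has_sum_cmult_right has_sum_infsum summable_on_cmult_left\<close>)
  then show "(\<lambda>(a,b). f a * g b) summable_on UNIV" by simp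
  show "infsum (\<lambda>(a,b). f a * g b) UNIV = infsum f UNIV * infsum g UNIV"
    using infsum_Sigma'_banach[OF *] assms(1,2)
    by (simp add: infsum_cmult_right infsum_cmult_left)
qed

lemma summable_on_gauss_int2:
  fixes c :: real assumes "c > 0"
  shows "(\<lambda>(m::int,n::int). exp (- c * ((of_int m)\<^sup>2 + (of_int n)\<^sup>2))) summable_on UNIV"
  using summable_on_product(1)[OF summable_on_gauss_int[OF assms] summable_on_gauss_int[OF assms]]
  by (simp add: exp_add[symmetric] algebra_simps)

lemma summable_on_abs_le:
  fixes f g :: "'a \<Rightarrow> real"
  assumes "g summable_on A" "\<And>x. x \<in> A \<Longrightarrow> \<bar>f x\<bar> \<le> g x"
  shows "f summable_on A"
proof -
  have "(\<lambda>x. norm (f x)) summable_on A"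
    by (rule Infinite_Sum.abs_summable_on_comparison_test'[OF assms(1)]) (use assms(2) in auto)
  then show ?thesis by (rule summable_on_iff_abs_summable_on_real[THEN iffD2])
qed

text \<open>Enumerating the countable index turns the unordered sum into a series, to which the
  Weierstrass test applies. Continuity of sums and the exchange of sum and integral are derived from
  this lemma as well.\<close>

lemma has_real_derivative_infsum:
  fixes f :: "'i::countable \<Rightarrow> real \<Rightarrow> real"
  assumes inf: "infinite (UNIV :: 'i set)" and S: "open S" "convex S" "s \<in> S"
    and der: "\<And>i t. t \<in> S \<Longrightarrow> (f i has_real_derivative f' i t) (at t)"
    and M: "M summable_on UNIV" "\<And>i t. t \<in> S \<Longrightarrow> \<bar>f' i t\<bar> \<le> M i"
    and sf: "\<And>t. t \<in> S \<Longrightarrow> (\<lambda>i. f i t) summable_on UNIV"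
  shows "((\<lambda>t. \<Sum>\<^sub>\<infinity>i. f i t) has_real_derivative (\<Sum>\<^sub>\<infinity>i. f' i s)) (at s)"
proof -
  obtain e :: "nat \<Rightarrow> 'i" where e: "bij_betw e UNIV UNIV"
    using bij_betw_from_nat_into[of "UNIV :: 'i set"] inf by auto
  have re: "infsum g UNIV = (\<Sum>n. g (e n))" and rs: "summable (\<lambda>n. g (e n))"
    if "g summable_on UNIV" for g :: "'i \<Rightarrow> real"
  proof -
    have "(\<lambda>n. g (e n)) summable_on UNIV" using that e by (simp add: summable_on_reindex_bij_betw)
    then have "((\<lambda>n. g (e n)) has_sum infsum g UNIV) UNIV"
      using infsum_reindex_bij_betw[OF e, of g] by (metis has_sum_infsum)
    then have "(\<lambda>n. g (e n)) sums infsum g UNIV" by (rule has_sum_imp_sums)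
    then show "infsum g UNIV = (\<Sum>n. g (e n))" "summable (\<lambda>n. g (e n))" by (auto simp: sums_iff)
  qed
  have sf': "(\<lambda>i. f' i t) summable_on UNIV" if "t \<in> S" for t
    by (rule summable_on_abs_le[OF M(1)]) (use M(2) that in auto)
  have "((\<lambda>t. \<Sum>n. f (e n) t) has_real_derivative (\<Sum>n. f' (e n) s)) (at s)"
  proof (rule has_field_derivative_series'(2)[OF S(2) _ _ S(3)])
    show "\<And>n x. x \<in> S \<Longrightarrow> (f (e n) has_real_derivative f' (e n) x) (at x within S)"
      using der by (blast intro: has_field_derivative_at_within)
    show "uniformly_convergent_on S (\<lambda>n x. \<Sum>i<n. f' (e i) x)"
      by (rule Weierstrass_m_test'[where M = "\<lambda>n. M (e n)"]) (use M rs in auto)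
    show "summable (\<lambda>n. f (e n) s)" using rs sf S by auto
    show "s \<in> interior S" using S by (simp add: interior_open)
  qed
  then have "((\<lambda>t. \<Sum>n. f (e n) t) has_real_derivative (\<Sum>\<^sub>\<infinity>i. f' i s)) (at s)"
    using re[OF sf'[OF S(3)]] by simp
  then show ?thesis
    by (rule has_field_derivative_transform_within_open[OF _ S(1) S(3)]) (use re sf in auto)
qed

text \<open>Half of the exponential rate pays for the linear factor that differentiation produces,
  so that derivatives are dominated by Gaussians of half the rate.\<close>

lemma exp_absorb1: fixes w :: real assumes "w \<ge> 0" shows "(1/2 + w) * exp (- w) \<le> 2 * exp (- w / 2)"
proof -
  have "1 + w / 2 \<le> exp (w / 2)" by (rule exp_ge_add_one_self)
  then have "1/2 + w \<le> 2 * exp (w/2)" using assms by linarith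
  then have "(1/2 + w) * exp (-w) \<le> (2 * exp (w/2)) * exp (-w)" by (intro mult_right_mono) auto
  also have "\<dots> = 2 * exp (- w / 2)" by (simp add: exp_add[symmetric] mult.assoc)
  finally show ?thesis .
qed

lemma exp_absorb1': fixes w :: real assumes "w \<ge> 0" shows "\<bar>(1/2 - w) * exp (- w)\<bar> \<le> 2 * exp (- w / 2)"
proof -
  have "\<bar>(1/2 - w) * exp (- w)\<bar> \<le> (1/2 + w) * exp (- w)"
    using assms by (auto simp: abs_mult intro!: mult_right_mono)
  then show ?thesis using exp_absorb1[OF assms] by linarith
qed

lemma infsum_diff_real:
  fixes f g :: "'a \<Rightarrow> real"
  assumes "f summable_on A" "g summable_on A"
  shows "infsum (\<lambda>x. f x - g x) A = infsum f A - infsum g A"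
    and "(\<lambda>x. f x - g x) summable_on A"
proof -
  have "((\<lambda>x. f x + - g x) has_sum (infsum f A + - infsum g A)) A"
    using assms by (intro has_sum_add has_sum_uminusI) auto
  then show "infsum (\<lambda>x. f x - g x) A = infsum f A - infsum g A" "(\<lambda>x. f x - g x) summable_on A"
    by (auto simp: has_sum_iff)
qed

text \<open>The sum of the antiderivatives is differentiated term by term, and the fundamental
  theorem of calculus evaluates its derivative between \<open>0\<close> and
  \<open>1\<close>.\<close>

lemma integral_infsum:
  fixes f :: "'i::countable \<Rightarrow> real \<Rightarrow> real"
  assumes inf: "infinite (UNIV :: 'i set)"
    and cont: "\<And>i. continuous_on UNIV (f i)"
    and M: "M summable_on UNIV" "\<And>i t. t \<in> {-1..2} \<Longrightarrow> \<bar>f i t\<bar> \<le> M i"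
  shows "((\<lambda>t. \<Sum>\<^sub>\<infinity>i. f i t) has_integral (\<Sum>\<^sub>\<infinity>i. integral {0..1} (f i))) {0..1}"
    and "(\<lambda>i. integral {0..1} (f i)) summable_on UNIV"
proof -
  \<comment> \<open>Starting at \<open>-1\<close>, with domination up to \<open>2\<close>, keeps
    both endpoints of \<open>{0..1}\<close> inside the open interval on which the sum is
    differentiated.\<close>
  define F where "F i t = integral {-1..t} (f i)" for i and t :: real
  have M0: "M i \<ge> 0" for i using M(2)[of 0 i] by auto
  have ci: "continuous_on S (f i)" for S i by (rule continuous_on_subset[OF cont]) simp
  have F: "(F i has_real_derivative f i t) (at t)" if "t \<in> {-1<..<2}" for i t
    using integral_has_real_derivative[OF ci, of t "-1" 2 i] that
    unfolding F_def by (simp add: at_within_Icc_at)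
  have Fb: "\<bar>F i t\<bar> \<le> 3 * M i" if "t \<in> {-1<..<2}" for i t
  proof -
    have "norm (integral (cbox (-1) t) (f i)) \<le> M i * measure lborel (cbox (-1) t)"
      using that by (intro integrable_bound M0 integrable_continuous ci) (auto intro!: M)
    also have "\<dots> \<le> M i * 3" using that M0 by (intro mult_left_mono) auto
    finally show ?thesis by (simp add: F_def)
  qed
  have sF: "(\<lambda>i. F i t) summable_on UNIV" if "t \<in> {-1<..<2}" for t
    by (rule summable_on_abs_le[where g = "\<lambda>i. 3 * M i"])
       (use Fb that M in \<open>auto intro: summable_on_cmult_right\<close>)
  have D: "((\<lambda>t. \<Sum>\<^sub>\<infinity>i. F i t) has_real_derivative (\<Sum>\<^sub>\<infinity>i. f i t)) (at t)" if "t \<in> {-1<..<2}" for t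
    by (rule has_real_derivative_infsum[OF inf, where S = "{-1<..<2}" and M = M])
       (use that F M sF in auto)
  have "((\<lambda>t. \<Sum>\<^sub>\<infinity>i. f i t) has_integral ((\<Sum>\<^sub>\<infinity>i. F i 1) - (\<Sum>\<^sub>\<infinity>i. F i 0))) {0..1}"
    by (rule fundamental_theorem_of_calculus)
       (auto simp: has_real_derivative_iff_has_vector_derivative[symmetric] intro!: has_field_derivative_at_within D)
  moreover have d: "integral {0..1} (f i) = F i 1 - F i 0" for i
    using Henstock_Kurzweil_Integration.integral_combine[of "-1" 0 1 "f i"]
    by (simp add: F_def integrable_continuous_interval ci)
  moreover have "(\<Sum>\<^sub>\<infinity>i. F i 1 - F i 0) = (\<Sum>\<^sub>\<infinity>i. F i 1) - (\<Sum>\<^sub>\<infinity>i. F i 0)"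
    by (rule infsum_diff_real(1)) (auto intro!: sF)
  ultimately show "((\<lambda>t. \<Sum>\<^sub>\<infinity>i. f i t) has_integral (\<Sum>\<^sub>\<infinity>i. integral {0..1} (f i))) {0..1}" by simp
  show "(\<lambda>i. integral {0..1} (f i)) summable_on UNIV"
    unfolding d by (intro infsum_diff_real(2) sF) auto
qed

section \<open>Uniqueness of cosine coefficients\<close>

text \<open>Symmetry about \<open>1/2\<close> makes \<open>f\<close> a continuous function
  \<open>h\<close> of \<open>cos (2 * pi * x)\<close>, hence uniformly close to a polynomial in that
  cosine. Orthogonality to all such polynomials makes the integral of the square of \<open>f\<close>
  arbitrarily small.\<close>

lemma even_periodic_eq_0:
  fixes f :: "real \<Rightarrow> real"
  assumes cont: "continuous_on UNIV f" and even: "\<And>x. f (1 - x) = f x"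
    and orth: "\<And>k::nat. integral {0..1} (\<lambda>x. f x * cos (2 * pi * real k * x)) = 0"
    and X: "x \<in> {0..1}"
  shows "f x = 0"
proof -
  have ci: "continuous_on S f" for S by (rule continuous_on_subset[OF cont]) simp
  \<comment> \<open>The product formula lowers the power of the cosine by one and replaces the
    frequency \<open>k\<close> by its two neighbours, which is why \<open>k\<close> varies in the
    induction on \<open>j\<close>.\<close>
  have mom: "integral {0..1} (\<lambda>x. f x * cos (2 * pi * real k * x) * cos (2 * pi * x) ^ j) = 0" for j k
  proof (induction j arbitrary: k)
    case 0 then show ?case using orth by simp
  next
    case (Suc j)
    have id: "cos (2 * pi * real (Suc k) * x) * cos (2 * pi * x)
       = (cos (2 * pi * real (Suc (Suc k)) * x) + cos (2 * pi * real k * x)) / 2" for x k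
    proof -
      have "cos (2 * pi * real (Suc k) * x) * cos (2 * pi * x)
        = (cos (2 * pi * real (Suc k) * x - 2 * pi * x) + cos (2 * pi * real (Suc k) * x + 2 * pi * x)) / 2"
        by (rule cos_times_cos)
      then show ?thesis by (simp add: algebra_simps)
    qed
    show ?case
    proof (cases k)
      case 0
      then show ?thesis using Suc.IH[of 1] by (simp add: mult_ac)
    next
      case (Suc k')
      have "f x * cos (2 * pi * real k * x) * cos (2 * pi * x) ^ Suc j =
          1/2 * (f x * cos (2 * pi * real (Suc (Suc k')) * x) * cos (2 * pi * x) ^ j) +
          1/2 * (f x * cos (2 * pi * real k' * x) * cos (2 * pi * x) ^ j)" for x
      proof -
        have "f x * cos (2 * pi * real k * x) * cos (2 * pi * x) ^ Suc j =
          f x * (cos (2 * pi * real (Suc k') * x) * cos (2 * pi * x)) * cos (2 * pi * x) ^ j"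
          by (simp only: Suc power_Suc mult_ac)
        moreover have "a * ((u + v) / 2) * w = 1/2 * (a * u * w) + 1/2 * (a * v * w)" for a u v w :: real
          by (simp add: field_simps)
        ultimately show ?thesis by (simp only: id)
      qed
      then have "integral {0..1} (\<lambda>x. f x * cos (2 * pi * real k * x) * cos (2 * pi * x) ^ Suc j) =
        1/2 * integral {0..1} (\<lambda>x. f x * cos (2 * pi * real (Suc (Suc k')) * x) * cos (2 * pi * x) ^ j) +
        1/2 * integral {0..1} (\<lambda>x. f x * cos (2 * pi * real k' * x) * cos (2 * pi * x) ^ j)"
        by (simp only:) (subst Henstock_Kurzweil_Integration.integral_add,
           auto intro!: integrable_continuous_interval continuous_intros ci)
      then show ?thesis by (simp only: Suc.IH mult_zero_right add_0)
    qed
  qed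
  define h where "h c = f (arccos c / (2 * pi))" for c
  have hc: "continuous_on {-1..1} h"
    unfolding h_def by (intro continuous_on_compose2[OF cont] continuous_intros) auto
  have fh: "f x = h (cos (2 * pi * x))" if "x \<in> {0..1}" for x
  proof (cases "x \<le> 1/2")
    case True
    then have "arccos (cos (2 * pi * x)) = 2 * pi * x" using that by (intro arccos_cos) auto
    then show ?thesis by (simp add: h_def)
  next
    case False
    have "cos (2 * pi * x) = cos (2 * pi * (1 - x))"
      by (simp add: algebra_simps cos_diff)
    moreover have "arccos (cos (2 * pi * (1 - x))) = 2 * pi * (1 - x)"
      using that False by (intro arccos_cos) (auto simp: algebra_simps)
    ultimately have "h (cos (2 * pi * x)) = f (1 - x)" by (simp add: h_def)
    then show ?thesis using even by simp
  qed
  define B where "B = integral {0..1} (\<lambda>x. \<bar>f x\<bar>)"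
  have B: "integral {0..1} (\<lambda>x. (f x)\<^sup>2) \<le> e * B" if e: "e > 0" for e
  proof -
    obtain g where g: "real_polynomial_function g" "\<And>c. c \<in> {-1..1} \<Longrightarrow> \<bar>h c - g c\<bar> < e"
      using Stone_Weierstrass_real_polynomial_function[OF compact_Icc hc e] by blast
    obtain a n where an: "g = (\<lambda>x. \<Sum>i\<le>n. a i * x^i)"
      using g(1) unfolding real_polynomial_function_iff_sum by blast
    have gi: "integral {0..1} (\<lambda>x. f x * g (cos (2 * pi * x))) = 0"
    proof -
      have "integral {0..1} (\<lambda>x. f x * g (cos (2 * pi * x)))
         = integral {0..1} (\<lambda>x. \<Sum>i\<le>n. a i * (f x * cos (2 * pi * x) ^ i))"
        unfolding an by (simp add: sum_distrib_left mult_ac)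
      also have "\<dots> = (\<Sum>i\<le>n. integral {0..1} (\<lambda>x. a i * (f x * cos (2 * pi * x) ^ i)))"
        by (intro integral_sum) (auto intro!: integrable_continuous_interval continuous_intros ci)
      also have "\<dots> = 0" using mom[of 0] by simp
      finally show ?thesis .
    qed
    have gc: "continuous_on S (\<lambda>x. g (cos (2 * pi * x)))" for S
      unfolding an by (intro continuous_intros)
    have "integral {0..1} (\<lambda>x. (f x)\<^sup>2) = integral {0..1} (\<lambda>x. (f x)\<^sup>2 - f x * g (cos (2 * pi * x)))"
      by (subst Henstock_Kurzweil_Integration.integral_diff)
         (auto simp: gi intro!: integrable_continuous_interval continuous_intros ci gc)
    also have "\<dots> \<le> integral {0..1} (\<lambda>x. e * \<bar>f x\<bar>)"
    proof (rule integral_le)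
      fix x :: real assume x: "x \<in> {0..1}"
      have "(f x)\<^sup>2 - f x * g (cos (2 * pi * x)) = f x * (h (cos (2 * pi * x)) - g (cos (2 * pi * x)))"
        using fh[OF x] by (simp add: power2_eq_square algebra_simps)
      also have "\<dots> \<le> \<bar>f x\<bar> * \<bar>h (cos (2 * pi * x)) - g (cos (2 * pi * x))\<bar>"
        by (metis abs_ge_self abs_mult)
      also have "\<dots> \<le> \<bar>f x\<bar> * e"
        using g(2)[of "cos (2 * pi * x)"] by (intro mult_left_mono) auto
      finally show "(f x)\<^sup>2 - f x * g (cos (2 * pi * x)) \<le> e * \<bar>f x\<bar>" by (simp add: mult.commute)
    qed (auto intro!: integrable_continuous_interval continuous_intros ci gc)
    also have "\<dots> = e * B" by (simp add: B_def)
    finally show ?thesis .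
  qed
  have B0: "B \<ge> 0" unfolding B_def by (intro integral_nonneg integrable_continuous_interval continuous_intros ci) auto
  have "integral {0..1} (\<lambda>x. (f x)\<^sup>2) \<le> 0"
  proof (rule field_le_epsilon)
    fix e :: real assume "e > 0"
    then have "e / (B + 1) * B \<le> e" using B0 by (simp add: field_simps)
    then show "integral {0..1} (\<lambda>x. (f x)\<^sup>2) \<le> 0 + e"
      using B[of "e / (B + 1)"] \<open>e > 0\<close> B0 by simp
  qed
  moreover have "integral {0..1} (\<lambda>x. (f x)\<^sup>2) \<ge> 0"
    by (intro integral_nonneg integrable_continuous_interval continuous_intros ci) auto
  moreover have "((\<lambda>x. (f x)\<^sup>2) has_integral integral {0..1} (\<lambda>x. (f x)\<^sup>2)) {0..1}"
    by (intro integrable_integral integrable_continuous_interval continuous_intros ci)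
  ultimately have "((\<lambda>x. (f x)\<^sup>2) has_integral 0) (cbox 0 1)" by simp
  then have "(f x)\<^sup>2 = 0"
    by (intro has_integral_0_cbox_imp_0[of 0 1 "\<lambda>x. (f x)\<^sup>2" x]) (use X in \<open>auto intro!: continuous_intros ci\<close>)
  then show ?thesis by simp
qed

section \<open>Fourier transform of the Gaussian and Poisson summation\<close>

text \<open>A rescaled form of the characteristic function of the standard normal distribution;
  \<open>c\<close> makes \<open>std_normal_density (c * x)\<close> a multiple of
  \<open>exp (- pi * T * x\<^sup>2)\<close>.\<close>

lemma gauss_fourier:
  fixes T k :: real assumes T: "T > 0"
  shows "integrable lborel (\<lambda>x. exp (- pi * T * x\<^sup>2) * cos (2 * pi * k * x))"
    and "(LINT x|lborel. exp (- pi * T * x\<^sup>2) * cos (2 * pi * k * x)) = exp (- pi * k\<^sup>2 / T) / sqrt T"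
proof -
  define c where "c = sqrt (2 * pi * T)"
  have c: "c > 0" "c\<^sup>2 = 2 * pi * T" using T by (auto simp: c_def)
  define t where "t = 2 * pi * k / c"
  have t2: "t\<^sup>2 / 2 = pi * k\<^sup>2 / T"
    using c T by (simp add: t_def power_divide power_mult_distrib) (simp add: power2_eq_square field_simps)
  have ii: "integrable std_normal_distribution (\<lambda>x. iexp (t * x))"
    by (rule prob_space.integrable_iexp)
       (auto intro!: prob_space_normal_density)
  have "exp (- t\<^sup>2 / 2) = Re (char std_normal_distribution t)"
    by (simp only: char_std_normal_distribution Re_complex_of_real)
  also have "\<dots> = (LINT x|std_normal_distribution. Re (iexp (t * x)))"
    unfolding char_def using ii by (intro integral_Re[symmetric]) simp
  also have "\<dots> = (LINT x|std_normal_distribution. cos (t * x))"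
    by (intro Bochner_Integration.integral_cong refl) (simp add: Re_exp)
  also have "\<dots> = (LINT x|lborel. std_normal_density x *\<^sub>R cos (t * x))"
    by (rule integral_density) auto
  finally have 1: "(LINT x|lborel. std_normal_density x * cos (t * x)) = exp (- t\<^sup>2 / 2)" by simp
  have i1: "integrable lborel (\<lambda>x. std_normal_density x * cos (t * x))"
    by (rule Bochner_Integration.integrable_bound[OF integrable_normal_density[of 1 0]])
       (auto simp: abs_mult intro!: mult_left_le)
  have eq: "std_normal_density (0 + c * x) * cos (t * (0 + c * x))
      = (1 / sqrt (2 * pi)) * (exp (- pi * T * x\<^sup>2) * cos (2 * pi * k * x))" for x
    using c by (simp add: std_normal_density_def t_def power_mult_distrib mult.assoc)
  have i2: "integrable lborel (\<lambda>x. std_normal_density (0 + c * x) * cos (t * (0 + c * x)))"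
    using lborel_integrable_real_affine[OF i1, of c 0] c by simp
  have "integrable lborel (\<lambda>x. sqrt (2 * pi) * (1 / sqrt (2 * pi) * (exp (- pi * T * x\<^sup>2) * cos (2 * pi * k * x))))"
    using i2 unfolding eq by (rule integrable_mult_right)
  moreover have "sqrt (2 * pi) * (1 / sqrt (2 * pi) * z) = z" for z by simp
  ultimately show "integrable lborel (\<lambda>x. exp (- pi * T * x\<^sup>2) * cos (2 * pi * k * x))" by (simp only:)
  have "exp (- t\<^sup>2 / 2) = \<bar>c\<bar> *\<^sub>R (LINT x|lborel. std_normal_density (0 + c * x) * cos (t * (0 + c * x)))"
    unfolding 1[symmetric] using c by (intro lborel_integral_real_affine) auto
  also have "\<dots> = c / sqrt (2 * pi) * (LINT x|lborel. exp (- pi * T * x\<^sup>2) * cos (2 * pi * k * x))"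
    unfolding eq using c by simp
  also have "c / sqrt (2 * pi) = sqrt T" by (simp add: c_def real_sqrt_mult)
  finally show "(LINT x|lborel. exp (- pi * T * x\<^sup>2) * cos (2 * pi * k * x)) = exp (- pi * k\<^sup>2 / T) / sqrt T"
    using T t2 by (simp add: field_simps)
qed

text \<open>The unfolding step of Poisson summation, read from right to left. Half-open unit
  intervals make the decomposition of the line disjoint; the missing endpoint is negligible.\<close>

lemma integral_eq_infsum_unit_intervals:
  fixes f :: "real \<Rightarrow> real"
  assumes f: "integrable lborel f" and cont: "continuous_on UNIV f"
    and s: "(\<lambda>n::int. integral {0..1} (\<lambda>x. f (of_int n + x))) summable_on UNIV"
  shows "(LINT x|lborel. f x) = (\<Sum>\<^sub>\<infinity>n::int. integral {0..1} (\<lambda>x. f (of_int n + x)))"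
proof -
  define A where "A i = {real_of_int (int_decode i) ..< real_of_int (int_decode i) + 1}" for i
  have U: "(\<Union>i. A i) = UNIV"
  proof -
    have "x \<in> A (int_encode \<lfloor>x\<rfloor>)" for x by (simp add: A_def)
    then show ?thesis by blast
  qed
  have disj: "A i \<inter> A j = {}" if "i \<noteq> j" for i j
  proof (rule ccontr)
    assume "A i \<inter> A j \<noteq> {}"
    then obtain x where "x \<in> A i" "x \<in> A j" by auto
    then have "int_decode i = \<lfloor>x\<rfloor>" "int_decode j = \<lfloor>x\<rfloor>"
      unfolding A_def by (auto intro!: floor_unique[symmetric])
    then show False using that by (metis int_decode_inverse)
  qed
  have I: "(LINT x:A i|lborel. f x) = integral {0..1} (\<lambda>x. f (of_int (int_decode i) + x))" for i
  proof -
    define n where "n = real_of_int (int_decode i)"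
    have "set_integrable lborel (A i) f"
      using f unfolding set_integrable_def A_def by (intro integrable_mult_indicator) auto
    then have "(LINT x:A i|lborel. f x) = integral (A i) f" by (rule set_borel_integral_eq_integral)
    also have "\<dots> = integral {n..n+1} f"
      unfolding A_def n_def[symmetric]
      by (intro integral_spike_set negligible_subset[OF negligible_sing[of "n+1"]]) auto
    also have "\<dots> = integral {0..1} (\<lambda>x. f (n + x))"
      using integral_shift_Icc_real[of 0 1 f n] by (simp add: o_def add.commute)
    finally show ?thesis by (simp add: n_def)
  qed
  have "(LINT x|lborel. f x) = (LINT x:(\<Union>i. A i)|lborel. f x)"
    by (simp add: U set_lebesgue_integral_def)
  also have "\<dots> = (\<Sum>i. (LINT x:A i|lborel. f x))"
    by (rule lebesgue_integral_countable_add)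
       (use f disj U in \<open>auto simp: A_def set_integrable_def\<close>)
  also have "\<dots> = (\<Sum>i. integral {0..1} (\<lambda>x. f (of_int (int_decode i) + x)))" by (simp add: I)
  also have "\<dots> = (\<Sum>\<^sub>\<infinity>n::int. integral {0..1} (\<lambda>x. f (of_int n + x)))"
  proof (intro sums_unique[symmetric] has_sum_imp_sums)
    show "((\<lambda>i. integral {0..1} (\<lambda>x. f (of_int (int_decode i) + x))) has_sum
        (\<Sum>\<^sub>\<infinity>n::int. integral {0..1} (\<lambda>x. f (of_int n + x)))) UNIV"
      by (subst has_sum_reindex_bij_betw[OF bij_int_decode]) (use s in auto)
  qed
  finally show ?thesis .
qed

text \<open>From \<open>n\<^sup>2 \<le> 2 * (n + x)\<^sup>2 + 2 * x\<^sup>2\<close>: for bounded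
  \<open>x\<close> a majorant independent of \<open>x\<close>, at half the rate.\<close>

lemma gauss_shift_bound:
  fixes x :: real assumes "T > 0" "\<bar>x\<bar> \<le> R"
  shows "exp (- pi * T * (of_int n + x)\<^sup>2) \<le> exp (pi * T * R\<^sup>2) * exp (- (pi * T / 2) * (of_int n)\<^sup>2)"
proof -
  have "x\<^sup>2 \<le> R\<^sup>2" using assms(2) by (metis abs_ge_zero power2_abs power_mono)
  moreover have "(of_int n)\<^sup>2 \<le> 2 * (of_int n + x)\<^sup>2 + 2 * x\<^sup>2"
    using zero_le_power2[of "of_int n + 2 * x"] by (simp add: power2_eq_square algebra_simps)
  ultimately have "(of_int n)\<^sup>2 / 2 - R\<^sup>2 \<le> (of_int n + x)\<^sup>2" by linarith
  then have "pi * T * ((of_int n)\<^sup>2 / 2 - R\<^sup>2) \<le> pi * T * (of_int n + x)\<^sup>2"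
    using assms by (intro mult_left_mono) auto
  then show ?thesis by (simp add: exp_add[symmetric] algebra_simps)
qed

lemma summable_on_gauss_shift:
  fixes x :: real assumes "T > 0"
  shows "(\<lambda>n::int. exp (- pi * T * (of_int n + x)\<^sup>2)) summable_on UNIV"
  by (rule summable_on_abs_le[OF summable_on_cmult_right[OF summable_on_gauss_int[of "pi * T / 2"]]])
     (use gauss_shift_bound[OF assms, of x "\<bar>x\<bar>"] assms in auto)

lemma summable_on_gauss_cos:
  fixes x :: real assumes "T > 0"
  shows "(\<lambda>k::int. exp (- pi * (of_int k)\<^sup>2 / T) * cos (2 * pi * of_int k * x)) summable_on UNIV"
  by (rule summable_on_abs_le[OF summable_on_gauss_int[of "pi / T"]])
     (use assms in \<open>auto simp: abs_mult intro!: mult_left_le\<close>)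

lemma gauss_deriv_bound:
  fixes t c :: real assumes "c > 0" shows "\<bar>2 * c * t * exp (- c * t\<^sup>2)\<bar> \<le> 2 * (c + 1) * exp (- c * t\<^sup>2 / 2)"
proof -
  have "\<bar>t\<bar> \<le> 1 + t\<^sup>2 / 2"
    using zero_le_power2[of "\<bar>t\<bar> - 1"] by (simp add: power2_eq_square algebra_simps)
  then have "c * \<bar>t\<bar> \<le> c * (1 + t\<^sup>2 / 2)" using assms by (intro mult_left_mono) auto
  also have "\<dots> \<le> (c + 1) * (1 + c * t\<^sup>2 / 2)"
  proof -
    have "0 \<le> c * (c * t\<^sup>2)" using assms by simp
    then show ?thesis by (simp add: algebra_simps add_divide_distrib)
  qed
  also have "\<dots> \<le> (c + 1) * exp (c * t\<^sup>2 / 2)" using assms exp_ge_add_one_self by (intro mult_left_mono) auto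
  finally have "2 * (c * \<bar>t\<bar>) * exp (- c * t\<^sup>2) \<le> 2 * ((c + 1) * exp (c * t\<^sup>2 / 2)) * exp (- c * t\<^sup>2)"
    by (intro mult_right_mono mult_left_mono) auto
  also have "\<dots> = 2 * (c + 1) * (exp (c * t\<^sup>2 / 2) * exp (- c * t\<^sup>2))" by simp
  also have "exp (c * t\<^sup>2 / 2) * exp (- c * t\<^sup>2) = exp (- c * t\<^sup>2 / 2)"
    by (simp add: exp_add[symmetric])
  finally show ?thesis using assms by (simp add: abs_mult mult_ac)
qed

lemma continuous_gauss_shift_sum:
  assumes "T > 0" shows "continuous_on UNIV (\<lambda>x. \<Sum>\<^sub>\<infinity>n::int. exp (- pi * T * (of_int n + x)\<^sup>2))"
proof (rule continuous_at_imp_continuous_on, rule ballI)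
  fix x :: real
  define R where "R = \<bar>x\<bar> + 1"
  have "((\<lambda>x. \<Sum>\<^sub>\<infinity>n::int. exp (- pi * T * (of_int n + x)\<^sup>2)) has_real_derivative
     (\<Sum>\<^sub>\<infinity>n::int. - (2 * (pi * T) * (of_int n + x) * exp (- (pi * T) * (of_int n + x)\<^sup>2)))) (at x)"
  proof (rule has_real_derivative_infsum[where S = "{-R<..<R}" and
        M = "\<lambda>n. 2 * (pi * T + 1) * (exp (pi * (T/2) * R\<^sup>2) * exp (- (pi * (T/2) / 2) * (of_int n)\<^sup>2))"])
    fix n :: int and t assume t: "t \<in> {-R<..<R}"
    show "((\<lambda>x. exp (- pi * T * (of_int n + x)\<^sup>2)) has_real_derivative
      - (2 * (pi * T) * (of_int n + t) * exp (- (pi * T) * (of_int n + t)\<^sup>2))) (at t)"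
      by (auto intro!: derivative_eq_intros simp: algebra_simps)
    have "\<bar>- (2 * (pi * T) * (of_int n + t) * exp (- (pi * T) * (of_int n + t)\<^sup>2))\<bar>
       \<le> 2 * (pi * T + 1) * exp (- (pi * T) * (of_int n + t)\<^sup>2 / 2)"
      using gauss_deriv_bound[of "pi * T"] assms by simp
    also have "\<dots> \<le> 2 * (pi * T + 1) * (exp (pi * (T/2) * R\<^sup>2) * exp (- (pi * (T/2) / 2) * (of_int n)\<^sup>2))"
      using gauss_shift_bound[of "T/2" t R n] assms t by (intro mult_left_mono) auto
    finally show "\<bar>- (2 * (pi * T) * (of_int n + t) * exp (- (pi * T) * (of_int n + t)\<^sup>2))\<bar> \<le> \<dots>" .
  next
    show "(\<lambda>n::int. 2 * (pi * T + 1) * (exp (pi * (T/2) * R\<^sup>2) * exp (- (pi * (T/2) / 2) * (of_int n)\<^sup>2))) summable_on UNIV"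
      using assms by (intro summable_on_cmult_right summable_on_gauss_int) auto
  qed (use assms summable_on_gauss_shift in \<open>auto simp: R_def\<close>)
  then show "isCont (\<lambda>x. \<Sum>\<^sub>\<infinity>n::int. exp (- pi * T * (of_int n + x)\<^sup>2)) x" by (rule DERIV_isCont)
qed

lemma continuous_gauss_cos_sum:
  assumes T: "T > 0" shows "continuous_on UNIV (\<lambda>x. \<Sum>\<^sub>\<infinity>k::int. exp (- pi * (of_int k)\<^sup>2 / T) * cos (2 * pi * of_int k * x))"
proof (rule continuous_at_imp_continuous_on, rule ballI)
  fix x :: real
  define c where "c = pi / T"
  have c: "c > 0" using T by (simp add: c_def)
  have "((\<lambda>x. \<Sum>\<^sub>\<infinity>k::int. exp (- pi * (of_int k)\<^sup>2 / T) * cos (2 * pi * of_int k * x)) has_real_derivative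
     (\<Sum>\<^sub>\<infinity>k::int. - (exp (- pi * (of_int k)\<^sup>2 / T) * (2 * pi * of_int k * sin (2 * pi * of_int k * x))))) (at x)"
  proof (rule has_real_derivative_infsum[where S = UNIV and
        M = "\<lambda>k. pi / c * (2 * (c + 1) * exp (- (c / 2) * (of_int k)\<^sup>2))"])
    fix k :: int and t :: real
    show "((\<lambda>x. exp (- pi * (of_int k)\<^sup>2 / T) * cos (2 * pi * of_int k * x)) has_real_derivative
      - (exp (- pi * (of_int k)\<^sup>2 / T) * (2 * pi * of_int k * sin (2 * pi * of_int k * t)))) (at t)"
      by (auto intro!: derivative_eq_intros)
    have "\<bar>- (exp (- pi * (of_int k)\<^sup>2 / T) * (2 * pi * of_int k * sin (2 * pi * of_int k * t)))\<bar>
       = (exp (- c * (of_int k)\<^sup>2) * (2 * pi * \<bar>of_int k\<bar>)) * \<bar>sin (2 * pi * of_int k * t)\<bar>"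
      by (simp add: abs_mult c_def mult_ac)
    also have "\<dots> \<le> exp (- c * (of_int k)\<^sup>2) * (2 * pi * \<bar>of_int k\<bar>)"
      by (intro mult_left_le) auto
    also have "\<dots> = pi / c * \<bar>2 * c * of_int k * exp (- c * (of_int k)\<^sup>2)\<bar>"
      using c by (simp add: abs_mult)
    also have "\<dots> \<le> pi / c * (2 * (c + 1) * exp (- c * (of_int k)\<^sup>2 / 2))"
      using c by (intro mult_left_mono gauss_deriv_bound) auto
    finally show "\<bar>- (exp (- pi * (of_int k)\<^sup>2 / T) * (2 * pi * of_int k * sin (2 * pi * of_int k * t)))\<bar>
      \<le> pi / c * (2 * (c + 1) * exp (- (c / 2) * (of_int k)\<^sup>2))" by simp
  next
    show "(\<lambda>k::int. pi / c * (2 * (c + 1) * exp (- (c / 2) * (of_int k)\<^sup>2))) summable_on UNIV"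
      using c by (intro summable_on_cmult_right summable_on_gauss_int) auto
  qed (use T summable_on_gauss_cos in auto)
  then show "isCont (\<lambda>x. \<Sum>\<^sub>\<infinity>k::int. exp (- pi * (of_int k)\<^sup>2 / T) * cos (2 * pi * of_int k * x)) x" by (rule DERIV_isCont)
qed

lemma integral_cos_int: "integral {0..1} (\<lambda>x. cos (2 * pi * of_int n * x)) = of_bool (n = 0)"
proof (cases "n = 0")
  case False
  have "((\<lambda>x. cos (2 * pi * of_int n * x)) has_integral
     (sin (2 * pi * of_int n * 1) / (2 * pi * of_int n) - sin (2 * pi * of_int n * 0) / (2 * pi * of_int n))) {0..1}"
    by (rule fundamental_theorem_of_calculus)
       (use False in \<open>auto simp: has_real_derivative_iff_has_vector_derivative[symmetric] intro!: derivative_eq_intros\<close>)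
  moreover have "sin (2 * pi * of_int n) = 0"
    using sin_int_2pin[of n] by (simp add: mult_ac)
  ultimately show ?thesis using False by (simp add: integral_unique)
qed simp

text \<open>Both sides are continuous, even and of period 1, and their cosine coefficients agree: on
  the left the integral over a period unfolds to the Fourier transform of the Gaussian, on the right
  orthogonality singles out one frequency. Uniqueness on \<open>{0..1}\<close> extends by
  periodicity.\<close>

theorem poisson_gauss:
  fixes T x :: real assumes T: "T > 0"
  shows "sqrt T * (\<Sum>\<^sub>\<infinity>n::int. exp (- pi * T * (of_int n + x)\<^sup>2)) =
         (\<Sum>\<^sub>\<infinity>k::int. exp (- pi * (of_int k)\<^sup>2 / T) * cos (2 * pi * of_int k * x))"
proof -
  define P where "P x = sqrt T * (\<Sum>\<^sub>\<infinity>n::int. exp (- pi * T * (of_int n + x)\<^sup>2))" for x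
  define Q where "Q x = (\<Sum>\<^sub>\<infinity>k::int. exp (- pi * (of_int k)\<^sup>2 / T) * cos (2 * pi * of_int k * x))" for x
  have Pc: "continuous_on S P" for S
    unfolding P_def by (intro continuous_intros continuous_on_subset[OF continuous_gauss_shift_sum[OF T]]) auto
  have Qc: "continuous_on S Q" for S
    unfolding Q_def by (intro continuous_on_subset[OF continuous_gauss_cos_sum[OF T]]) auto
  have Pper: "P (x + of_int j) = P x" for x j
  proof -
    have "(\<Sum>\<^sub>\<infinity>n::int. exp (- pi * T * (of_int n + (x + of_int j))\<^sup>2)) = (\<Sum>\<^sub>\<infinity>n::int. exp (- pi * T * (of_int n + x)\<^sup>2))"
      by (rule infsum_reindex_bij_witness[where i = "\<lambda>n. n - j" and j = "\<lambda>n. n + j"]) (auto simp: algebra_simps)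
    then show ?thesis by (simp add: P_def)
  qed
  have Peven: "P (- x) = P x" for x
  proof -
    have "(\<Sum>\<^sub>\<infinity>n::int. exp (- pi * T * (of_int n + (- x))\<^sup>2)) = (\<Sum>\<^sub>\<infinity>n::int. exp (- pi * T * (of_int n + x)\<^sup>2))"
      by (rule infsum_reindex_bij_witness[where i = "\<lambda>n. - n" and j = "\<lambda>n. - n"])
         (auto simp: power2_eq_square algebra_simps)
    then show ?thesis by (simp add: P_def)
  qed
  have cos_per: "cos (2 * pi * of_int k * (x + of_int j)) = cos (2 * pi * of_int k * x)" for k j :: int and x
  proof -
    have "cos (2 * pi * of_int k * (x + of_int j)) = cos (2 * pi * of_int k * x + 2 * pi * of_int (k * j))"
      by (simp add: algebra_simps)
    also have "\<dots> = cos (2 * pi * of_int k * x)"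
      unfolding cos_add using sin_int_2pin[of "k*j"] cos_int_2pin[of "k*j"] by (simp add: mult_ac)
    finally show ?thesis .
  qed
  have Qper: "Q (x + of_int j) = Q x" for x j unfolding Q_def by (simp only: cos_per)
  have Qeven: "Q (- x) = Q x" for x by (simp add: Q_def)
  have Pco: "integral {0..1} (\<lambda>x. P x * cos (2 * pi * real k * x)) = exp (- pi * (real k)\<^sup>2 / T)" for k :: nat
  proof -
    let ?f = "\<lambda>(n::int) x. exp (- pi * T * (of_int n + x)\<^sup>2) * cos (2 * pi * real k * x)"
    let ?M = "\<lambda>n::int. exp (pi * T * 2\<^sup>2) * exp (- (pi * T / 2) * (of_int n)\<^sup>2)"
    have b: "\<bar>?f n t\<bar> \<le> ?M n" if "t \<in> {-1..2}" for n t
    proof -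
      have "\<bar>?f n t\<bar> \<le> exp (- pi * T * (of_int n + t)\<^sup>2)" by (auto simp: abs_mult intro!: mult_left_le)
      also have "\<dots> \<le> ?M n" using that by (intro gauss_shift_bound T) auto
      finally show ?thesis .
    qed
    have Ms: "?M summable_on UNIV" using T by (intro summable_on_cmult_right summable_on_gauss_int) auto
    have fc: "continuous_on UNIV (?f n)" for n by (intro continuous_intros)
    have I: "((\<lambda>t. \<Sum>\<^sub>\<infinity>i. ?f i t) has_integral (\<Sum>\<^sub>\<infinity>i. integral {0..1} (?f i))) {0..1}"
      "(\<lambda>i. integral {0..1} (?f i)) summable_on UNIV"
      by (rule integral_infsum[OF infinite_UNIV_int fc Ms b]; assumption)+
    have cs: "cos (2 * pi * real k * (of_int n + x)) = cos (2 * pi * real k * x)" for n :: int and x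
      using cos_per[of "int k" x n] by (simp add: add.commute)
    have "(LINT x|lborel. exp (- pi * T * x\<^sup>2) * cos (2 * pi * real k * x)) = (\<Sum>\<^sub>\<infinity>n::int. integral {0..1} (?f n))"
    proof (subst integral_eq_infsum_unit_intervals)
      show "integrable lborel (\<lambda>x. exp (- pi * T * x\<^sup>2) * cos (2 * pi * real k * x))" by (rule gauss_fourier(1)[OF T])
      show "continuous_on UNIV (\<lambda>x. exp (- pi * T * x\<^sup>2) * cos (2 * pi * real k * x))" by (intro continuous_intros)
    qed (use I(2) in \<open>simp_all only: cs\<close>)
    moreover have "P x * cos (2 * pi * real k * x) = sqrt T * (\<Sum>\<^sub>\<infinity>i. ?f i x)" for x
      unfolding P_def by (simp add: infsum_cmult_left')
    ultimately show ?thesis using gauss_fourier(2)[OF T, of k] integral_unique[OF I(1)] T by simp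
  qed
  have Qco: "integral {0..1} (\<lambda>x. Q x * cos (2 * pi * real k * x)) = exp (- pi * (real k)\<^sup>2 / T)" for k :: nat
  proof -
    let ?f = "\<lambda>(n::int) x. exp (- pi * (of_int n)\<^sup>2 / T) * cos (2 * pi * of_int n * x) * cos (2 * pi * real k * x)"
    let ?M = "\<lambda>n::int. exp (- (pi / T) * (of_int n)\<^sup>2)"
    have b: "\<bar>?f n t\<bar> \<le> ?M n" for n t
      by (auto simp: abs_mult mult.assoc intro!: mult_left_le mult_le_one)
    have Ms: "?M summable_on UNIV" using T by (intro summable_on_gauss_int) auto
    have fc: "continuous_on UNIV (?f n)" for n using T by (intro continuous_intros) auto
    have I: "((\<lambda>t. \<Sum>\<^sub>\<infinity>i. ?f i t) has_integral (\<Sum>\<^sub>\<infinity>i. integral {0..1} (?f i))) {0..1}"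
      by (rule integral_infsum[OF infinite_UNIV_int fc Ms b])
    have prod: "cos (2 * pi * of_int n * x) * cos (2 * pi * real k * x) =
        1/2 * cos (2 * pi * of_int (n - int k) * x) + 1/2 * cos (2 * pi * of_int (n + int k) * x)" for n x
      unfolding cos_times_cos by (simp add: algebra_simps)
    \<comment> \<open>For \<open>k = 0\<close> the two indicators coincide and add up to the full
      coefficient, so this frequency needs no separate case.\<close>
    have fi: "integral {0..1} (?f n) = exp (- pi * (of_int n)\<^sup>2 / T) * (1/2 * of_bool (n = int k) + 1/2 * of_bool (n = - int k))" for n
    proof -
      have "integral {0..1} (\<lambda>x. 1/2 * cos (2 * pi * of_int (n - int k) * x) + 1/2 * cos (2 * pi * of_int (n + int k) * x))
        = 1/2 * integral {0..1} (\<lambda>x. cos (2 * pi * of_int (n - int k) * x)) + 1/2 * integral {0..1} (\<lambda>x. cos (2 * pi * of_int (n + int k) * x))"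
        by (subst Henstock_Kurzweil_Integration.integral_add) (auto intro!: integrable_continuous_interval continuous_intros)
      also have "\<dots> = 1/2 * of_bool (n = int k) + 1/2 * of_bool (n = - int k)"
        unfolding integral_cos_int by (auto simp: eq_neg_iff_add_eq_0)
      moreover have "?f n = (\<lambda>x. exp (- pi * (of_int n)\<^sup>2 / T) *
          (1/2 * cos (2 * pi * of_int (n - int k) * x) + 1/2 * cos (2 * pi * of_int (n + int k) * x)))"
        by (rule ext) (subst mult.assoc, subst prod, rule refl)
      ultimately show ?thesis by (simp only: integral_mult_right)
    qed
    have single: "(\<Sum>\<^sub>\<infinity>n::int. c n * of_bool (n = j)) = (c j :: real)" "(\<lambda>n::int. c n * of_bool (n = j)) summable_on UNIV"
      for c and j :: int
    proof -
      have "((\<lambda>n::int. c n * of_bool (n = j)) has_sum c j) UNIV"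
        by (rule has_sum_finite_neutralI[of "{j}"]) auto
      then show "(\<Sum>\<^sub>\<infinity>n::int. c n * of_bool (n = j)) = (c j :: real)" "(\<lambda>n::int. c n * of_bool (n = j)) summable_on UNIV"
        by (auto simp: has_sum_iff)
    qed
    have "(\<Sum>\<^sub>\<infinity>n. integral {0..1} (?f n)) = (\<Sum>\<^sub>\<infinity>n::int. (exp (- pi * (of_int n)\<^sup>2 / T) / 2) * of_bool (n = int k) + (exp (- pi * (of_int n)\<^sup>2 / T) / 2) * of_bool (n = - int k))"
      unfolding fi by (intro infsum_cong) (simp add: algebra_simps)
    also have "\<dots> = exp (- pi * (real k)\<^sup>2 / T) / 2 + exp (- pi * (real k)\<^sup>2 / T) / 2"
      by (subst infsum_add) (simp_all only: single, simp_all)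
    finally have "(\<Sum>\<^sub>\<infinity>n. integral {0..1} (?f n)) = exp (- pi * (real k)\<^sup>2 / T)" by simp
    moreover have "Q x * cos (2 * pi * real k * x) = (\<Sum>\<^sub>\<infinity>i. ?f i x)" for x
      unfolding Q_def by (simp add: infsum_cmult_left')
    ultimately show ?thesis using integral_unique[OF I] by simp
  qed
  have "P x - Q x = 0" if "x \<in> {0..1}" for x
  proof (rule even_periodic_eq_0[OF _ _ _ that, of "\<lambda>x. P x - Q x"])
    show "continuous_on UNIV (\<lambda>x. P x - Q x)" by (intro continuous_intros Pc Qc)
    show "P (1 - x) - Q (1 - x) = P x - Q x" for x
      using Pper[of "-x" 1] Qper[of "-x" 1] Peven Qeven by simp
    show "integral {0..1} (\<lambda>x. (P x - Q x) * cos (2 * pi * real k * x)) = 0" for k :: nat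
      unfolding left_diff_distrib
      by (subst Henstock_Kurzweil_Integration.integral_diff)
         (auto simp: Pco Qco intro!: integrable_continuous_interval continuous_intros Pc Qc)
  qed
  from this[of "frac x"] have "P (frac x) = Q (frac x)"
    using frac_lt_1[of x] by (simp add: less_imp_le)
  moreover have "x = frac x + of_int \<lfloor>x\<rfloor>" by (simp add: frac_def)
  ultimately have "P x = Q x" by (metis Pper Qper)
  then show ?thesis by (simp add: P_def Q_def)
qed

section \<open>The normalised theta function and its dual forms\<close>

text \<open>With \<open>z = x + i y\<close> this is \<open>|m z + n|^2 / Im z\<close>, a binary
  quadratic form of determinant 1 in \<open>m\<close> and \<open>n\<close>.\<close>

definition quad :: "real \<Rightarrow> real \<Rightarrow> int \<Rightarrow> int \<Rightarrow> real" where
  "quad x y m n = ((of_int m * x + of_int n)\<^sup>2 + (of_int m * y)\<^sup>2) / y"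

text \<open>The factor \<open>sqrt s\<close> makes this invariant under \<open>s \<mapsto> 1 / s\<close>; \<open>ntheta'\<close> is \<open>s\<close> times its derivative in \<open>s\<close>.\<close>

definition ntheta :: "real \<Rightarrow> real \<Rightarrow> real \<Rightarrow> real" where
  "ntheta s x y = sqrt s * (\<Sum>\<^sub>\<infinity>(m,n). exp (- (pi * s * quad x y m n)))"

definition ntheta' :: "real \<Rightarrow> real \<Rightarrow> real \<Rightarrow> real" where
  "ntheta' s x y = sqrt s * (\<Sum>\<^sub>\<infinity>(m,n). (1/2 - pi * s * quad x y m n) * exp (- (pi * s * quad x y m n)))"

lemma quad_nonneg: "y > 0 \<Longrightarrow> quad x y m n \<ge> 0"
  by (simp add: quad_def)

text \<open>Uniformity over a compact range of heights is what dominating the derivative in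
  \<open>y\<close> requires; the choice \<open>l = u\<close> gives plain summability and
  finiteness.\<close>

lemma quad_lower:
  assumes "0 < l" "l \<le> u"
  obtains \<kappa> where "\<kappa> > 0" "\<And>y m n. l \<le> y \<Longrightarrow> y \<le> u \<Longrightarrow> \<kappa> * ((of_int m)\<^sup>2 + (of_int n)\<^sup>2) \<le> quad x y m n"
proof
  define C where "C = 2 + (2 * x\<^sup>2 + 1) / l\<^sup>2"
  have C: "C > 0" unfolding C_def by (intro add_pos_nonneg) auto
  show "1 / (u * C) > 0" using assms C by simp
  fix y m n assume y: "l \<le> y" "y \<le> u"
  have "((of_int n)\<^sup>2 :: real) \<le> 2 * (of_int m * x + of_int n)\<^sup>2 + 2 * (of_int m * x)\<^sup>2"
    using zero_le_power2[of "of_int n + 2 * (of_int m * x)"] by (simp add: power2_eq_square algebra_simps)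
  then have 1: "((of_int m)\<^sup>2 + (of_int n)\<^sup>2 :: real) \<le> 2 * (of_int m * x + of_int n)\<^sup>2 + (2 * x\<^sup>2 + 1) * (of_int m)\<^sup>2"
    by (simp add: power_mult_distrib algebra_simps)
  have "l\<^sup>2 \<le> y\<^sup>2" using assms y by (intro power_mono) auto
  then have "(of_int m)\<^sup>2 * l\<^sup>2 \<le> (of_int m)\<^sup>2 * y\<^sup>2" by (intro mult_left_mono) auto
  then have "(of_int m)\<^sup>2 \<le> (of_int m * y)\<^sup>2 / l\<^sup>2" using assms by (simp add: field_simps power_mult_distrib)
  then have "(2 * x\<^sup>2 + 1) * (of_int m)\<^sup>2 \<le> (2 * x\<^sup>2 + 1) * ((of_int m * y)\<^sup>2 / l\<^sup>2)"
    by (intro mult_left_mono) auto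
  moreover have "C * ((of_int m * x + of_int n)\<^sup>2 + (of_int m * y)\<^sup>2) =
     2 * (of_int m * x + of_int n)\<^sup>2 + (2 * x\<^sup>2 + 1) * ((of_int m * y)\<^sup>2 / l\<^sup>2) +
     (2 * (of_int m * y)\<^sup>2 + (2 * x\<^sup>2 + 1) / l\<^sup>2 * (of_int m * x + of_int n)\<^sup>2)"
    by (simp add: C_def algebra_simps add_divide_distrib)
  moreover have "0 \<le> 2 * (of_int m * y)\<^sup>2 + (2 * x\<^sup>2 + 1) / l\<^sup>2 * (of_int m * x + of_int n)\<^sup>2"
    by (intro add_nonneg_nonneg mult_nonneg_nonneg divide_nonneg_nonneg) auto
  ultimately have 2: "(of_int m)\<^sup>2 + (of_int n)\<^sup>2 \<le> C * ((of_int m * x + of_int n)\<^sup>2 + (of_int m * y)\<^sup>2)"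
    using 1 by linarith
  have "1 / (u * C) * ((of_int m)\<^sup>2 + (of_int n)\<^sup>2) \<le> 1 / (u * C) * (C * ((of_int m * x + of_int n)\<^sup>2 + (of_int m * y)\<^sup>2))"
    using assms C 2 by (intro mult_left_mono) auto
  also have "\<dots> = ((of_int m * x + of_int n)\<^sup>2 + (of_int m * y)\<^sup>2) / u" using C by simp
  also have "\<dots> \<le> quad x y m n"
    unfolding quad_def using assms y by (intro divide_left_mono) auto
  finally show "1 / (u * C) * ((of_int m)\<^sup>2 + (of_int n)\<^sup>2) \<le> quad x y m n" .
qed

lemma infinite_UNIV_int2: "infinite (UNIV :: (int \<times> int) set)"
  by (metis finite_cartesian_productD1 UNIV_Times_UNIV UNIV_not_empty infinite_UNIV_int)

lemma summable_exp_quad: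
  assumes "c > 0" "y > 0" shows "(\<lambda>(m,n). exp (- (c * quad x y m n))) summable_on UNIV"
proof -
  obtain \<kappa> where k: "\<kappa> > 0" "\<And>m n. \<kappa> * ((of_int m)\<^sup>2 + (of_int n)\<^sup>2) \<le> quad x y m n"
    by (rule quad_lower[of y y x]) (use assms in \<open>auto intro: that\<close>)
  show ?thesis
  proof (rule summable_on_abs_le[OF summable_on_gauss_int2[of "c * \<kappa>"]])
    show "c * \<kappa> > 0" using assms k(1) by simp
    fix p :: "int \<times> int"
    obtain m n where p: "p = (m,n)" by force
    have "c * \<kappa> * ((of_int m)\<^sup>2 + (of_int n)\<^sup>2) \<le> c * quad x y m n"
      using mult_left_mono[OF k(2)[of m n], of c] assms(1) by (simp add: mult.assoc)
    then show "\<bar>case p of (m,n) \<Rightarrow> exp (- (c * quad x y m n))\<bar> \<le>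
        (case p of (m,n) \<Rightarrow> exp (- (c * \<kappa>) * ((of_int m)\<^sup>2 + (of_int n)\<^sup>2)))"
      by (simp add: p)
  qed
qed

lemma summable_ntheta':
  assumes "s > 0" "y > 0"
  shows "(\<lambda>(m,n). (1/2 - pi * s * quad x y m n) * exp (- (pi * s * quad x y m n))) summable_on UNIV"
proof (rule summable_on_abs_le[OF summable_on_cmult_right[OF summable_exp_quad[of "pi * s / 2" y x], of 2]])
  fix p :: "int \<times> int"
  obtain m n where p: "p = (m,n)" by force
  show "\<bar>case p of (m,n) \<Rightarrow> (1/2 - pi * s * quad x y m n) * exp (- (pi * s * quad x y m n))\<bar> \<le>
      2 * (case p of (m,n) \<Rightarrow> exp (- (pi * s / 2 * quad x y m n)))"
    using exp_absorb1'[of "pi * s * quad x y m n"] quad_nonneg[OF assms(2), of x m n] assms by (simp add: p)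
qed (use assms in auto)

lemma ntheta_has_derivative:
  assumes s: "s > 0" and y: "y > 0"
  shows "((\<lambda>s. ntheta s x y) has_real_derivative ntheta' s x y / s) (at s)"
proof -
  define f where "f = (\<lambda>(m,n) t. sqrt t * exp (- (pi * t * quad x y m n)))"
  define f' where "f' = (\<lambda>(m,n) t. ((1/2 - pi * t * quad x y m n) * exp (- (pi * t * quad x y m n))) / sqrt t)"
  have "((\<lambda>t. \<Sum>\<^sub>\<infinity>i. f i t) has_real_derivative (\<Sum>\<^sub>\<infinity>i. f' i s)) (at s)"
  proof (rule has_real_derivative_infsum[OF infinite_UNIV_int2, where S = "{s/2<..<2 * s}"
        and M = "\<lambda>(m,n). 2 / sqrt (s/2) * exp (- (pi * s / 4 * quad x y m n))"])
    fix i :: "int \<times> int" and t :: real assume t: "t \<in> {s/2<..<2 * s}"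
    then have t0: "t > 0" using s by auto
    obtain m n where i: "i = (m,n)" by force
    have st: "1 / (sqrt t * 2) = inverse (sqrt t) / 2" "sqrt t = t * inverse (sqrt t)"
      using t0 by (auto simp: field_simps)
    show "(f i has_real_derivative f' i t) (at t)"
      unfolding f_def f'_def i prod.case using t0
      by (auto intro!: derivative_eq_intros simp: field_simps)
    have "\<bar>f' i t\<bar> = \<bar>(1/2 - pi * t * quad x y m n) * exp (- (pi * t * quad x y m n))\<bar> / sqrt t"
      using t0 by (simp add: f'_def i)
    also have "\<dots> \<le> 2 * exp (- (pi * t * quad x y m n) / 2) / sqrt t"
      using exp_absorb1'[of "pi * t * quad x y m n"] quad_nonneg[OF y] t0 by (intro divide_right_mono) auto
    also have "\<dots> \<le> 2 * exp (- (pi * s / 4 * quad x y m n)) / sqrt (s / 2)"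
    proof (rule frac_le)
      have "pi * quad x y m n * (s / 2) \<le> pi * quad x y m n * t"
        using t quad_nonneg[OF y] by (intro mult_left_mono) auto
      then show "2 * exp (- (pi * t * quad x y m n) / 2) \<le> 2 * exp (- (pi * s / 4 * quad x y m n))"
        by (simp add: algebra_simps)
    qed (use t s in auto)
    finally show "\<bar>f' i t\<bar> \<le> (case i of (m,n) \<Rightarrow> 2 / sqrt (s/2) * exp (- (pi * s / 4 * quad x y m n)))"
      by (simp add: i)
  next
    show "(\<lambda>(m,n). 2 / sqrt (s/2) * exp (- (pi * s / 4 * quad x y m n))) summable_on UNIV"
      using summable_on_cmult_right[OF summable_exp_quad[of "pi * s / 4" y x], of "2 / sqrt (s/2)"] s y
      by (simp add: case_prod_unfold)
  next
    fix t assume "t \<in> {s/2<..<2 * s}"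
    then show "(\<lambda>i. f i t) summable_on UNIV"
      using summable_on_cmult_right[OF summable_exp_quad[of "pi * t" y x], of "sqrt t"] s y
      by (simp add: f_def case_prod_unfold)
  qed (use s in auto)
  moreover have "(\<Sum>\<^sub>\<infinity>i. f i t) = ntheta t x y" for t
    unfolding ntheta_def f_def by (simp add: case_prod_unfold infsum_cmult_right')
  moreover have "(\<Sum>\<^sub>\<infinity>i. f' i s) = ntheta' s x y / s"
  proof -
    have "(\<Sum>\<^sub>\<infinity>i. f' i s) = (\<Sum>\<^sub>\<infinity>i. inverse (sqrt s) * (case i of (m,n) \<Rightarrow> (1/2 - pi * s * quad x y m n) * exp (- (pi * s * quad x y m n))))"
      by (simp only: f'_def case_prod_unfold divide_inverse mult_ac)
    also have "\<dots> = ntheta' s x y / s"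
    proof -
      have "sqrt s / s = inverse (sqrt s)" using s by (intro sqrt_divide_self_eq) simp
      then have "inverse (sqrt s) * X = sqrt s * X / s" for X by (simp only: times_divide_eq_left[symmetric])
      then show ?thesis unfolding infsum_cmult_right' ntheta'_def by (simp only:)
    qed
    finally show ?thesis .
  qed
  ultimately show ?thesis by simp
qed

text \<open>Serves the existence of a maximum on a compact segment of heights; continuity is read
  off from termwise differentiability.\<close>

lemma ntheta_continuous_y:
  assumes s: "s > 0" and y: "y > 0"
  shows "isCont (\<lambda>y. ntheta s x y) y"
proof -
  define f where "f = (\<lambda>(m,n) t. exp (- (pi * s * quad x t m n)))"
  define f' where "f' = (\<lambda>(m,n) t. - (pi * s * ((of_int m)\<^sup>2 - (of_int m * x + of_int n)\<^sup>2 / t\<^sup>2)) * exp (- (pi * s * quad x t m n)))"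
  obtain \<kappa> where k: "\<kappa> > 0" "\<And>t m n. y/2 \<le> t \<Longrightarrow> t \<le> 2*y \<Longrightarrow> \<kappa> * ((of_int m)\<^sup>2 + (of_int n)\<^sup>2) \<le> quad x t m n"
    using quad_lower[of "y/2" "2*y" x] y by auto
  have "((\<lambda>t. \<Sum>\<^sub>\<infinity>i. f i t) has_real_derivative (\<Sum>\<^sub>\<infinity>i. f' i y)) (at y)"
  proof (rule has_real_derivative_infsum[OF infinite_UNIV_int2, where S = "{y/2<..<2*y}"
        and M = "\<lambda>(m,n). (4 / y) * exp (- (pi * s / 2 * \<kappa>) * ((of_int m)\<^sup>2 + (of_int n)\<^sup>2))"])
    fix i :: "int \<times> int" and t :: real assume t: "t \<in> {y/2<..<2*y}"
    then have t0: "t > 0" using y by auto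
    obtain m n where i: "i = (m,n)" by force
    have q: "quad x t m n = (of_int m)\<^sup>2 * t + (of_int m * x + of_int n)\<^sup>2 / t" for t
      by (simp add: quad_def power2_eq_square add_divide_distrib)
    have d1: "((\<lambda>t. exp (- (pi * s * ((of_int m)\<^sup>2 * t + (of_int m * x + of_int n)\<^sup>2 / t)))) has_real_derivative
       exp (- (pi * s * ((of_int m)\<^sup>2 * t + (of_int m * x + of_int n)\<^sup>2 / t))) * - (pi * s * ((of_int m)\<^sup>2 - (of_int m * x + of_int n)\<^sup>2 / t\<^sup>2))) (at t)"
      using t0 by (auto intro!: derivative_eq_intros simp: power2_eq_square)
    then show "(f i has_real_derivative f' i t) (at t)"
      unfolding f_def f'_def i prod.case q by (simp add: mult.commute)
    let ?w = "pi * s * quad x t m n"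
    have w0: "?w \<ge> 0" using s quad_nonneg[OF t0] by simp
    have "\<bar>pi * s * ((of_int m)\<^sup>2 - (of_int m * x + of_int n)\<^sup>2 / t\<^sup>2)\<bar> = pi * s * \<bar>(of_int m)\<^sup>2 - (of_int m * x + of_int n)\<^sup>2 / t\<^sup>2\<bar>"
      using s by (simp add: abs_mult)
    also have "\<dots> \<le> pi * s * ((of_int m)\<^sup>2 + (of_int m * x + of_int n)\<^sup>2 / t\<^sup>2)"
      using s by (intro mult_left_mono abs_leI) (auto intro: order_trans[of _ 0])
    also have "\<dots> = ?w / t" unfolding q using t0 by (simp add: power2_eq_square field_simps)
    finally have fb: "\<bar>pi * s * ((of_int m)\<^sup>2 - (of_int m * x + of_int n)\<^sup>2 / t\<^sup>2)\<bar> \<le> ?w / t" .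
    have "\<bar>f' i t\<bar> = \<bar>pi * s * ((of_int m)\<^sup>2 - (of_int m * x + of_int n)\<^sup>2 / t\<^sup>2)\<bar> * exp (- ?w)"
      unfolding f'_def i prod.case by (subst abs_mult) (simp add: abs_mult)
    also have "\<dots> \<le> ?w / t * exp (- ?w)" by (intro mult_right_mono fb) auto
    also have "\<dots> \<le> ((1/2 + ?w) * exp (- ?w)) / t" using t0 by (simp add: field_simps)
    also have "\<dots> \<le> (2 * exp (- ?w / 2)) / t" using t0 by (intro divide_right_mono exp_absorb1 w0) auto
    also have "\<dots> \<le> 2 * exp (- ?w / 2) / (y / 2)" using t y by (intro divide_left_mono) auto
    also have "\<dots> = (4 / y) * exp (- ?w / 2)" by simp
    also have "\<dots> \<le> (4 / y) * exp (- (pi * s / 2 * \<kappa>) * ((of_int m)\<^sup>2 + (of_int n)\<^sup>2))"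
    proof -
      have "pi * s / 2 * (\<kappa> * ((of_int m)\<^sup>2 + (of_int n)\<^sup>2)) \<le> pi * s / 2 * quad x t m n"
        using k(2)[of t m n] t s by (intro mult_left_mono) auto
      then show ?thesis using y by (intro mult_left_mono) (auto simp: mult.assoc)
    qed
    finally show "\<bar>f' i t\<bar> \<le> (case i of (m,n) \<Rightarrow> (4 / y) * exp (- (pi * s / 2 * \<kappa>) * ((of_int m)\<^sup>2 + (of_int n)\<^sup>2)))"
      by (simp add: i)
  next
    show "(\<lambda>(m::int,n::int). (4 / y) * exp (- (pi * s / 2 * \<kappa>) * ((of_int m)\<^sup>2 + (of_int n)\<^sup>2))) summable_on UNIV"
      using summable_on_cmult_right[OF summable_on_gauss_int2[of "pi * s / 2 * \<kappa>"], of "4/y"] s k(1)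
      by (simp add: case_prod_unfold)
  next
    fix t assume "t \<in> {y/2<..<2*y}"
    then show "(\<lambda>i. f i t) summable_on UNIV"
      using summable_exp_quad[of "pi * s" t x] s y by (simp add: f_def case_prod_unfold)
  qed (use y in auto)
  then have "isCont (\<lambda>t. \<Sum>\<^sub>\<infinity>i. f i t) y" by (rule DERIV_isCont)
  then show ?thesis unfolding ntheta_def f_def by (intro continuous_intros) (simp add: case_prod_unfold)
qed

text \<open>The Poisson dual of \<open>sqrt T * (\<Sum>\<^sub>\<infinity>n. exp (- pi * T * (n + x)\<^sup>2))\<close>, and \<open>T\<close> times its derivative in \<open>T\<close>.\<close>

definition th :: "real \<Rightarrow> real \<Rightarrow> real" where
  "th T x = (\<Sum>\<^sub>\<infinity>k::int. exp (- pi * (of_int k)\<^sup>2 / T) * cos (2 * pi * of_int k * x))"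

definition th' :: "real \<Rightarrow> real \<Rightarrow> real" where
  "th' T x = (\<Sum>\<^sub>\<infinity>k::int. (pi * (of_int k)\<^sup>2 / T) * exp (- pi * (of_int k)\<^sup>2 / T) * cos (2 * pi * of_int k * x))"

lemma th_gauss: "T > 0 \<Longrightarrow> (\<Sum>\<^sub>\<infinity>n::int. exp (- pi * T * (of_int n + x)\<^sup>2)) = th T x / sqrt T"
  using poisson_gauss[of T x] by (simp add: th_def field_simps)

lemma th_has_derivative:
  assumes T: "T > 0"
  shows "((\<lambda>T. th T x) has_real_derivative th' T x / T) (at T)"
proof -
  have "((\<lambda>t. \<Sum>\<^sub>\<infinity>k::int. exp (- pi * (of_int k)\<^sup>2 / t) * cos (2 * pi * of_int k * x)) has_real_derivative
     (\<Sum>\<^sub>\<infinity>k::int. (pi * (of_int k)\<^sup>2 / T) * exp (- pi * (of_int k)\<^sup>2 / T) * cos (2 * pi * of_int k * x) / T)) (at T)"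
  proof (rule has_real_derivative_infsum[OF infinite_UNIV_int, where S = "{T/2<..<2*T}"
        and M = "\<lambda>k. (4 / T) * exp (- (pi / (4 * T)) * (of_int k)\<^sup>2)"])
    fix k :: int and t assume t: "t \<in> {T/2<..<2*T}"
    then have t0: "t > 0" using T by auto
    show "((\<lambda>t. exp (- pi * (of_int k)\<^sup>2 / t) * cos (2 * pi * of_int k * x)) has_real_derivative
      (pi * (of_int k)\<^sup>2 / t) * exp (- pi * (of_int k)\<^sup>2 / t) * cos (2 * pi * of_int k * x) / t) (at t)"
      using t0 by (auto intro!: derivative_eq_intros simp: power2_eq_square)
    let ?w = "pi * (of_int k)\<^sup>2 / t"
    have w0: "?w \<ge> 0" using t0 by simp
    have "\<bar>?w * exp (- pi * (of_int k)\<^sup>2 / t) * cos (2 * pi * of_int k * x) / t\<bar> \<le> (?w * exp (- ?w)) / t"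
      using t0 by (auto simp: abs_mult intro!: divide_right_mono mult_left_le)
    also have "\<dots> \<le> ((1/2 + ?w) * exp (- ?w)) / t" using t0 by (intro divide_right_mono mult_right_mono) auto
    also have "\<dots> \<le> (2 * exp (- ?w / 2)) / t" using t0 by (intro divide_right_mono exp_absorb1 w0) auto
    also have "\<dots> \<le> (2 * exp (- ?w / 2)) / (T/2)" using t T by (intro divide_left_mono) auto
    also have "\<dots> = (4 / T) * exp (- ?w / 2)" by simp
    also have "\<dots> \<le> (4 / T) * exp (- (pi / (4 * T)) * (of_int k)\<^sup>2)"
    proof -
      have "pi * (of_int k)\<^sup>2 / (2 * T) \<le> ?w" using t t0 by (intro divide_left_mono) auto
      then show ?thesis using T by (intro mult_left_mono) auto
    qed
    finally show "\<bar>?w * exp (- pi * (of_int k)\<^sup>2 / t) * cos (2 * pi * of_int k * x) / t\<bar> \<le> (4 / T) * exp (- (pi / (4 * T)) * (of_int k)\<^sup>2)" .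
  next
    show "(\<lambda>k::int. (4 / T) * exp (- (pi / (4 * T)) * (of_int k)\<^sup>2)) summable_on UNIV"
      using T by (intro summable_on_cmult_right summable_on_gauss_int) auto
  qed (use T summable_on_gauss_cos in auto)
  also have "(\<Sum>\<^sub>\<infinity>k::int. (pi * (of_int k)\<^sup>2 / T) * exp (- pi * (of_int k)\<^sup>2 / T) * cos (2 * pi * of_int k * x) / T)
    = th' T x / T"
    unfolding th'_def divide_inverse[of _ T] by (rule infsum_cmult_left')
  finally show ?thesis unfolding th_def .
qed

text \<open>The two sides of Poisson summation are both differentiated term by term in
  \<open>T\<close>, and uniqueness of the derivative equates the results.\<close>

lemma th'_gauss:
  assumes T: "T > 0"
  shows "(\<Sum>\<^sub>\<infinity>n::int. (1/2 - pi * T * (of_int n + x)\<^sup>2) * exp (- pi * T * (of_int n + x)\<^sup>2)) = th' T x / sqrt T"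
proof -
  define f' where "f' = (\<lambda>(n::int) t. ((1/2 - pi * t * (of_int n + x)\<^sup>2) * exp (- pi * t * (of_int n + x)\<^sup>2)) / sqrt t)"
  have "((\<lambda>t. \<Sum>\<^sub>\<infinity>n::int. sqrt t * exp (- pi * t * (of_int n + x)\<^sup>2)) has_real_derivative
     (\<Sum>\<^sub>\<infinity>n. f' n T)) (at T)"
  proof (rule has_real_derivative_infsum[OF infinite_UNIV_int, where S = "{T/2<..<2*T}"
        and M = "\<lambda>n. 2 / sqrt (T/2) * exp (- pi * (T / 4) * (of_int n + x)\<^sup>2)"])
    fix n :: int and t assume t: "t \<in> {T/2<..<2*T}"
    then have t0: "t > 0" using T by auto
    show "((\<lambda>t. sqrt t * exp (- pi * t * (of_int n + x)\<^sup>2)) has_real_derivative f' n t) (at t)"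
      unfolding f'_def using t0 by (auto intro!: derivative_eq_intros simp: field_simps)
    let ?w = "pi * t * (of_int n + x)\<^sup>2"
    have "\<bar>f' n t\<bar> = \<bar>(1/2 - ?w) * exp (- ?w)\<bar> / sqrt t"
      using t0 by (simp add: f'_def)
    also have "\<dots> \<le> 2 * exp (- ?w / 2) / sqrt t"
      using t0 by (intro divide_right_mono exp_absorb1') auto
    also have "\<dots> \<le> 2 * exp (- pi * (T / 4) * (of_int n + x)\<^sup>2) / sqrt (T / 2)"
    proof (rule frac_le)
      have "pi * (of_int n + x)\<^sup>2 * (T / 2) \<le> pi * (of_int n + x)\<^sup>2 * t"
        using t by (intro mult_left_mono) auto
      then show "2 * exp (- ?w / 2) \<le> 2 * exp (- pi * (T / 4) * (of_int n + x)\<^sup>2)"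
        by (simp add: algebra_simps)
    qed (use t T in auto)
    finally show "\<bar>f' n t\<bar> \<le> 2 / sqrt (T/2) * exp (- pi * (T / 4) * (of_int n + x)\<^sup>2)" by simp
  next
    show "(\<lambda>n::int. 2 / sqrt (T/2) * exp (- pi * (T / 4) * (of_int n + x)\<^sup>2)) summable_on UNIV"
      using T by (intro summable_on_cmult_right summable_on_gauss_shift) auto
  next
    fix t assume "t \<in> {T/2<..<2*T}"
    then show "(\<lambda>n::int. sqrt t * exp (- pi * t * (of_int n + x)\<^sup>2)) summable_on UNIV"
      using T by (intro summable_on_cmult_right summable_on_gauss_shift) auto
  qed (use T in auto)
  moreover have "(\<Sum>\<^sub>\<infinity>n::int. sqrt t * exp (- pi * t * (of_int n + x)\<^sup>2)) = th t x" if "t > 0" for t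
    using th_gauss[OF that, of x] that by (simp add: infsum_cmult_right')
  ultimately have "((\<lambda>t. th t x) has_real_derivative (\<Sum>\<^sub>\<infinity>n. f' n T)) (at T)"
    using T by (auto elim!: has_field_derivative_transform_within_open[where S = "{0<..}"])
  then have 1: "(\<Sum>\<^sub>\<infinity>n. f' n T) = th' T x / T"
    using DERIV_unique th_has_derivative[OF T] by blast
  have 2: "(\<Sum>\<^sub>\<infinity>n. f' n T) = (\<Sum>\<^sub>\<infinity>n::int. (1/2 - pi * T * (of_int n + x)\<^sup>2) * exp (- pi * T * (of_int n + x)\<^sup>2)) / sqrt T"
    unfolding f'_def divide_inverse[of _ "sqrt T"] by (rule infsum_cmult_left')
  have "X = a / sqrt T" if "X / sqrt T = a / T" for X a
  proof -
    have "X = a / T * sqrt T" using that T by (simp add: field_simps)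
    also have "\<dots> = a * (sqrt T / T)" by simp
    also have "sqrt T / T = inverse (sqrt T)" using T by (intro sqrt_divide_self_eq) simp
    also have "a * inverse (sqrt T) = a / sqrt T" by (simp add: divide_inverse)
    finally show ?thesis .
  qed
  from this[OF trans[OF 2[symmetric] 1]] show ?thesis .
qed

section \<open>Slices and the double Fourier series\<close>

lemma summable_fourier_bound:
  fixes a b :: real assumes "a > 0" "b > 0"
  shows "(\<lambda>(m::int,k::int). exp (- (pi * (a * (of_int m)\<^sup>2 + b * (of_int k)\<^sup>2)))) summable_on UNIV"
proof (rule summable_on_abs_le[OF summable_on_gauss_int2[of "pi * min a b"]])
  fix p :: "int \<times> int"
  obtain m k where p: "p = (m,k)" by force
  have "min a b * (of_int m)\<^sup>2 \<le> a * (of_int m)\<^sup>2" "min a b * (of_int k)\<^sup>2 \<le> b * (of_int k)\<^sup>2"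
    by (intro mult_right_mono; simp)+
  then have "pi * (min a b * ((of_int m)\<^sup>2 + (of_int k)\<^sup>2)) \<le> pi * (a * (of_int m)\<^sup>2 + b * (of_int k)\<^sup>2)"
    unfolding distrib_left[of "min a b"] by (intro mult_left_mono add_mono) auto
  then show "\<bar>case p of (m,k) \<Rightarrow> exp (- (pi * (a * (of_int m)\<^sup>2 + b * (of_int k)\<^sup>2)))\<bar>
      \<le> (case p of (m,k) \<Rightarrow> exp (- (pi * min a b) * ((of_int m)\<^sup>2 + (of_int k)\<^sup>2)))"
    by (simp add: p mult.assoc)
qed (use assms in auto)

text \<open>With \<open>a = s * y\<close> and \<open>b = y / s\<close> these are the double Fourier
  coefficients of \<open>ntheta\<close>; the inversion of \<open>s\<close> exchanges
  \<open>a\<close> and \<open>b\<close>.\<close>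

definition efun :: "real \<Rightarrow> real \<Rightarrow> int \<Rightarrow> int \<Rightarrow> real" where
  "efun a b m k = exp (- (pi * (a * (of_int m)\<^sup>2 + b * (of_int k)\<^sup>2)))"

lemma summable_efun_weighted:
  assumes "a > 0" "b > 0" "\<And>m k. \<bar>h m k\<bar> \<le> 1"
  shows "(\<lambda>(m,k). pi * (b * (of_int k)\<^sup>2 - a * (of_int m)\<^sup>2) * efun a b m k * h m k) summable_on UNIV"
proof (rule summable_on_abs_le[OF summable_on_cmult_right[OF summable_fourier_bound[of "a/2" "b/2"], of 2]])
  fix p :: "int \<times> int"
  obtain m k where p: "p = (m,k)" by force
  let ?w = "pi * (a * (of_int m)\<^sup>2 + b * (of_int k)\<^sup>2)"
  have "\<bar>pi * (b * (of_int k)\<^sup>2 - a * (of_int m)\<^sup>2)\<bar> = pi * \<bar>b * (of_int k)\<^sup>2 - a * (of_int m)\<^sup>2\<bar>" by (simp add: abs_mult)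
  also have "\<dots> \<le> ?w" using assms by (intro mult_left_mono abs_leI) (auto intro: order_trans[of _ 0])
  finally have "\<bar>pi * (b * (of_int k)\<^sup>2 - a * (of_int m)\<^sup>2)\<bar> * exp (- ?w) * \<bar>h m k\<bar> \<le> (1/2 + ?w) * exp (- ?w) * 1"
    using assms by (intro mult_mono) auto
  also have "\<dots> \<le> 2 * exp (- ?w / 2)"
    using exp_absorb1[of ?w] assms by simp
  finally show "\<bar>case p of (m,k) \<Rightarrow> pi * (b * (of_int k)\<^sup>2 - a * (of_int m)\<^sup>2) * efun a b m k * h m k\<bar>
     \<le> 2 * (case p of (m,k) \<Rightarrow> exp (- (pi * (a / 2 * (of_int m)\<^sup>2 + b / 2 * (of_int k)\<^sup>2))))"
    unfolding p prod.case abs_mult by (simp add: efun_def abs_mult algebra_simps add_divide_distrib diff_divide_distrib)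
qed (use assms in auto)

lemma th_has_sum: "T > 0 \<Longrightarrow> ((\<lambda>k::int. exp (- pi * (of_int k)\<^sup>2 / T) * cos (2 * pi * of_int k * x)) has_sum th T x) UNIV"
  unfolding th_def by (intro has_sum_infsum summable_on_gauss_cos)

lemma th'_has_sum:
  assumes T: "T > 0"
  shows "((\<lambda>k::int. (pi * (of_int k)\<^sup>2 / T) * exp (- pi * (of_int k)\<^sup>2 / T) * cos (2 * pi * of_int k * x)) has_sum th' T x) UNIV"
  unfolding th'_def
proof (rule has_sum_infsum, rule summable_on_abs_le[OF summable_on_cmult_right[OF summable_on_gauss_int[of "pi / T / 2"], of 2]])
  fix k :: int
  let ?w = "pi * (of_int k)\<^sup>2 / T"
  have "\<bar>?w * exp (- pi * (of_int k)\<^sup>2 / T) * cos (2 * pi * of_int k * x)\<bar> = (?w * exp (- ?w)) * \<bar>cos (2 * pi * of_int k * x)\<bar>"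
    using T by (simp add: abs_mult)
  also have "\<dots> \<le> ?w * exp (- ?w)" using T by (intro mult_left_le) auto
  also have "\<dots> \<le> (1/2 + ?w) * exp (- ?w)" by (intro mult_right_mono) auto
  also have "\<dots> \<le> 2 * exp (- ?w / 2)" using T by (intro exp_absorb1) auto
  finally show "\<bar>?w * exp (- pi * (of_int k)\<^sup>2 / T) * cos (2 * pi * of_int k * x)\<bar> \<le> 2 * exp (- (pi / T / 2) * (of_int k)\<^sup>2)"
    by simp
qed (use T in auto)

lemma th_gauss_has_sum:
  assumes "T > 0"
  shows "((\<lambda>n::int. exp (- pi * T * (of_int n + x)\<^sup>2)) has_sum th T x / sqrt T) UNIV"
  using th_gauss[OF assms, of x] summable_on_gauss_shift[OF assms, of x] by (simp add: has_sum_iff)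

lemma th'_gauss_has_sum:
  assumes T: "T > 0"
  shows "((\<lambda>n::int. (1/2 - pi * T * (of_int n + x)\<^sup>2) * exp (- pi * T * (of_int n + x)\<^sup>2)) has_sum th' T x / sqrt T) UNIV"
proof -
  have "(\<lambda>n::int. (1/2 - pi * T * (of_int n + x)\<^sup>2) * exp (- pi * T * (of_int n + x)\<^sup>2)) summable_on UNIV"
  proof (rule summable_on_abs_le[OF summable_on_cmult_right[OF summable_on_gauss_shift[of "T/2" x], of 2]])
    fix n :: int
    show "\<bar>(1/2 - pi * T * (of_int n + x)\<^sup>2) * exp (- pi * T * (of_int n + x)\<^sup>2)\<bar> \<le> 2 * exp (- pi * (T / 2) * (of_int n + x)\<^sup>2)"
      using exp_absorb1'[of "pi * T * (of_int n + x)\<^sup>2"] T by simp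
  qed (use T in auto)
  then show ?thesis using th'_gauss[OF T, of x] by (simp add: has_sum_iff)
qed

lemma quad_split:
  assumes "s > 0" "y > 0"
  shows "pi * s * quad x y m n = pi * s * y * (of_int m)\<^sup>2 + pi * (s / y) * (of_int n + of_int m * x)\<^sup>2"
  using assms by (simp add: quad_def power2_eq_square field_simps)

text \<open>For fixed \<open>m\<close> the sum over \<open>n\<close> is a shifted Gaussian sum with
  parameter \<open>s / y\<close>, which Poisson summation turns into \<open>th\<close>. Leaving
  \<open>th\<close> unexpanded allows a later choice, slice by slice, between its Gaussian and its
  cosine form.\<close>

lemma ntheta_slices:
  assumes s: "s > 0" and y: "y > 0"
  shows "((\<lambda>m::int. exp (- pi * s * y * (of_int m)\<^sup>2) * th (s / y) (of_int m * x)) has_sum ntheta s x y / sqrt y) UNIV"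
    and "((\<lambda>m::int. exp (- pi * s * y * (of_int m)\<^sup>2) *
      (th' (s / y) (of_int m * x) - pi * s * y * (of_int m)\<^sup>2 * th (s / y) (of_int m * x))) has_sum ntheta' s x y / sqrt y) UNIV"
proof -
  have T: "s / y > 0" using s y by simp
  have sq: "sqrt (s / y) * X = sqrt s * X / sqrt y" for X by (simp add: real_sqrt_divide)
  have c: "sqrt (s / y) * (A / sqrt (s / y)) = A" for A using s y by simp
  let ?f = "\<lambda>(m,n). exp (- (pi * s * quad x y m n))"
  have "(?f has_sum infsum ?f UNIV) (UNIV \<times> UNIV)"
    using summable_exp_quad[of "pi * s" y x] s y by simp
  then have "((\<lambda>m::int. exp (- pi * s * y * (of_int m)\<^sup>2) * (th (s / y) (of_int m * x) / sqrt (s / y))) has_sum infsum ?f UNIV) UNIV"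
  proof (rule has_sum_SigmaD)
    fix m :: int
    have "((\<lambda>n::int. exp (- pi * s * y * (of_int m)\<^sup>2) * exp (- pi * (s / y) * (of_int n + of_int m * x)\<^sup>2)) has_sum
       exp (- pi * s * y * (of_int m)\<^sup>2) * (th (s / y) (of_int m * x) / sqrt (s / y))) UNIV"
      by (intro has_sum_cmult_right th_gauss_has_sum T)
    then show "((\<lambda>n. ?f (m,n)) has_sum exp (- pi * s * y * (of_int m)\<^sup>2) * (th (s / y) (of_int m * x) / sqrt (s / y))) UNIV"
      unfolding prod.case quad_split[OF s y] by (simp add: exp_add[symmetric])
  qed
  from has_sum_cmult_right[OF this, of "sqrt (s / y)"]
  show "((\<lambda>m::int. exp (- pi * s * y * (of_int m)\<^sup>2) * th (s / y) (of_int m * x)) has_sum ntheta s x y / sqrt y) UNIV"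
    unfolding mult.left_commute[of "sqrt (s / y)"] c unfolding sq ntheta_def .
  let ?g = "\<lambda>(m,n). (1/2 - pi * s * quad x y m n) * exp (- (pi * s * quad x y m n))"
  have "(?g has_sum infsum ?g UNIV) (UNIV \<times> UNIV)"
    using summable_ntheta'[OF s y, of x] by simp
  then have "((\<lambda>m::int. exp (- pi * s * y * (of_int m)\<^sup>2) * ((th' (s / y) (of_int m * x) - pi * s * y * (of_int m)\<^sup>2 * th (s / y) (of_int m * x)) / sqrt (s / y))) has_sum infsum ?g UNIV) UNIV"
  proof (rule has_sum_SigmaD)
    fix m :: int
    have "((\<lambda>n::int. (1/2 - pi * (s / y) * (of_int n + of_int m * x)\<^sup>2) * exp (- pi * (s / y) * (of_int n + of_int m * x)\<^sup>2)
          + - (pi * s * y * (of_int m)\<^sup>2 * exp (- pi * (s / y) * (of_int n + of_int m * x)\<^sup>2))) has_sum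
       (th' (s / y) (of_int m * x) / sqrt (s / y) + - (pi * s * y * (of_int m)\<^sup>2 * (th (s / y) (of_int m * x) / sqrt (s / y))))) UNIV"
      by (intro has_sum_add has_sum_uminusI has_sum_cmult_right th_gauss_has_sum th'_gauss_has_sum T)
    from has_sum_cmult_right[OF this, of "exp (- pi * s * y * (of_int m)\<^sup>2)"]
    have "((\<lambda>n::int. (1/2 - (pi * s * y * (of_int m)\<^sup>2 + pi * (s / y) * (of_int n + of_int m * x)\<^sup>2)) *
        (exp (- pi * s * y * (of_int m)\<^sup>2) * exp (- pi * (s / y) * (of_int n + of_int m * x)\<^sup>2))) has_sum
       exp (- pi * s * y * (of_int m)\<^sup>2) * ((th' (s / y) (of_int m * x) - pi * s * y * (of_int m)\<^sup>2 * th (s / y) (of_int m * x)) / sqrt (s / y))) UNIV"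
      by (simp add: algebra_simps diff_divide_distrib)
    then show "((\<lambda>n. ?g (m,n)) has_sum exp (- pi * s * y * (of_int m)\<^sup>2) * ((th' (s / y) (of_int m * x) - pi * s * y * (of_int m)\<^sup>2 * th (s / y) (of_int m * x)) / sqrt (s / y))) UNIV"
      unfolding prod.case quad_split[OF s y] by (simp add: exp_add[symmetric])
  qed
  from has_sum_cmult_right[OF this, of "sqrt (s / y)"]
  show "((\<lambda>m::int. exp (- pi * s * y * (of_int m)\<^sup>2) *
      (th' (s / y) (of_int m * x) - pi * s * y * (of_int m)\<^sup>2 * th (s / y) (of_int m * x))) has_sum ntheta' s x y / sqrt y) UNIV"
    unfolding mult.left_commute[of "sqrt (s / y)"] c unfolding sq ntheta'_def .
qed

lemma ntheta_fourier:
  assumes s: "s > 0" and y: "y > 0"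
  shows "((\<lambda>(m,k). efun (s * y) (y / s) m k * cos (2 * pi * (of_int m * of_int k) * x)) has_sum ntheta s x y / sqrt y) UNIV"
    and "((\<lambda>(m,k). pi * (y / s * (of_int k)\<^sup>2 - s * y * (of_int m)\<^sup>2) * efun (s * y) (y / s) m k * cos (2 * pi * (of_int m * of_int k) * x))
           has_sum ntheta' s x y / sqrt y) UNIV"
proof -
  have T: "s / y > 0" using s y by simp
  have ab: "s * y > 0" "y / s > 0" using s y by auto
  let ?f = "\<lambda>(m,k). efun (s * y) (y / s) m k * cos (2 * pi * (of_int m * of_int k) * x)"
  have e: "efun (s * y) (y / s) m k = exp (- pi * s * y * (of_int m)\<^sup>2) * exp (- pi * (of_int k)\<^sup>2 / (s / y))" for m k
    by (simp add: efun_def exp_add[symmetric] algebra_simps)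
  have cc: "cos (2 * pi * (of_int m * of_int k) * x) = cos (2 * pi * of_int k * (of_int m * x))" for m k
    by (simp add: mult_ac)
  have "(?f has_sum ntheta s x y / sqrt y) (UNIV \<times> UNIV)"
  proof (rule has_sum_SigmaI[OF _ ntheta_slices(1)[OF s y, of x]])
    show "((\<lambda>k. ?f (m, k)) has_sum exp (- pi * s * y * (of_int m)\<^sup>2) * th (s / y) (of_int m * x)) UNIV" for m
      using has_sum_cmult_right[OF th_has_sum[OF T, of "of_int m * x"], of "exp (- pi * s * y * (of_int m)\<^sup>2)"]
      unfolding prod.case e cc by (simp only: mult.assoc)
    have "(\<lambda>(m,k). efun (s * y) (y / s) m k * cos (2 * pi * (of_int m * of_int k) * x)) summable_on UNIV"
      by (rule summable_on_abs_le[OF summable_fourier_bound[OF ab]])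
         (auto simp: efun_def abs_mult intro!: mult_left_le)
    then show "?f summable_on (UNIV \<times> UNIV)" by simp
  qed
  then show "(?f has_sum ntheta s x y / sqrt y) UNIV" by simp
  let ?g = "\<lambda>(m,k). pi * (y / s * (of_int k)\<^sup>2 - s * y * (of_int m)\<^sup>2) * efun (s * y) (y / s) m k * cos (2 * pi * (of_int m * of_int k) * x)"
  have "(?g has_sum ntheta' s x y / sqrt y) (UNIV \<times> UNIV)"
  proof (rule has_sum_SigmaI[OF _ ntheta_slices(2)[OF s y, of x]])
    fix m :: int
    let ?E = "exp (- pi * s * y * (of_int m)\<^sup>2)"
    have "((\<lambda>k. ?E * ((pi * (of_int k)\<^sup>2 / (s/y)) * exp (- pi * (of_int k)\<^sup>2 / (s/y)) * cos (2 * pi * of_int k * (of_int m * x))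
           + - (pi * s * y * (of_int m)\<^sup>2 * (exp (- pi * (of_int k)\<^sup>2 / (s/y)) * cos (2 * pi * of_int k * (of_int m * x)))))) has_sum
       ?E * (th' (s / y) (of_int m * x) + - (pi * s * y * (of_int m)\<^sup>2 * th (s / y) (of_int m * x)))) UNIV"
      by (intro has_sum_add has_sum_uminusI has_sum_cmult_right th_has_sum th'_has_sum T)
    moreover have "?E * ((pi * (of_int k)\<^sup>2 / (s/y)) * exp (- pi * (of_int k)\<^sup>2 / (s/y)) * C
           + - (pi * s * y * (of_int m)\<^sup>2 * (exp (- pi * (of_int k)\<^sup>2 / (s/y)) * C)))
       = pi * (y / s * (of_int k)\<^sup>2 - s * y * (of_int m)\<^sup>2) * (?E * exp (- pi * (of_int k)\<^sup>2 / (s / y))) * C" for k :: int and C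
      by (simp add: algebra_simps)
    ultimately show "((\<lambda>k. ?g (m, k)) has_sum ?E * (th' (s / y) (of_int m * x) - pi * s * y * (of_int m)\<^sup>2 * th (s / y) (of_int m * x))) UNIV"
      unfolding prod.case e cc by (simp only: diff_conv_add_uminus)
  next
    show "?g summable_on (UNIV \<times> UNIV)"
      using summable_efun_weighted[OF ab, of "\<lambda>m k. cos (2 * pi * (of_int m * of_int k) * x)"] by simp
  qed
  then show "(?g has_sum ntheta' s x y / sqrt y) UNIV" by simp
qed

text \<open>Inverting \<open>s\<close> exchanges the two Fourier indices in the coefficients, and
  the cosine depends on their product only.\<close>

lemma ntheta_inverse:
  assumes s: "s > 0" and y: "y > 0"
  shows "ntheta (1 / s) x y = ntheta s x y"
proof -
  have "((\<lambda>(m,k). efun (1 / s * y) (y / (1 / s)) m k * cos (2 * pi * (of_int m * of_int k) * x)) has_sum ntheta (1/s) x y / sqrt y) (UNIV \<times> UNIV)"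
    using ntheta_fourier(1)[of "1/s" y x] s y by simp
  then have "((\<lambda>(m,k). efun (1 / s * y) (y / (1 / s)) k m * cos (2 * pi * (of_int k * of_int m) * x)) has_sum ntheta (1/s) x y / sqrt y) UNIV"
    by (subst (asm) has_sum_swap) (simp add: case_prod_unfold)
  moreover have "efun (1 / s * y) (y / (1 / s)) k m = efun (s * y) (y / s) m k" for k m
    by (simp add: efun_def algebra_simps)
  ultimately have "((\<lambda>(m,k). efun (s * y) (y / s) m k * cos (2 * pi * (of_int m * of_int k) * x)) has_sum ntheta (1/s) x y / sqrt y) UNIV"
    by (simp add: mult.commute)
  from has_sum_unique[OF this ntheta_fourier(1)[OF s y]] show ?thesis using y by simp
qed

lemma ntheta_uminus_x:
  assumes "s > 0" "y > 0" shows "ntheta s (- x) y = ntheta s x y"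
  using has_sum_unique[OF ntheta_fourier(1)[OF assms, of x], of "ntheta s (- x) y / sqrt y"] ntheta_fourier(1)[OF assms, of "- x"] assms by simp

section \<open>Comparison of the derivative with the line of real part one half\<close>

lemma exp_ge_Taylor: fixes x :: real assumes "x \<ge> 0" shows "(\<Sum>k<n. x ^ k / fact k) \<le> exp x"
proof -
  have "(\<lambda>k. x ^ k / fact k) sums exp x"
    using exp_converges[of x] by (simp add: scaleR_conv_of_real divide_inverse mult.commute)
  then have "summable (\<lambda>k. x ^ k / fact k)" "(\<Sum>k. x ^ k / fact k) = exp x" by (simp_all add: sums_iff)
  then show ?thesis using sum_le_suminf[of "\<lambda>k. x ^ k / fact k" "{..<n}"] assms by simp
qed

lemma exp_minus_1_le: "exp (- 1) \<le> (3679 / 10000 :: real)"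
proof -
  have "10000 / 3679 \<le> (\<Sum>k<9. 1 ^ k / fact k :: real)"
    by (simp add: fact_numeral lessThan_nat_numeral lessThan_Suc eval_nat_numeral)
  also have "\<dots> \<le> exp 1" by (rule exp_ge_Taylor) simp
  finally have "inverse (exp 1) \<le> inverse (10000 / 3679 :: real)" by (intro le_imp_inverse_le) auto
  then show ?thesis by (simp add: exp_minus)
qed

text \<open>Splitting the exponent into an integer part and a remainder \<open>f\<close>, treated by
  a quadratic Taylor bound, reduces most numerical estimates below to rational arithmetic.\<close>

lemma exp_minus_le:
  fixes f c :: real
  assumes "f \<ge> 0" "x = real n + f" "(3679 / 10000) ^ n \<le> c * (1 + f + f\<^sup>2 / 2)"
  shows "exp (- x) \<le> c"
proof -
  have q: "1 + f + f\<^sup>2 / 2 \<le> exp f" by (rule exp_lower_Taylor_quadratic[OF assms(1)])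
  have p: "1 + f + f\<^sup>2 / 2 > 0" using assms(1) by (intro add_pos_nonneg) auto
  have "exp (- x) = exp (- 1) ^ n * exp (- f)"
    by (simp add: assms(2) exp_of_nat_mult[symmetric] exp_add[symmetric])
  also have "\<dots> \<le> (3679 / 10000) ^ n * (1 / (1 + f + f\<^sup>2 / 2))"
    using q p by (intro mult_mono power_mono exp_minus_1_le) (auto simp: exp_minus inverse_eq_divide intro!: divide_left_mono)
  also have "\<dots> \<le> c" using assms(3) p by (simp only: mult_1_right times_divide_eq_right pos_divide_le_eq)
  finally show ?thesis .
qed

lemma pi_gt_314: "pi > 3.14"
  using pi_approx by simp

section \<open>Differences of cosines\<close>

lemma abs_sin_mult_le: "\<bar>sin (of_nat n * t)\<bar> \<le> of_nat n * \<bar>sin t\<bar>" for t :: real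
proof (induction n)
  case (Suc n)
  have "\<bar>sin (of_nat (Suc n) * t)\<bar> = \<bar>sin (of_nat n * t) * cos t + cos (of_nat n * t) * sin t\<bar>"
    by (simp add: algebra_simps sin_add)
  also have "\<dots> \<le> \<bar>sin (of_nat n * t)\<bar> * \<bar>cos t\<bar> + \<bar>cos (of_nat n * t)\<bar> * \<bar>sin t\<bar>"
    by (metis abs_mult abs_triangle_ineq)
  also have "\<dots> \<le> \<bar>sin (of_nat n * t)\<bar> * 1 + 1 * \<bar>sin t\<bar>"
    by (intro add_mono mult_left_mono mult_right_mono) auto
  finally show ?case using Suc by (simp add: algebra_simps)
qed simp

text \<open>From \<open>1 - cos t = 2 * (sin (t / 2))\<^sup>2\<close>. Every harmonic is controlled
  by the first one with a merely quadratic loss, which the Gaussian coefficients absorb.\<close>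

lemma one_minus_cos_mult_le: "1 - cos (of_int n * t) \<le> (of_int n)\<^sup>2 * (1 - cos t)" for t :: real
proof -
  have c: "1 - cos t = 2 * (sin (t/2))\<^sup>2" for t :: real
    using cos_double_sin[of "t/2"] by simp
  have "\<bar>sin (of_int n * (t/2))\<bar> = \<bar>sin (of_nat (nat \<bar>n\<bar>) * (t/2))\<bar>"
    by (cases "n \<ge> 0") auto
  also have "\<dots> \<le> of_nat (nat \<bar>n\<bar>) * \<bar>sin (t/2)\<bar>" by (rule abs_sin_mult_le)
  finally have "\<bar>sin (of_int n * (t/2))\<bar>\<^sup>2 \<le> (of_nat (nat \<bar>n\<bar>) * \<bar>sin (t/2)\<bar>)\<^sup>2" by (intro power_mono) auto
  then have "(sin (of_int n * (t/2)))\<^sup>2 \<le> (of_int n)\<^sup>2 * (sin (t/2))\<^sup>2"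
    by (simp add: power_mult_distrib)
  then show ?thesis using c[of t] c[of "of_int n * t"] by simp
qed

definition dcos :: "real \<Rightarrow> int \<Rightarrow> real" where
  "dcos x N = cos (2 * pi * of_int N * x) - cos (pi * of_int N)"

text \<open>In the variable \<open>t = pi - 2 * pi * x\<close>, centred at real part one half,
  \<open>dcos x N\<close> equals \<open>(-1)^N * (cos (N t) - 1)\<close>. The sign for even
  \<open>N\<close> is what later makes the index pair 1, 2 affordable down to
  \<open>y / s = 35/100\<close>.\<close>

lemma dcos_bounds:
  shows "\<bar>dcos x N\<bar> \<le> (of_int N)\<^sup>2 * dcos x 1"
    and "even N \<Longrightarrow> dcos x N \<le> 0"
    and "dcos x 0 = 0" and "dcos x 1 = 1 + cos (2 * pi * x)"
proof -
  define t where "t = pi - 2 * pi * x"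
  have d1: "dcos x 1 = 1 - cos t" by (simp add: dcos_def t_def)
  have eq: "\<bar>dcos x N\<bar> = 1 - cos (of_int N * t)"
  proof (cases "even N")
    case True
    then have "cos (pi * of_int N) = 1" "sin (pi * of_int N) = 0"
      by (auto simp: cos_int_times_real mult.commute sin_int_times_real elim!: evenE)
    then show ?thesis by (simp add: dcos_def t_def right_diff_distrib cos_diff mult_ac)
  next
    case False
    then have "cos (pi * of_int N) = -1" "sin (pi * of_int N) = 0"
      by (auto simp: cos_int_times_real mult.commute sin_int_times_real elim!: oddE)
    then show ?thesis by (simp add: dcos_def t_def right_diff_distrib cos_diff mult_ac)
        (smt (verit) cos_ge_minus_one)
  qed
  show "\<bar>dcos x N\<bar> \<le> (of_int N)\<^sup>2 * dcos x 1" unfolding eq d1 by (rule one_minus_cos_mult_le)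
  show "dcos x N \<le> 0" if "even N"
  proof -
    have "cos (pi * of_int N) = 1" using that by (auto simp: cos_int_times_real mult.commute elim!: evenE)
    then show ?thesis by (simp add: dcos_def)
  qed
  show "dcos x 0 = 0" "dcos x 1 = 1 + cos (2 * pi * x)" by (simp_all add: dcos_def)
qed

text \<open>Two terms that differ by a swap of the indices nearly cancel when \<open>a\<close> is
  close to \<open>b\<close>. Writing their sum as
  \<open>(a * M - b * K) * (nA - nB) + (a - b) * (M + K) * nB\<close> brings out the factor
  \<open>a - b\<close>, which the dominant term carries too. The weights are abstract because both
  exponentials and values of \<open>nu\<close> are inserted.\<close>

lemma pair_bounds:
  fixes a b M K nA nB :: real
  assumes ab: "0 < b" "b \<le> a" and MK: "0 \<le> M" "M \<le> K" and n: "0 \<le> nB" "nB \<le> nA"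
    and d: "nA - nB \<le> (pi * (a * K + b * M) - pi * (a * M + b * K)) * nA"
  shows "(a * M - b * K) * nA + (a * K - b * M) * nB \<le> (a - b) * (M * nA + (M + K) * nB)"
    and "- ((a * M - b * K) * nA + (a * K - b * M) * nB) \<le> (a - b) * (pi * b * (K - M)\<^sup>2 * nA)"
proof -
  have dM: "0 \<le> (a - b) * M" and dK: "b * M \<le> b * K" "b * M \<le> a * K" "a * M \<le> a * K"
    using ab MK by (auto intro!: mult_left_mono mult_mono)
  have id: "(a * M - b * K) * nA + (a * K - b * M) * nB = (a * M - b * K) * (nA - nB) + (a - b) * (M + K) * nB"
    by (simp add: algebra_simps)
  have "(a * M - b * K) * (nA - nB) \<le> (a - b) * M * nA"
  proof (cases "a * M - b * K \<le> 0")
    case True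
    then have "(a * M - b * K) * (nA - nB) \<le> 0" using n by (intro mult_nonpos_nonneg) auto
    also have "0 \<le> (a - b) * M * nA" using dM n by simp
    finally show ?thesis .
  next
    case False
    have "(a * M - b * K) * (nA - nB) \<le> ((a - b) * M) * nA"
      using False n dK by (intro mult_mono) (auto simp: algebra_simps)
    then show ?thesis by simp
  qed
  then show "(a * M - b * K) * nA + (a * K - b * M) * nB \<le> (a - b) * (M * nA + (M + K) * nB)"
    unfolding id by (simp add: algebra_simps)
  have nn: "0 \<le> (a - b) * (M + K) * nB" using ab MK n by (intro mult_nonneg_nonneg) auto
  have "(b * K - a * M) * (nA - nB) \<le> (a - b) * (pi * b * (K - M)\<^sup>2 * nA)"
  proof (cases "b * K - a * M \<le> 0")
    case True
    then have "(b * K - a * M) * (nA - nB) \<le> 0" using n by (intro mult_nonpos_nonneg) auto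
    also have "0 \<le> (a - b) * (pi * b * (K - M)\<^sup>2 * nA)" using ab n by (intro mult_nonneg_nonneg) auto
    finally show ?thesis .
  next
    case False
    have "b * M \<le> a * M" using ab MK by (intro mult_right_mono) auto
    then have "b * K - a * M \<le> b * (K - M)" by (simp add: algebra_simps)
    then have "(b * K - a * M) * (nA - nB) \<le> (b * (K - M)) * ((pi * (a * K + b * M) - pi * (a * M + b * K)) * nA)"
      using False n d ab MK by (intro mult_mono) auto
    also have "\<dots> = (a - b) * (pi * b * (K - M)\<^sup>2 * nA)" by (simp add: power2_eq_square algebra_simps)
    finally show ?thesis .
  qed
  then show "- ((a * M - b * K) * nA + (a * K - b * M) * nB) \<le> (a - b) * (pi * b * (K - M)\<^sup>2 * nA)"
    unfolding id using nn by (simp add: algebra_simps)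
qed

section \<open>Majorants for the neglected terms\<close>

text \<open>From \<open>k \<ge> 2\<close> on, passing to \<open>k + 1\<close> multiplies the left
  side by at most \<open>(3/2) ^ j * exp (- (5 * c))\<close>, so two numerical checks settle all
  \<open>k\<close>.\<close>

lemma gauss_power_decay:
  fixes c C :: real
  assumes c: "c \<ge> 0" and r: "(3/2) ^ j * exp (- (5 * c)) \<le> 1/2" and k0: "2 \<le> k0"
    and base: "real k0 ^ j * exp (- (c * ((real k0)\<^sup>2 - 1))) \<le> C * (1/2) ^ k0"
    and k: "k0 \<le> k"
  shows "real k ^ j * exp (- (c * ((real k)\<^sup>2 - 1))) \<le> C * (1/2) ^ k"
  using k
proof (induction k rule: dec_induct)
  case base then show ?case using assms by simp
next
  case (step k)
  then have k2: "real k \<ge> 2" using k0 by simp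
  have "real (Suc k) ^ j * exp (- (c * ((real (Suc k))\<^sup>2 - 1)))
      = real (Suc k) ^ j * (exp (- (c * ((real k)\<^sup>2 - 1))) * exp (- (c * (2 * real k + 1))))"
    by (simp add: exp_add[symmetric] power2_eq_square algebra_simps)
  also have "\<dots> \<le> (3/2 * real k) ^ j * (exp (- (c * ((real k)\<^sup>2 - 1))) * exp (- (5 * c)))"
  proof (intro mult_mono power_mono)
    show "exp (- (c * (2 * real k + 1))) \<le> exp (- (5 * c))"
      using mult_left_mono[OF _ c, of 5 "2 * real k + 1"] k2 by (simp add: mult.commute)
  qed (use k2 in auto)
  also have "\<dots> = (real k ^ j * exp (- (c * ((real k)\<^sup>2 - 1)))) * ((3/2) ^ j * exp (- (5 * c)))"
    by (simp only: power_mult_distrib mult_ac)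
  also have "\<dots> \<le> (C * (1/2) ^ k) * (1/2)"
  proof (rule mult_mono[OF step.IH r])
    have "0 \<le> real k ^ j * exp (- (c * ((real k)\<^sup>2 - 1)))" by simp
    then show "0 \<le> C * (1/2) ^ k" using step.IH by linarith
  qed auto
  finally show ?case by simp
qed

text \<open>A common majorant for the terms to be neglected; its sum over the integers is the rational number \<open>14/5\<close>.\<close>

definition uwt :: "nat \<Rightarrow> real" where
  "uwt k = (if k = 0 then 0 else if k = 1 then 1 else 4/5 * (1/2) ^ k)"

lemma uwt_nonneg: "uwt k \<ge> 0" by (simp add: uwt_def)

lemma has_sum_half_int: "((\<lambda>k::int. (1/2) ^ nat \<bar>k\<bar>) has_sum (3::real)) UNIV"
proof -
  have g: "((\<lambda>n::nat. (1/2) ^ n) has_sum (2::real)) UNIV"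
    using geometric_sums[of "1/2::real"] by (intro sums_nonneg_imp_has_sum) auto
  have 1: "((\<lambda>k::int. (1/2) ^ nat \<bar>k\<bar>) has_sum (2::real)) (range int)"
    by (subst has_sum_reindex) (use g in \<open>auto simp: o_def inj_on_def\<close>)
  have 2: "((\<lambda>k::int. (1/2) ^ nat \<bar>k\<bar>) has_sum (1::real)) (range (\<lambda>n. - int n - 1))"
  proof (subst has_sum_reindex)
    have "nat \<bar>- int n - 1\<bar> = Suc n" for n by simp
    then show "((\<lambda>k::int. (1/2) ^ nat \<bar>k\<bar>) \<circ> (\<lambda>n. - int n - 1) has_sum (1::real)) UNIV"
      using has_sum_cmult_right[OF g, of "1/2"] by (simp add: o_def)
  qed (auto simp: inj_on_def)
  have U: "range int \<union> range (\<lambda>n. - int n - 1) = UNIV"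
  proof -
    have "x \<in> range int \<union> range (\<lambda>n. - int n - 1)" for x :: int
    proof (cases "x \<ge> 0")
      case True then show ?thesis by (metis UnI1 nonneg_int_cases rangeI)
    next
      case False
      then have "x = - int (nat (- x - 1)) - 1" by simp
      then show ?thesis by blast
    qed
    then show ?thesis by blast
  qed
  have "range int \<inter> range (\<lambda>n. - int n - 1) = {}" by auto
  from has_sum_Un_disjoint[OF 1 2 this] show ?thesis by (simp add: U)
qed

lemma has_sum_uwt: "((\<lambda>k::int. uwt (nat \<bar>k\<bar>)) has_sum (14/5)) UNIV"
proof -
  have 1: "((\<lambda>k::int. 3/5 * of_bool (k \<in> {1,-1})) has_sum (6/5 :: real)) UNIV"
    by (rule has_sum_finite_neutralI[of "{1,-1}"]) auto
  have 2: "((\<lambda>k::int. - (4/5) * of_bool (k = 0)) has_sum (-4/5 :: real)) UNIV"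
    by (rule has_sum_finite_neutralI[of "{0}"]) auto
  have "uwt (nat \<bar>k\<bar>) = 3/5 * of_bool (k \<in> {1,-1}) + - (4/5) * of_bool (k = 0) + 4/5 * (1/2) ^ nat \<bar>k\<bar>" for k :: int
    by (auto simp: uwt_def nat_eq_iff abs_if split: if_splits)
  then show ?thesis
    using has_sum_add[OF has_sum_add[OF 1 2] has_sum_cmult_right[OF has_sum_half_int, of "4/5"]] by simp
qed

text \<open>The error budget of the Fourier estimates. The four modes with indices of modulus 1
  contribute 8 against the total \<open>(14/5)\<^sup>2 = 196/25\<close> of the products. Subtracting
  the product on those modes as well keeps the sum factorised and leaves weight 1 there.\<close>

definition lwt :: "int \<Rightarrow> int \<Rightarrow> real" where
  "lwt m k = 2 * of_bool (\<bar>m\<bar> = 1 \<and> \<bar>k\<bar> = 1) - uwt (nat \<bar>m\<bar>) * uwt (nat \<bar>k\<bar>)"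

lemma has_sum_lwt: "((\<lambda>(m,k). lwt m k) has_sum (4/25)) UNIV"
proof -
  have 1: "((\<lambda>(m::int,k::int). 2 * of_bool (\<bar>m\<bar> = 1 \<and> \<bar>k\<bar> = 1)) has_sum (8 :: real)) UNIV"
    by (rule has_sum_finite_neutralI[of "{1,-1} \<times> {1,-1}"]) auto
  have s: "(\<lambda>k::int. uwt (nat \<bar>k\<bar>)) summable_on UNIV" "infsum (\<lambda>k::int. uwt (nat \<bar>k\<bar>)) UNIV = 14/5"
    using has_sum_uwt by (auto simp: has_sum_iff)
  have 2: "((\<lambda>(m::int,k::int). uwt (nat \<bar>m\<bar>) * uwt (nat \<bar>k\<bar>)) has_sum (196/25 :: real)) UNIV"
    using summable_on_product[OF s(1) s(1) uwt_nonneg uwt_nonneg] s(2) by (simp add: has_sum_iff)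
  from has_sum_add[OF 1 has_sum_uminusI[OF 2]] show ?thesis
    by (simp add: lwt_def case_prod_unfold)
qed

text \<open>Symmetrising over the exchange of the two indices removes the degeneracy of the
  Fourier coefficients at \<open>s = 1\<close>, that is at \<open>a = b\<close>.\<close>

lemma symmetrised_sum_pos:
  fixes f :: "int \<Rightarrow> int \<Rightarrow> real"
  assumes f: "((\<lambda>(m,k). f m k) has_sum S) UNIV" and c: "c > 0"
    and nonneg: "\<And>m k. 0 \<le> m \<Longrightarrow> 0 \<le> k \<Longrightarrow> m \<le> k \<Longrightarrow> (f m k + f k m) / 2 \<ge> c * lwt m k"
    and even: "\<And>m k. f (- m) k = f m k" "\<And>m k. f m (- k) = f m k"
  shows "S > 0"
proof -
  have "((\<lambda>(m,k). f m k) has_sum S) (UNIV \<times> UNIV)" using f by simp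
  then have "((\<lambda>(m,k). f k m) has_sum S) UNIV"
    by (subst (asm) has_sum_swap) (simp add: case_prod_unfold)
  from has_sum_cmult_right[OF has_sum_add[OF f this], of "1/2"]
  have g: "((\<lambda>(m,k). (f m k + f k m) / 2) has_sum S) UNIV" by (simp add: case_prod_unfold)
  have fa: "f m k = f \<bar>m\<bar> \<bar>k\<bar>" for m k using even by (metis abs_if)
  have la: "lwt m k = lwt \<bar>m\<bar> \<bar>k\<bar>" "lwt m k = lwt k m" for m k by (simp_all add: lwt_def conj_commute mult.commute)
  have "c * lwt m k \<le> (f m k + f k m) / 2" for m k
  proof (cases "\<bar>m\<bar> \<le> \<bar>k\<bar>")
    case True
    then show ?thesis using nonneg[of "\<bar>m\<bar>" "\<bar>k\<bar>"] fa[of m k] fa[of k m] la(1)[of m k] by simp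
  next
    case False
    then show ?thesis using nonneg[of "\<bar>k\<bar>" "\<bar>m\<bar>"] fa[of m k] fa[of k m] la(1)[of m k] la(2)[of "\<bar>m\<bar>" "\<bar>k\<bar>"] by (simp add: add.commute)
  qed
  then have "c * (4/25) \<le> S"
    by (intro has_sum_mono[OF has_sum_cmult_right[OF has_sum_lwt, of c] g]) auto
  then show ?thesis using c by simp
qed

text \<open>The exponents are a rate times 5, for the ratio in \<open>gauss_power_decay\<close>, or
  times \<open>k0\<^sup>2 - 1\<close>, for its base case. The rates are \<open>109/100\<close>,
  which is below \<open>3.14 * 0.35\<close> and so below \<open>pi * y / s\<close>;
  \<open>2\<close>, a lower bound for \<open>pi * s * y\<close>; and \<open>3/2\<close>.\<close>

lemma exp_num:
  "exp (- (109/20)) \<le> (1/100::real)" "exp (- (327/100)) \<le> (1/25 :: real)" "exp (- (218/25)) \<le> (17/100000 :: real)"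
  "exp (- 6) \<le> (1/400::real)" "exp (-10) \<le> (1/20000 :: real)" "exp (-16) \<le> (1/1000000 :: real)" "exp (- (15/2)) \<le> (1/1000::real)"
  "exp (- (9/2)) \<le> (1/80::real)"
proof -
  show "exp (- (109/20)) \<le> (1/100::real)" by (rule exp_minus_le[of "9/20" _ 5]) (simp_all add: power2_eq_square power_divide)
  show "exp (- (327/100)) \<le> (1/25::real)" by (rule exp_minus_le[of "27/100" _ 3]) (simp_all add: power2_eq_square power_divide)
  show "exp (- (218/25)) \<le> (17/100000 :: real)" by (rule exp_minus_le[of "72/100" _ 8]) (simp_all add: power2_eq_square power_divide)
  show "exp (- 6) \<le> (1/400::real)" by (rule exp_minus_le[of 0 _ 6]) (simp_all add: power_divide)
  show "exp (-10) \<le> (1/20000 :: real)" by (rule exp_minus_le[of 0 _ 10]) (simp_all add: power_divide)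
  show "exp (-16) \<le> (1/1000000 :: real)" by (rule exp_minus_le[of 0 _ 16]) (simp_all add: power_divide)
  show "exp (- (15/2)) \<le> (1/1000::real)" by (rule exp_minus_le[of "1/2" _ 7]) (simp_all add: power2_eq_square power_divide)
  show "exp (- (9/2)) \<le> (1/80::real)" by (rule exp_minus_le[of "1/2" _ 4]) (simp_all add: power2_eq_square power_divide)
qed

lemma linear_exp_antimono:
  fixes \<beta> \<beta>0 n :: real
  assumes "0 < \<beta>0" "\<beta>0 \<le> \<beta>" "1 \<le> \<beta>0 * n"
  shows "\<beta> * exp (- (\<beta> * n)) \<le> \<beta>0 * exp (- (\<beta>0 * n))"
proof -
  have "\<beta> - \<beta>0 \<le> (\<beta> - \<beta>0) * (\<beta>0 * n)" using assms by (simp add: mult_le_cancel_left1)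
  then have "\<beta> \<le> \<beta>0 * (1 + (\<beta> - \<beta>0) * n)" by (simp add: algebra_simps)
  also have "\<dots> \<le> \<beta>0 * exp ((\<beta> - \<beta>0) * n)" using assms by (intro mult_left_mono exp_ge_add_one_self) auto
  finally have "\<beta> * exp (- (\<beta> * n)) \<le> \<beta>0 * exp ((\<beta> - \<beta>0) * n) * exp (- (\<beta> * n))"
    by (intro mult_right_mono) auto
  also have "\<dots> = \<beta>0 * exp (- (\<beta>0 * n))" by (simp add: exp_add[symmetric] mult.assoc algebra_simps)
  finally show ?thesis .
qed

lemma uwt_ge2: "k \<ge> 2 \<Longrightarrow> uwt k = 4/5 * (1/2) ^ k" by (simp add: uwt_def)

lemma uwt_bound_sq:
  assumes "1 \<le> p" "109/100 \<le> \<beta>"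
  shows "(real p)\<^sup>2 * exp (- (\<beta> * ((real p)\<^sup>2 - 1))) \<le> uwt p"
proof (cases "p = 1")
  case True then show ?thesis by (simp add: uwt_def)
next
  case False
  then have p: "2 \<le> p" using assms by simp
  have "(real p)\<^sup>2 \<ge> 1" using p by simp
  then have "109/100 * ((real p)\<^sup>2 - 1) \<le> \<beta> * ((real p)\<^sup>2 - 1)"
    using assms by (intro mult_right_mono) auto
  then have "exp (- (\<beta> * ((real p)\<^sup>2 - 1))) \<le> exp (- (109/100 * ((real p)\<^sup>2 - 1)))"
    by (simp only: exp_le_cancel_iff neg_le_iff_le)
  then have "(real p)\<^sup>2 * exp (- (\<beta> * ((real p)\<^sup>2 - 1))) \<le> (real p)\<^sup>2 * exp (- (109/100 * ((real p)\<^sup>2 - 1)))"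
    by (intro mult_left_mono) auto
  also have "\<dots> \<le> 4/5 * (1/2) ^ p"
    by (rule gauss_power_decay[OF _ _ _ _ p]) (use exp_num(1,2) in \<open>simp_all add: power2_eq_square\<close>)
  finally show ?thesis using p by (simp add: uwt_ge2)
qed

lemma uwt_bound_6:
  assumes "3 \<le> q"
  shows "109/200 * (real q) ^ 6 * exp (- (109/100 * ((real q)\<^sup>2 - 1))) + (real q) ^ 4 * exp (- (2 * ((real q)\<^sup>2 - 1))) \<le> uwt q"
proof -
  have "(real q) ^ 6 * exp (- (109/100 * ((real q)\<^sup>2 - 1))) \<le> 1 * (1/2) ^ q"
    by (rule gauss_power_decay[OF _ _ _ _ assms]) (use exp_num(1,3) in \<open>simp_all add: power2_eq_square power_divide\<close>)
  moreover have "(real q) ^ 4 * exp (- (2 * ((real q)\<^sup>2 - 1))) \<le> 1/100 * (1/2) ^ q"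
    by (rule gauss_power_decay[OF _ _ _ _ assms]) (use exp_num(5,6) in \<open>simp_all add: power2_eq_square power_divide\<close>)
  ultimately have "109/200 * ((real q) ^ 6 * exp (- (109/100 * ((real q)\<^sup>2 - 1)))) + (real q) ^ 4 * exp (- (2 * ((real q)\<^sup>2 - 1)))
     \<le> 109/200 * (1 * (1/2) ^ q) + 1/100 * (1/2) ^ q" by (intro add_mono mult_left_mono) auto
  also have "\<dots> \<le> uwt q" using assms by (simp add: uwt_ge2)
  finally show ?thesis by simp
qed

lemma uwt_bound_cube:
  assumes "2 \<le> p" "3 \<le> w"
  shows "(real p) ^ 6 * exp (- (w * ((real p)\<^sup>2 - 1))) \<le> uwt p * uwt p"
proof -
  have p1: "(real p)\<^sup>2 \<ge> 1" using assms by simp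
  have *: "(real p) ^ 3 * exp (- (3/2 * ((real p)\<^sup>2 - 1))) \<le> uwt p"
    unfolding uwt_ge2[OF assms(1)]
    by (rule gauss_power_decay[OF _ _ _ _ assms(1)]) (use exp_num(7,8) in \<open>simp_all add: power2_eq_square power_divide\<close>)
  have "3 * ((real p)\<^sup>2 - 1) \<le> w * ((real p)\<^sup>2 - 1)"
    using assms p1 by (intro mult_right_mono) auto
  then have "exp (- (w * ((real p)\<^sup>2 - 1))) \<le> exp (- (3 * ((real p)\<^sup>2 - 1)))"
    by (simp only: exp_le_cancel_iff neg_le_iff_le)
  then have "(real p) ^ 6 * exp (- (w * ((real p)\<^sup>2 - 1))) \<le> (real p) ^ 6 * exp (- (3 * ((real p)\<^sup>2 - 1)))"
    by (intro mult_left_mono) auto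
  also have "\<dots> = ((real p) ^ 3 * exp (- (3/2 * ((real p)\<^sup>2 - 1)))) * ((real p) ^ 3 * exp (- (3/2 * ((real p)\<^sup>2 - 1))))"
    by (simp add: mult_ac flip: exp_add power_add)
  also have "\<dots> \<le> uwt p * uwt p" by (intro mult_mono * uwt_nonneg) auto
  finally show ?thesis .
qed

text \<open>Lowering \<open>\<alpha>\<close> to \<open>\<beta>\<close> in one exponential and to
  \<open>2\<close> in the other lets a common factor depending on \<open>p\<close> split off, and
  the rest depends on \<open>q\<close> only. The polynomial prefactor collects the bounds of
  \<open>pair_bounds\<close> and the quadratic growth of the cosine differences.\<close>

lemma fourier_pair_weight:
  fixes \<alpha> \<beta> :: real and p q :: nat
  assumes "109/100 \<le> \<beta>" "\<beta> \<le> \<alpha>" "2 \<le> \<alpha>" "1 \<le> p" "p < q" "3 \<le> q"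
  defines "M \<equiv> (real p)\<^sup>2" and "K \<equiv> (real q)\<^sup>2"
  shows "M * K / 2 * ((\<beta> * (K - M)\<^sup>2 + M) * exp (- (\<alpha> * (M - 1) + \<beta> * (K - 1)))
      + (M + K) * exp (- (\<alpha> * (K - 1) + \<beta> * (M - 1)))) \<le> uwt p * uwt q"
proof -
  have M1: "1 \<le> M" using assms by simp
  have MK: "M < K" using assms by (simp add: power_strict_mono)
  have K9: "9 \<le> K" using power_mono[of 3 "real q" 2] assms by simp
  define E where "E = exp (- (\<beta> * (M - 1)))"
  have E: "M * E \<le> uwt p" unfolding M_def E_def by (rule uwt_bound_sq) (use assms in auto)
  have aM: "\<beta> * (M - 1) \<le> \<alpha> * (M - 1)" using assms M1 by (intro mult_right_mono) auto
  have aK: "2 * (K - 1) \<le> \<alpha> * (K - 1)" using assms K9 by (intro mult_right_mono) auto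
  have "exp (- (\<alpha> * (M - 1) + \<beta> * (K - 1))) \<le> exp (- (\<beta> * (M - 1) + \<beta> * (K - 1)))"
    using aM by simp
  then have e1: "exp (- (\<alpha> * (M - 1) + \<beta> * (K - 1))) \<le> E * exp (- (\<beta> * (K - 1)))"
    unfolding E_def by (simp add: exp_add[symmetric])
  have "exp (- (\<alpha> * (K - 1) + \<beta> * (M - 1))) \<le> exp (- (2 * (K - 1) + \<beta> * (M - 1)))"
    using aK by simp
  then have e2: "exp (- (\<alpha> * (K - 1) + \<beta> * (M - 1))) \<le> E * exp (- (2 * (K - 1)))"
    unfolding E_def by (simp add: exp_add[symmetric])
  have b1: "\<beta> * (K - M)\<^sup>2 + M \<le> \<beta> * K\<^sup>2"
  proof -
    have "M * 1 \<le> M * (2 * K - M)" using M1 MK by (intro mult_left_mono) auto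
    then have "1 * M \<le> \<beta> * (M * (2 * K - M))"
      using assms(1) M1 by (intro mult_mono) auto
    then show ?thesis by (simp add: power2_eq_square algebra_simps)
  qed
  have b0: "0 \<le> \<beta> * (K - M)\<^sup>2 + M" using assms M1 by (intro add_nonneg_nonneg mult_nonneg_nonneg) auto
  have bn: "\<beta> * exp (- (\<beta> * (K - 1))) \<le> 109/100 * exp (- (109/100 * (K - 1)))"
    by (rule linear_exp_antimono) (use assms K9 in auto)
  have "M * K / 2 * ((\<beta> * (K - M)\<^sup>2 + M) * exp (- (\<alpha> * (M - 1) + \<beta> * (K - 1)))
      + (M + K) * exp (- (\<alpha> * (K - 1) + \<beta> * (M - 1))))
     \<le> M * K / 2 * ((\<beta> * K\<^sup>2) * (E * exp (- (\<beta> * (K - 1)))) + (2 * K) * (E * exp (- (2 * (K - 1)))))"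
    using M1 MK K9 assms b0 by (intro mult_left_mono add_mono mult_mono b1 e1 e2) auto
  also have "\<dots> = (M * E) * (K^3 / 2 * (\<beta> * exp (- (\<beta> * (K - 1)))) + K\<^sup>2 * exp (- (2 * (K - 1))))"
    by (simp add: power2_eq_square power3_eq_cube algebra_simps)
  also have "\<dots> \<le> (M * E) * (K^3 / 2 * (109/100 * exp (- (109/100 * (K - 1)))) + K\<^sup>2 * exp (- (2 * (K - 1))))"
    using M1 K9 by (intro mult_left_mono add_mono bn) (auto simp: E_def)
  also have "\<dots> = (M * E) * (109/200 * (real q) ^ 6 * exp (- (109/100 * ((real q)\<^sup>2 - 1))) + (real q) ^ 4 * exp (- (2 * ((real q)\<^sup>2 - 1))))"
    unfolding K_def by (simp flip: power_mult)
  also have "\<dots> \<le> uwt p * uwt q"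
    using E uwt_bound_6[OF assms(6)] M1 by (intro mult_mono uwt_nonneg) (auto simp: E_def)
  finally show ?thesis .
qed

section \<open>Horizontal comparison in the Fourier regime\<close>

lemma exp_diff_bound: "A \<le> B \<Longrightarrow> exp (- A) - exp (- B) \<le> (B - A) * exp (- A)" for A B :: real
proof -
  have "exp (- A) * (1 + (A - B)) \<le> exp (- A) * exp (A - B)" by (intro mult_left_mono exp_ge_add_one_self) auto
  then show ?thesis by (simp add: exp_add[symmetric] algebra_simps)
qed

text \<open>Formulated for a general family \<open>\<Delta>\<close> because the comparison is made
  both with real part \<open>1/2\<close> and with real part \<open>0\<close>. Pairs with a zero
  index vanish, the pair 1, 1 dominates, and every other pair is charged to \<open>lwt\<close>. The
  pair 1, 2 is the critical one and is responsible for the alternative in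
  \<open>two\<close>.\<close>

lemma fourier_sum_pos:
  fixes \<Delta> :: "int \<Rightarrow> real"
  assumes s: "s > 1" and y: "y \<ge> 2/3" and b: "y / s \<ge> 35/100" and d1: "\<Delta> 1 > 0"
    and \<Delta>: "\<And>N. \<bar>\<Delta> N\<bar> \<le> (of_int N)\<^sup>2 * \<Delta> 1" "\<And>N. \<Delta> (- N) = \<Delta> N" and two: "\<Delta> 2 \<le> 0 \<or> y / s \<ge> 58/100"
    and S: "((\<lambda>(m,k). pi * (s * y * (of_int m)\<^sup>2 - y / s * (of_int k)\<^sup>2) * efun (s * y) (y / s) m k * \<Delta> (m * k)) has_sum S) UNIV"
  shows "S > 0"
proof -
  define a where "a = s * y"
  define b where "b = y / s"
  define \<alpha> where "\<alpha> = pi * a"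
  define \<beta> where "\<beta> = pi * b"
  have ab: "0 < b" "b < a" using s y mult_strict_mono[of 1 s 1 s] by (auto simp: a_def b_def field_simps)
  have ay: "y \<le> a" unfolding a_def using s y by (simp add: mult_le_cancel_right1)
  have "3.14 * (35/100) \<le> \<beta>"
    unfolding \<beta>_def by (intro mult_mono) (use pi_gt_314 assms(3) in \<open>auto simp: b_def\<close>)
  then have \<beta>: "109/100 \<le> \<beta>" by simp
  have \<alpha>: "2 \<le> \<alpha>" unfolding \<alpha>_def using mult_mono[of "3" pi "2/3" a] pi_gt_314 assms ay by simp
  have ba: "\<beta> < \<alpha>" using ab by (simp add: \<alpha>_def \<beta>_def)
  define d1 where "d1 = \<Delta> 1"
  have d1: "d1 > 0" using d1 by (simp add: d1_def)
  have D0: "\<Delta> 0 = 0" using \<Delta>(1)[of 0] by simp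
  define f where "f m k = pi * (a * (of_int m)\<^sup>2 - b * (of_int k)\<^sup>2) * efun a b m k * \<Delta> (m * k)" for m k
  define C where "C = pi * (a - b) * exp (- (\<alpha> + \<beta>)) * d1"
  have C: "C > 0" using ab d1 by (simp add: C_def)
  have "((\<lambda>(m,k). f m k) has_sum S) UNIV" using S by (simp add: f_def a_def b_def)
  then show "S > 0"
  proof (rule symmetrised_sum_pos[OF _ C])
    show "f (- m) k = f m k" "f m (- k) = f m k" for m k
      using \<Delta>(2)[of "m * k"] by (simp_all add: f_def efun_def)
    fix m k :: int assume mk: "0 \<le> m" "0 \<le> k" "m \<le> k"
    define p q where "p = nat m" and "q = nat k"
    have pq: "m = int p" "k = int q" "p \<le> q" using mk by (auto simp: p_def q_def)
    define M K where "M = (real p)\<^sup>2" and "K = (real q)\<^sup>2"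
    have MKi: "(of_int m)\<^sup>2 = M" "(of_int k)\<^sup>2 = K" by (simp_all add: pq M_def K_def)
    have MK: "0 \<le> M" "M \<le> K" using pq by (auto simp: M_def K_def power_mono)
    define nA nB where "nA = efun a b m k" and "nB = efun a b k m"
    have nA: "nA = exp (- (pi * (a * M + b * K)))" and nB: "nB = exp (- (pi * (a * K + b * M)))"
      by (simp_all add: nA_def nB_def efun_def MKi)
    have AB: "pi * (a * M + b * K) \<le> pi * (a * K + b * M)"
    proof -
      have "0 \<le> (a - b) * (K - M)" using ab MK by (intro mult_nonneg_nonneg) auto
      then show ?thesis by (intro mult_left_mono) (auto simp: algebra_simps)
    qed
    have nAB: "0 \<le> nB" "nB \<le> nA" "nA - nB \<le> (pi * (a * K + b * M) - pi * (a * M + b * K)) * nA"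
      using AB exp_diff_bound[OF AB] unfolding nA nB by auto
    define S where "S = (a * M - b * K) * nA + (a * K - b * M) * nB"
    define D where "D = \<Delta> (m * k)"
    have D: "\<bar>D\<bar> \<le> M * K * d1" using \<Delta>(1)[of "m * k"] by (simp add: D_def d1_def power_mult_distrib MKi)
    have fS: "(f m k + f k m) / 2 = pi / 2 * (S * D)"
    proof -
      have "f m k = pi * (a * M - b * K) * nA * D" by (simp only: f_def nA_def MKi D_def)
      moreover have "f k m = pi * (a * K - b * M) * nB * D" by (simp only: f_def nB_def MKi D_def mult.commute[of k m])
      ultimately show ?thesis unfolding S_def by (simp only:) (simp add: algebra_simps add_divide_distrib diff_divide_distrib)
    qed
    have S1: "S \<le> (a - b) * (M * nA + (M + K) * nB)" and S2: "- S \<le> (a - b) * (pi * b * (K - M)\<^sup>2 * nA)"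
      unfolding S_def using pair_bounds[OF ab(1) less_imp_le[OF ab(2)] MK nAB] by auto
    define X1 X2 where "X1 = exp (- (\<alpha> * (M - 1) + \<beta> * (K - 1)))" and "X2 = exp (- (\<alpha> * (K - 1) + \<beta> * (M - 1)))"
    have nX: "nA = exp (- (\<alpha> + \<beta>)) * X1" "nB = exp (- (\<alpha> + \<beta>)) * X2"
      by (simp_all add: nA nB X1_def X2_def \<alpha>_def \<beta>_def exp_add[symmetric] algebra_simps)
    have lw: "lwt m k = 2 * of_bool (p = 1 \<and> q = 1) - uwt p * uwt q"
      by (simp add: lwt_def pq)
    consider "p = 0" | "p = 1" "q = 1" | "2 \<le> p" "q = p" | "p = 1" "q = 2" | "1 \<le> p" "p < q" "3 \<le> q"
      using pq(3) by linarith
    then show "(f m k + f k m) / 2 \<ge> C * lwt m k"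
    proof cases
      case 1
      then show ?thesis unfolding fS lw by (simp add: D_def pq D0 uwt_def)
    next
      case 2
      then have "M = 1" "K = 1" by (auto simp: M_def K_def)
      then show ?thesis using 2 unfolding fS lw S_def nX X1_def X2_def D_def
        by (simp add: uwt_def C_def pq d1_def algebra_simps)
    next
      case 3
      then have KM: "K = M" by (simp add: K_def M_def)
      have "\<alpha> + \<beta> \<ge> 3" using \<alpha> \<beta> by simp
      then have u: "M ^ 3 * X1 \<le> uwt p * uwt p"
        using uwt_bound_cube[OF 3(1), of "\<alpha> + \<beta>"] unfolding X1_def KM M_def
        by (simp add: algebra_simps flip: power_mult)
      have "S * D \<ge> - (S * (M * K * d1))"
      proof -
        have "S \<ge> 0" unfolding S_def KM using ab MK by (auto simp: nA nB intro!: add_nonneg_nonneg mult_nonneg_nonneg simp flip: left_diff_distrib)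
        then have "S * (- (M * K * d1)) \<le> S * D" using D by (intro mult_left_mono) auto
        then show ?thesis by simp
      qed
      moreover have "S * (M * K * d1) = 2 * ((a - b) * exp (- (\<alpha> + \<beta>)) * d1) * (M ^ 3 * X1)"
        unfolding S_def nX KM X1_def X2_def by (simp add: power3_eq_cube algebra_simps)
      moreover have "2 * ((a - b) * exp (- (\<alpha> + \<beta>)) * d1) * (M ^ 3 * X1) \<le> 2 * ((a - b) * exp (- (\<alpha> + \<beta>)) * d1) * (uwt p * uwt p)"
        using ab d1 by (intro mult_left_mono u) auto
      ultimately have "pi / 2 * (S * D) \<ge> pi / 2 * - (2 * ((a - b) * exp (- (\<alpha> + \<beta>)) * d1) * (uwt p * uwt p))"
        by (intro mult_left_mono) auto
      then show ?thesis using 3 unfolding fS lw by (simp add: C_def algebra_simps)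
    next
      case 4
      then have MK': "M = 1" "K = 4" by (auto simp: M_def K_def)
      have X1: "X1 = exp (- (\<beta> * 3))" and X2: "X2 \<le> 1/400"
      proof -
        show "X1 = exp (- (\<beta> * 3))" unfolding X1_def MK' by simp
        have "X2 \<le> exp (- 6)" unfolding X2_def MK' using \<alpha> by simp
        then show "X2 \<le> 1/400" using exp_num(4) by linarith
      qed
      have "\<exists>B. S * D \<ge> - (2 * ((a - b) * exp (- (\<alpha> + \<beta>)) * d1) * B) \<and> B \<le> uwt p * uwt q"
      proof (cases "D \<le> 0")
        case De: True
        \<comment> \<open>When \<open>\<Delta> 2\<close> is nonpositive, only a positive
          \<open>S\<close> does harm, and the upper bound for \<open>S\<close> has no factor
          \<open>\<beta>\<close>.\<close>
        have "X1 + 5 * X2 \<le> 1/25 + 5 * (1/400)"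
        proof (intro add_mono mult_left_mono)
          have "X1 \<le> exp (- (327/100))" unfolding X1 using \<beta> by simp
          then show "X1 \<le> 1/25" using exp_num(2) by linarith
          show "X2 \<le> 1/400" by (rule X2)
        qed auto
        then have u: "2 * (X1 + 5 * X2) \<le> uwt p * uwt q" by (simp add: 4 uwt_def power_divide)
        have "S * D \<ge> - (((a - b) * (M * nA + (M + K) * nB)) * (M * K * d1))"
        proof (cases "S \<ge> 0")
          case True
          have "S * (- D) \<le> ((a - b) * (M * nA + (M + K) * nB)) * (M * K * d1)"
            using True S1 D De by (intro mult_mono) auto
          then show ?thesis by simp
        next
          case False
          then have "0 \<le> S * D" using De by (intro mult_nonpos_nonpos) auto
          moreover have "0 \<le> ((a - b) * (M * nA + (M + K) * nB)) * (M * K * d1)"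
            using ab MK d1 nAB by (intro mult_nonneg_nonneg add_nonneg_nonneg) auto
          ultimately show ?thesis by linarith
        qed
        also have "((a - b) * (M * nA + (M + K) * nB)) * (M * K * d1) = 2 * ((a - b) * exp (- (\<alpha> + \<beta>)) * d1) * (2 * (X1 + 5 * X2))"
          unfolding nX MK' by (simp add: algebra_simps)
        finally have "S * D \<ge> - (2 * ((a - b) * exp (- (\<alpha> + \<beta>)) * d1) * (2 * (X1 + 5 * X2)))" by simp
        then show ?thesis using u by blast
      next
        case False
        \<comment> \<open>The other sign also calls on the lower bound for \<open>S\<close> with its
          factor \<open>9 * \<beta>\<close>. With \<open>\<beta> \<ge> 182/100\<close> the cost is
          about \<open>0.175\<close>, against the allowance
          \<open>uwt 1 * uwt 2 = 1/5\<close>.\<close>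
        then have "58/100 \<le> b" using two by (auto simp: D_def pq 4 b_def)
        then have "3.14 * (58/100) \<le> \<beta>" unfolding \<beta>_def by (intro mult_mono) (use pi_gt_314 in auto)
        then have \<beta>2: "182/100 \<le> \<beta>" by simp
        have "\<beta> * X1 \<le> 182/100 * exp (- (182/100 * 3))" unfolding X1 by (rule linear_exp_antimono) (use \<beta>2 in auto)
        moreover have e: "exp (- (546/100)) \<le> (431/100000 :: real)"
          by (rule exp_minus_le[of "46/100" _ 5]) (simp_all add: power2_eq_square power_divide)
        moreover have "X1 \<le> exp (- (546/100))" unfolding X1 using \<beta>2 by simp
        ultimately have u: "2 * ((9 * \<beta> + 1) * X1 + 5 * X2) \<le> uwt p * uwt q"
          using X2 by (simp add: 4 uwt_def power_divide algebra_simps)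
        have "\<bar>S\<bar> \<le> (a - b) * (M * nA + (M + K) * nB) + (a - b) * (pi * b * (K - M)\<^sup>2 * nA)"
        proof -
          have "0 \<le> (a - b) * (M * nA + (M + K) * nB)" "0 \<le> (a - b) * (pi * b * (K - M)\<^sup>2 * nA)"
            using ab MK nAB by (auto intro!: mult_nonneg_nonneg add_nonneg_nonneg)
          then show ?thesis using S1 S2 by linarith
        qed
        then have "\<bar>S * D\<bar> \<le> ((a - b) * (M * nA + (M + K) * nB) + (a - b) * (pi * b * (K - M)\<^sup>2 * nA)) * (M * K * d1)"
          unfolding abs_mult using D by (intro mult_mono) auto
        also have "\<dots> = 2 * ((a - b) * exp (- (\<alpha> + \<beta>)) * d1) * (2 * ((9 * \<beta> + 1) * X1 + 5 * X2))"
          unfolding nX MK' by (simp add: \<beta>_def algebra_simps)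
        finally have "S * D \<ge> - (2 * ((a - b) * exp (- (\<alpha> + \<beta>)) * d1) * (2 * ((9 * \<beta> + 1) * X1 + 5 * X2)))" by linarith
        then show ?thesis using u by blast
      qed
      then obtain B where B: "S * D \<ge> - (2 * ((a - b) * exp (- (\<alpha> + \<beta>)) * d1) * B)" and u: "B \<le> uwt p * uwt q" by blast
      have "2 * ((a - b) * exp (- (\<alpha> + \<beta>)) * d1) * B \<le> 2 * ((a - b) * exp (- (\<alpha> + \<beta>)) * d1) * (uwt p * uwt q)"
        using ab d1 by (intro mult_left_mono u) auto
      then have "pi / 2 * (S * D) \<ge> pi / 2 * - (2 * ((a - b) * exp (- (\<alpha> + \<beta>)) * d1) * (uwt p * uwt q))"
        using B by (intro mult_left_mono) auto
      then show ?thesis using 4 unfolding fS lw by (simp add: C_def algebra_simps)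
    next
      case 5
      have u: "M * K / 2 * ((\<beta> * (K - M)\<^sup>2 + M) * X1 + (M + K) * X2) \<le> uwt p * uwt q"
        unfolding X1_def X2_def M_def K_def by (rule fourier_pair_weight) (use 5 \<alpha> \<beta> ba in auto)
      have nn: "0 \<le> (a - b) * (M * nA + (M + K) * nB)" "0 \<le> (a - b) * (pi * b * (K - M)\<^sup>2 * nA)"
        using ab MK nAB by (auto intro!: mult_nonneg_nonneg add_nonneg_nonneg)
      have "\<bar>S\<bar> \<le> (a - b) * (M * nA + (M + K) * nB) + (a - b) * (pi * b * (K - M)\<^sup>2 * nA)"
        using S1 S2 nn by linarith
      then have "\<bar>S * D\<bar> \<le> ((a - b) * (M * nA + (M + K) * nB) + (a - b) * (pi * b * (K - M)\<^sup>2 * nA)) * (M * K * d1)"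
        unfolding abs_mult using D by (intro mult_mono) auto
      also have "\<dots> = 2 * ((a - b) * exp (- (\<alpha> + \<beta>)) * d1) * (M * K / 2 * ((\<beta> * (K - M)\<^sup>2 + M) * X1 + (M + K) * X2))"
        unfolding nX by (simp add: \<beta>_def algebra_simps)
      also have "\<dots> \<le> 2 * ((a - b) * exp (- (\<alpha> + \<beta>)) * d1) * (uwt p * uwt q)"
        using ab d1 by (intro mult_left_mono u) auto
      finally have "pi / 2 * (S * D) \<ge> pi / 2 * - (2 * ((a - b) * exp (- (\<alpha> + \<beta>)) * d1) * (uwt p * uwt q))"
        by (intro mult_left_mono) auto
      moreover have "lwt m k = - (uwt p * uwt q)" unfolding lw using 5 by auto
      ultimately show ?thesis unfolding fS by (simp add: C_def algebra_simps)
    qed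
  qed
qed

lemma ntheta'_fourier_diff:
  assumes "s > 0" "y > 0"
  shows "((\<lambda>(m,k). pi * (s * y * (of_int m)\<^sup>2 - y / s * (of_int k)\<^sup>2) * efun (s * y) (y / s) m k *
     (cos (2 * pi * of_int (m * k) * x) - cos (2 * pi * of_int (m * k) * x'))) has_sum (ntheta' s x' y - ntheta' s x y) / sqrt y) UNIV"
proof -
  from has_sum_add[OF ntheta_fourier(2)[OF assms, of x'] has_sum_uminusI[OF ntheta_fourier(2)[OF assms, of x]]]
  have "((\<lambda>p. (case p of (m,k) \<Rightarrow> pi * (y / s * (of_int k)\<^sup>2 - s * y * (of_int m)\<^sup>2) * efun (s * y) (y / s) m k * cos (2 * pi * (of_int m * of_int k) * x'))
        + - (case p of (m,k) \<Rightarrow> pi * (y / s * (of_int k)\<^sup>2 - s * y * (of_int m)\<^sup>2) * efun (s * y) (y / s) m k * cos (2 * pi * (of_int m * of_int k) * x)))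
        has_sum (ntheta' s x' y - ntheta' s x y) / sqrt y) UNIV" by (simp add: diff_divide_distrib)
  then show ?thesis
    by (rule has_sum_cong[THEN iffD1, rotated]) (auto simp: algebra_simps)
qed

theorem ntheta'_less_half_fourier:
  assumes "s > 1" "y \<ge> 2/3" "y / s \<ge> 35/100" "cos (2 * pi * x) > -1"
  shows "ntheta' s x y < ntheta' s (1/2) y"
proof -
  have dc: "cos (2 * pi * of_int N * x) - cos (2 * pi * of_int N * (1/2)) = dcos x N" for N by (simp add: dcos_def)
  have "((\<lambda>(m,k). pi * (s * y * (of_int m)\<^sup>2 - y / s * (of_int k)\<^sup>2) * efun (s * y) (y / s) m k * dcos x (m * k))
     has_sum (ntheta' s (1/2) y - ntheta' s x y) / sqrt y) UNIV"
    using ntheta'_fourier_diff[of s y x "1/2"] assms unfolding dc by simp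
  then have "(ntheta' s (1/2) y - ntheta' s x y) / sqrt y > 0"
  proof (rule fourier_sum_pos[OF assms(1-3), of "dcos x", rotated -1])
    show "dcos x 1 > 0" using assms by (simp add: dcos_bounds(4))
    show "\<bar>dcos x N\<bar> \<le> (of_int N)\<^sup>2 * dcos x 1" for N by (rule dcos_bounds(1))
    show "dcos x (- N) = dcos x N" for N by (simp add: dcos_def)
    show "dcos x 2 \<le> 0 \<or> 58/100 \<le> y / s" using dcos_bounds(2)[of 2 x] by simp
  qed
  then show ?thesis using assms by (simp add: zero_less_divide_iff)
qed

text \<open>Relative to real part \<open>0\<close> the second harmonic difference is nonnegative, so
  the larger bound on \<open>y / s\<close> is required. When \<open>cos (2 * pi * x) = 1\<close>,
  all harmonics agree and the two values coincide.\<close>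

theorem ntheta'_zero_le_fourier:
  assumes "s > 1" "y \<ge> 2/3" "y / s \<ge> 58/100"
  shows "ntheta' s 0 y \<le> ntheta' s x y"
proof (cases "cos (2 * pi * x) = 1")
  case True
  have "cos (2 * pi * of_int N * x) = 1" for N :: int
  proof (rule antisym)
    show "1 \<le> cos (2 * pi * of_int N * x)" using one_minus_cos_mult_le[of N "2 * pi * x"] True by (simp add: mult_ac)
  qed simp
  then have d: "cos (2 * pi * of_int N * 0) - cos (2 * pi * of_int N * x) = 0" for N :: int by simp
  have "((\<lambda>_ :: int \<times> int. 0) has_sum (ntheta' s x y - ntheta' s 0 y) / sqrt y) UNIV"
    using ntheta'_fourier_diff[of s y 0 x] assms unfolding d by (simp add: case_prod_unfold)
  from has_sum_unique[OF this has_sum_0_simp] have "(ntheta' s x y - ntheta' s 0 y) / sqrt y = 0" .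
  then show ?thesis using assms by simp
next
  case False
  then have "cos (2 * pi * x) < 1" using order_le_less cos_le_one by blast
  let ?D = "\<lambda>N. 1 - cos (2 * pi * of_int N * x)"
  have d: "cos (2 * pi * of_int N * 0) - cos (2 * pi * of_int N * x) = ?D N" for N :: int by simp
  have "((\<lambda>(m,k). pi * (s * y * (of_int m)\<^sup>2 - y / s * (of_int k)\<^sup>2) * efun (s * y) (y / s) m k * ?D (m * k))
     has_sum (ntheta' s x y - ntheta' s 0 y) / sqrt y) UNIV"
    using ntheta'_fourier_diff[of s y 0 x] assms unfolding d by simp
  then have "(ntheta' s x y - ntheta' s 0 y) / sqrt y > 0"
  proof (rule fourier_sum_pos[OF assms(1,2), of ?D, rotated -1])
    show "35/100 \<le> y / s" using assms(3) by linarith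
    show "?D 1 > 0" using \<open>cos (2 * pi * x) < 1\<close> by simp
    show "\<bar>?D N\<bar> \<le> (of_int N)\<^sup>2 * ?D 1" for N
      using one_minus_cos_mult_le[of N "2 * pi * x"] by (simp add: mult_ac)
    show "?D 2 \<le> 0 \<or> 58/100 \<le> y / s" using assms(3) by blast
  qed simp
  then show ?thesis using assms by (simp add: zero_less_divide_iff)
qed

section \<open>Horizontal comparison in the Gaussian regime: convexity of the first slice\<close>

text \<open>With \<open>p = pi * T\<close>, \<open>c = a - 1/2\<close> and \<open>t = n + x\<close>,
  this is minus the summand of the Gaussian form of
  \<open>(th' T x - a * th T x) / sqrt T\<close>.\<close>

definition chi :: "real \<Rightarrow> real \<Rightarrow> real \<Rightarrow> real" where
  "chi c p t = (c + p * t\<^sup>2) * exp (- (p * t\<^sup>2))"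

lemma chi_even: "chi c p (- t) = chi c p t" by (simp add: chi_def)

lemma chi_deriv:
  "(chi c p has_real_derivative - (2 * p * t * (c - 1 + p * t\<^sup>2) * exp (- (p * t\<^sup>2)))) (at t)"
  unfolding chi_def
  by (auto intro!: derivative_eq_intros simp: power2_eq_square algebra_simps)

lemma chi_deriv2:
  "((\<lambda>t. - (2 * p * t * (c - 1 + p * t\<^sup>2) * exp (- (p * t\<^sup>2)))) has_real_derivative
     2 * p * exp (- (p * t\<^sup>2)) * ((2 * (p * t\<^sup>2) - 1) * (c - 1 + p * t\<^sup>2) - 2 * (p * t\<^sup>2))) (at t)"
  by (auto intro!: derivative_eq_intros simp: power2_eq_square algebra_simps)

lemma chi_bracket: "v \<ge> 1 \<Longrightarrow> c \<ge> 2 \<Longrightarrow> c - 2 \<le> (2 * v - 1) * (c - 1 + v) - 2 * v" for v c :: real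
proof -
  assume a: "v \<ge> 1" "c \<ge> 2"
  have "0 \<le> (v - 1) * (2 * c - 1) + 2 * (v - 1)\<^sup>2" using a by (intro add_nonneg_nonneg mult_nonneg_nonneg) auto
  then show ?thesis by (simp add: power2_eq_square algebra_simps)
qed

text \<open>Convexity of \<open>chi\<close> where \<open>p * t\<^sup>2 \<ge> 1\<close>, in the form
  of tangent inequalities. To the left of \<open>u\<close> the factor
  \<open>exp (- (p * t\<^sup>2))\<close> is at least its value at \<open>u\<close>, so the second
  derivative has a positive lower bound there, which yields the quadratic gain.\<close>

lemma chi_tangent:
  assumes p: "p > 0" and c: "c \<ge> 2" and t1: "p * t1\<^sup>2 \<ge> 1" "t1 > 0" and u: "t1 \<le> u" "t1 \<le> w"
  shows "chi c p w \<ge> chi c p u - 2 * p * u * (c - 1 + p * u\<^sup>2) * exp (- (p * u\<^sup>2)) * (w - u)"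
    and "w \<le> u \<Longrightarrow> chi c p w \<ge> chi c p u - 2 * p * u * (c - 1 + p * u\<^sup>2) * exp (- (p * u\<^sup>2)) * (w - u)
            + p * exp (- (p * u\<^sup>2)) * (c - 2) * (w - u)\<^sup>2"
proof -
  have v: "1 \<le> p * t\<^sup>2" if "t1 \<le> t" for t
    using power_mono[of t1 t 2] that t1 p mult_left_mono[of "t1\<^sup>2" "t\<^sup>2" p] by linarith
  have "- (2 * p * u * (c - 1 + p * u\<^sup>2) * exp (- (p * u\<^sup>2))) * (w - u) \<le> chi c p w - chi c p u"
  proof (rule f''_imp_f'[of "{t1..}", OF _ chi_deriv chi_deriv2])
    fix t assume "t \<in> {t1..}"
    then have "1 \<le> p * t\<^sup>2" using v by simp
    then have "0 \<le> (2 * (p * t\<^sup>2) - 1) * (c - 1 + p * t\<^sup>2) - 2 * (p * t\<^sup>2)" using chi_bracket[OF _ c] c by fastforce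
    then show "0 \<le> 2 * p * exp (- (p * t\<^sup>2)) * ((2 * (p * t\<^sup>2) - 1) * (c - 1 + p * t\<^sup>2) - 2 * (p * t\<^sup>2))"
      using p by (intro mult_nonneg_nonneg) auto
  qed (use u in auto)
  then show "chi c p w \<ge> chi c p u - 2 * p * u * (c - 1 + p * u\<^sup>2) * exp (- (p * u\<^sup>2)) * (w - u)" by simp
  define \<kappa> where "\<kappa> = p * exp (- (p * u\<^sup>2)) * (c - 2)"
  assume wu: "w \<le> u"
  let ?f' = "\<lambda>t. - (2 * p * t * (c - 1 + p * t\<^sup>2) * exp (- (p * t\<^sup>2))) - \<kappa> * (2 * (t - u))"
  have "?f' u * (w - u) \<le> (chi c p w - \<kappa> * (w - u)\<^sup>2) - (chi c p u - \<kappa> * (u - u)\<^sup>2)"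
  proof (rule f''_imp_f'[of "{t1..u}" "\<lambda>t. chi c p t - \<kappa> * (t - u)\<^sup>2" ?f' "\<lambda>t. 2 * p * exp (- (p * t\<^sup>2)) * ((2 * (p * t\<^sup>2) - 1) * (c - 1 + p * t\<^sup>2) - 2 * (p * t\<^sup>2)) - \<kappa> * 2"])
    fix t assume t: "t \<in> {t1..u}"
    show "((\<lambda>t. chi c p t - \<kappa> * (t - u)\<^sup>2) has_real_derivative ?f' t) (at t)"
      by (auto intro!: derivative_eq_intros chi_deriv)
    show "(?f' has_real_derivative 2 * p * exp (- (p * t\<^sup>2)) * ((2 * (p * t\<^sup>2) - 1) * (c - 1 + p * t\<^sup>2) - 2 * (p * t\<^sup>2)) - \<kappa> * 2) (at t)"
      by (intro DERIV_diff chi_deriv2) (auto intro!: derivative_eq_intros)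
    have "p * t\<^sup>2 \<le> p * u\<^sup>2" using t t1 p by (intro mult_left_mono power_mono) auto
    then have "(2 * p * exp (- (p * u\<^sup>2))) * (c - 2) \<le> (2 * p * exp (- (p * t\<^sup>2))) * ((2 * (p * t\<^sup>2) - 1) * (c - 1 + p * t\<^sup>2) - 2 * (p * t\<^sup>2))"
      using p c chi_bracket[OF v c, of t] t by (intro mult_mono) auto
    then show "0 \<le> 2 * p * exp (- (p * t\<^sup>2)) * ((2 * (p * t\<^sup>2) - 1) * (c - 1 + p * t\<^sup>2) - 2 * (p * t\<^sup>2)) - \<kappa> * 2"
      by (simp add: \<kappa>_def mult_ac)
  qed (use u wu in auto)
  then show "chi c p w \<ge> chi c p u - 2 * p * u * (c - 1 + p * u\<^sup>2) * exp (- (p * u\<^sup>2)) * (w - u)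
            + p * exp (- (p * u\<^sup>2)) * (c - 2) * (w - u)\<^sup>2" by (simp add: \<kappa>_def)
qed

lemma chi_second_difference_nonneg:
  assumes p: "p \<ge> 1" and c: "c \<ge> 2" and "\<delta> \<ge> 0" "t - \<delta> \<ge> 1"
  shows "chi c p (t - \<delta>) + chi c p (t + \<delta>) - 2 * chi c p t \<ge> 0"
  using chi_tangent(1)[of p c 1 t "t - \<delta>"] chi_tangent(1)[of p c 1 t "t + \<delta>"] assms by (simp add: algebra_simps)

text \<open>If \<open>1/2 - \<delta>\<close> stays in the convex range, the quadratic tangent bound
  applies. Otherwise it lies left of \<open>1 / sqrt p\<close>; as \<open>chi\<close> decreases for
  nonnegative arguments, this one value is at least \<open>(c + 1) / e\<close> and outweighs the
  rest. The bound \<open>224/25\<close> is below \<open>3.14 * 20/7\<close>, which corresponds to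
  \<open>y / s \<le> 35/100\<close>.\<close>

lemma chi_second_difference_half:
  assumes p: "p \<ge> 224/25" and c: "c \<ge> 3" and \<delta>: "0 \<le> \<delta>" "\<delta> \<le> 1/2"
  shows "chi c p (1/2 - \<delta>) + chi c p (1/2 + \<delta>) - 2 * chi c p (1/2) \<ge> 4 * (c - 2) * exp (- (p / 4)) * \<delta>\<^sup>2"
proof -
  define t1 where "t1 = 1 / sqrt p"
  have t1: "p * t1\<^sup>2 = 1" "t1 > 0" using p by (auto simp: t1_def power_divide)
  have sp: "2 \<le> sqrt p" using p real_le_rsqrt[of 2 p] by simp
  then have t1h: "t1 \<le> 1/2" using frac_le[of 1 1 2 "sqrt p"] by (simp add: t1_def)
  show ?thesis
  proof (cases "t1 \<le> 1/2 - \<delta>")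
    case True
    have "chi c p (1/2 - \<delta>) + chi c p (1/2 + \<delta>) - 2 * chi c p (1/2) \<ge> p * exp (- (p * (1/2)\<^sup>2)) * (c - 2) * \<delta>\<^sup>2"
      using chi_tangent(2)[of p c t1 "1/2" "1/2 - \<delta>"] chi_tangent(1)[of p c t1 "1/2" "1/2 + \<delta>"] p c \<delta> t1 t1h True
      by simp
    moreover have "4 * (exp (- (p / 4)) * (c - 2) * \<delta>\<^sup>2) \<le> p * (exp (- (p / 4)) * (c - 2) * \<delta>\<^sup>2)"
      using p c by (intro mult_right_mono) auto
    moreover have "p * (1/2)\<^sup>2 = p / 4" by (simp add: power2_eq_square)
    ultimately show ?thesis by (simp only: mult_ac)
  next
    case False
    have "chi c p t1 \<le> chi c p (1/2 - \<delta>)"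
    proof (rule DERIV_nonpos_imp_nonincreasing[of "1/2 - \<delta>" t1 "chi c p"])
      fix t assume "1/2 - \<delta> \<le> t" "t \<le> t1"
      then have "0 \<le> 2 * p * t * (c - 1 + p * t\<^sup>2) * exp (- (p * t\<^sup>2))"
        using \<delta> p c by (intro mult_nonneg_nonneg add_nonneg_nonneg) auto
      then show "\<exists>y. (chi c p has_real_derivative y) (at t) \<and> y \<le> 0" using chi_deriv by fastforce
    qed (use False in auto)
    moreover have "(c + 1) * (100/272) \<le> chi c p t1"
    proof -
      have "(c + 1) * (100/272) \<le> (c + 1) * exp (- 1)"
      proof (intro mult_left_mono)
        have "inverse (272/100) \<le> inverse (exp 1 :: real)" using e_less_272 by (intro le_imp_inverse_le) auto
        then show "100/272 \<le> exp (- 1 :: real)" by (simp add: exp_minus)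
      qed (use c in auto)
      then show ?thesis by (simp add: chi_def t1)
    qed
    moreover have "0 \<le> chi c p (1/2 + \<delta>)" using p c by (auto simp: chi_def intro!: mult_nonneg_nonneg add_nonneg_nonneg)
    moreover have "chi c p (1/2) = c * exp (- (p / 4)) + p * exp (- (p / 4)) / 4"
      by (simp add: chi_def power2_eq_square distrib_right)
    moreover have "4 * (c - 2) * exp (- (p / 4)) * \<delta>\<^sup>2 \<le> c * exp (- (p / 4)) - 2 * exp (- (p / 4))"
    proof -
      have "4 * (c - 2) * exp (- (p / 4)) * \<delta>\<^sup>2 \<le> 4 * (c - 2) * exp (- (p / 4)) * (1/2)\<^sup>2"
        using c \<delta> by (intro mult_left_mono power_mono) auto
      also have "\<dots> = c * exp (- (p / 4)) - 2 * exp (- (p / 4))" by (simp add: power2_eq_square algebra_simps)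
      finally show ?thesis .
    qed
    moreover have e: "exp (- (56/25)) \<le> (1067/10000 :: real)"
      by (rule exp_minus_le[of "6/25" _ 2]) (simp_all add: power2_eq_square)
    moreover have "p * exp (- (p / 4)) \<le> 224/25 * exp (- (56/25))"
      using linear_exp_antimono[of "224/25" p "1/4"] p by simp
    moreover have "c * exp (- (p / 4)) \<le> c * (1067/10000)"
    proof (intro mult_left_mono)
      have "exp (- (p / 4)) \<le> exp (- (56/25))" using p by simp
      then show "exp (- (p / 4)) \<le> 1067/10000" using e by linarith
    qed (use c in auto)
    moreover have "0 \<le> exp (- (p / 4))" by simp
    moreover define e Z where "e = exp (- (p / 4))" and "Z = 4 * (c - 2) * exp (- (p / 4)) * \<delta>\<^sup>2"
    moreover define ce pe where "ce = c * e" and "pe = p * e"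
    ultimately have "(c + 1) * (100/272) \<le> chi c p (1/2 - \<delta>)" "0 \<le> chi c p (1/2 + \<delta>)" "chi c p (1/2) = ce + pe / 4"
      "Z \<le> ce - 2 * e" "pe \<le> 224/25 * (1067/10000)" "ce \<le> c * (1067/10000)" "0 \<le> e"
      by simp_all
    then have "Z \<le> chi c p (1/2 - \<delta>) + chi c p (1/2 + \<delta>) - 2 * chi c p (1/2)" using c by (simp add: field_simps)
    then show ?thesis by (simp add: Z_def)
  qed
qed

lemma chi_sum:
  assumes T: "T > 0"
  shows "((\<lambda>n::int. chi (a - 1/2) (pi * T) (of_int n + x)) has_sum (- ((th' T x - a * th T x) / sqrt T))) UNIV"
proof -
  have "((\<lambda>n::int. - ((1/2 - pi * T * (of_int n + x)\<^sup>2) * exp (- pi * T * (of_int n + x)\<^sup>2)) + a * exp (- pi * T * (of_int n + x)\<^sup>2))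
    has_sum (- (th' T x / sqrt T) + a * (th T x / sqrt T))) UNIV"
    by (intro has_sum_add has_sum_uminusI has_sum_cmult_right th'_gauss_has_sum th_gauss_has_sum T)
  moreover have "- ((1/2 - pi * T * (of_int n + x)\<^sup>2) * exp (- pi * T * (of_int n + x)\<^sup>2)) + a * exp (- pi * T * (of_int n + x)\<^sup>2)
     = chi (a - 1/2) (pi * T) (of_int n + x)" for n :: int
    by (simp add: chi_def algebra_simps)
  ultimately show ?thesis by (simp add: diff_divide_distrib)
qed

text \<open>Pairing \<open>n\<close> with \<open>-1 - n\<close> and using that \<open>chi\<close> is
  even turns the difference of the sums into second differences centred at \<open>n + 1/2\<close>
  with step \<open>1/2 - x\<close>. All are nonnegative by convexity, and only the central ones are
  counted.\<close>

lemma chi_sum_diff_lower: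
  assumes T: "pi * T \<ge> 224/25" and a: "a \<ge> 7/2" and x: "0 \<le> x" "x \<le> 1/2"
  shows "(th' T (1/2) - a * th T (1/2)) / sqrt T - (th' T x - a * th T x) / sqrt T
       \<ge> (a - 5/2) * exp (- (pi * T / 4)) * (dcos x 1 / 5)"
proof -
  define p where "p = pi * T"
  define c where "c = a - 1/2"
  define \<delta> where "\<delta> = 1/2 - x"
  have \<delta>: "0 \<le> \<delta>" "\<delta> \<le> 1/2" using x by (auto simp: \<delta>_def)
  have T0: "T > 0" using T by (smt (verit) divide_pos_pos mult_nonneg_nonpos pi_gt_zero)
  define J where "J = (th' T (1/2) - a * th T (1/2)) / sqrt T - (th' T x - a * th T x) / sqrt T"
  define f where "f n = chi c p (of_int n + x) - chi c p (of_int n + 1/2)" for n :: int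
  have f: "(f has_sum J) UNIV"
    using has_sum_add[OF chi_sum[OF T0, of a x] has_sum_uminusI[OF chi_sum[OF T0, of a "1/2"]]]
    unfolding f_def[abs_def] J_def c_def p_def by simp
  have "((\<lambda>n. f (- 1 - n)) has_sum J) UNIV"
    using f by (subst has_sum_reindex_bij_witness[where i = "\<lambda>n. - 1 - n" and j = "\<lambda>n. - 1 - n" and T = UNIV and h = f]) auto
  from has_sum_add[OF f this] have g: "((\<lambda>n. f n + f (- 1 - n)) has_sum 2 * J) UNIV" by simp
  define h where "h n = chi c p (of_int n + 1/2 - \<delta>) + chi c p (of_int n + 1/2 + \<delta>) - 2 * chi c p (of_int n + 1/2)" for n :: int
  have fh: "f n + f (- 1 - n) = h n" for n
  proof -
    have "of_int (- 1 - n) + x = - (of_int n + 1/2 + \<delta>)" "of_int (- 1 - n) + 1/2 = - (of_int n + 1/2 :: real)"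
      "of_int n + x = of_int n + 1/2 - \<delta>" by (simp_all add: \<delta>_def)
    then show ?thesis unfolding f_def h_def by (simp only: chi_even)
  qed
  have hsym: "h (- 1 - n) = h n" for n using fh[of n] fh[of "- 1 - n"] by simp
  define g0 where "g0 = 4 * (c - 2) * exp (- (p / 4)) * \<delta>\<^sup>2"
  have h0: "h 0 \<ge> g0" unfolding h_def g0_def
    using chi_second_difference_half[of p c \<delta>] T a \<delta> by (simp add: p_def c_def)
  have hn: "h n \<ge> 0" if "n \<ge> 1" for n
  proof -
    have "real_of_int n \<ge> 1" using that by simp
    then show ?thesis unfolding h_def using T a \<delta>
      by (intro chi_second_difference_nonneg) (auto simp: p_def c_def)
  qed
  have "((\<lambda>n::int. g0 * of_bool (n \<in> {0, -1})) has_sum (2 * g0)) UNIV"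
    by (rule has_sum_finite_neutralI[of "{0, -1}"]) auto
  then have "2 * g0 \<le> 2 * J"
  proof (rule has_sum_mono[OF _ g])
    fix n :: int
    consider "n = 0" | "n = -1" | "n \<ge> 1" | "- 1 - n \<ge> 1" by linarith
    then show "g0 * of_bool (n \<in> {0, -1}) \<le> f n + f (- 1 - n)"
      unfolding fh using h0 hn[of n] hn[of "- 1 - n"] hsym[of n] hsym[of 0] by cases auto
  qed
  moreover have "(a - 5/2) * exp (- (p / 4)) * (dcos x 1 / 5) \<le> g0"
  proof -
    \<comment> \<open>The factor \<open>1/5\<close> arises from \<open>2 * (sin (pi *
      \<delta>))\<^sup>2 \<le> 20 * \<delta>\<^sup>2\<close>, set against the
      \<open>4 * \<delta>\<^sup>2\<close> in \<open>g0\<close>.\<close>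
    have "dcos x 1 = 2 * (sin (pi * \<delta>))\<^sup>2"
      using cos_double_sin[of "pi * \<delta>"] by (simp add: dcos_bounds \<delta>_def algebra_simps)
    also have "\<dots> \<le> 2 * (pi * \<delta>)\<^sup>2"
      using abs_sin_x_le_abs_x[of "pi * \<delta>"] by (simp add: abs_le_square_iff)
    also have "\<dots> = 2 * (pi\<^sup>2 * \<delta>\<^sup>2)" by (simp add: power_mult_distrib)
    also have "\<dots> \<le> 2 * (10 * \<delta>\<^sup>2)"
    proof (intro mult_left_mono mult_right_mono)
      have "pi\<^sup>2 \<le> (3.15)\<^sup>2" using pi_approx by (intro power_mono) auto
      then show "pi\<^sup>2 \<le> 10" by (simp add: power2_eq_square)
    qed auto
    finally have "dcos x 1 / 5 \<le> 4 * \<delta>\<^sup>2" by simp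
    then have "(a - 5/2) * exp (- (p / 4)) * (dcos x 1 / 5) \<le> (a - 5/2) * exp (- (p / 4)) * (4 * \<delta>\<^sup>2)"
      using a by (intro mult_left_mono) auto
    moreover have "(a - 5/2) * exp (- (p / 4)) * (4 * \<delta>\<^sup>2) = g0" by (simp add: g0_def c_def algebra_simps)
    ultimately show ?thesis by simp
  qed
  ultimately have "(a - 5/2) * exp (- (p / 4)) * (dcos x 1 / 5) \<le> J" by linarith
  then show ?thesis by (simp only: J_def p_def)
qed

section \<open>Horizontal comparison in the Gaussian regime: the outer slices\<close>

lemma has_sum_int_even:
  fixes f :: "int \<Rightarrow> real"
  assumes S: "((\<lambda>n::nat. f (int n + 1)) has_sum S) UNIV" and even: "\<And>n. f (- n) = f n" and f0: "f 0 = 0"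
  shows "(f has_sum (2 * S)) UNIV"
proof -
  have 1: "(f has_sum S) (range (\<lambda>n. int n + 1))"
    by (subst has_sum_reindex) (use S in \<open>auto simp: o_def inj_on_def\<close>)
  have "f (- int n - 1) = f (int n + 1)" for n using even[of "int n + 1"] by simp
  then have 2: "(f has_sum S) (range (\<lambda>n. - int n - 1))"
    by (subst has_sum_reindex) (use S in \<open>auto simp: o_def inj_on_def\<close>)
  have 3: "(f has_sum 0) {0}" using f0 has_sum_finite[of "{0::int}" f] by simp
  have U: "range (\<lambda>n. int n + 1) \<union> range (\<lambda>n. - int n - 1) \<union> {0} = UNIV"
  proof -
    have "x \<in> range (\<lambda>n. int n + 1) \<union> range (\<lambda>n. - int n - 1) \<union> {0}" for x :: int
      by (cases x rule: int_cases3)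
         (auto simp: image_iff intro: exI[of _ "nat (\<bar>x\<bar> - 1)"])
    then show ?thesis by blast
  qed
  have "range (\<lambda>n. int n + 1) \<inter> range (\<lambda>n. - int n - 1) = {}" by auto
  from has_sum_Un_disjoint[OF 1 2 this] have "(f has_sum (S + S)) (range (\<lambda>n. int n + 1) \<union> range (\<lambda>n. - int n - 1))" .
  then have "(f has_sum (S + S + 0)) (range (\<lambda>n. int n + 1) \<union> range (\<lambda>n. - int n - 1) \<union> {0})"
    by (rule has_sum_Un_disjoint[OF _ 3]) auto
  then show ?thesis unfolding U by simp
qed

text \<open>The index 0 contributes nothing since \<open>1 / 0 = 0\<close>; the rest is twice the
  Basel series.\<close>

lemma has_sum_inverse_square_int: "((\<lambda>k::int. 1 / (of_int k)\<^sup>2) has_sum (pi\<^sup>2 / 3)) UNIV"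
proof -
  have "((\<lambda>n::nat. 1 / (of_int (int n + 1))\<^sup>2) has_sum (pi\<^sup>2 / 6)) UNIV"
    using inverse_squares_sums by (intro sums_nonneg_imp_has_sum) (auto simp: add.commute)
  from has_sum_int_even[OF this] show ?thesis by simp
qed

lemma power_exp_le_fact:
  fixes v :: real assumes "v \<ge> 0" shows "v ^ n * exp (- v) \<le> fact n"
proof -
  have "v ^ n / fact n = (\<Sum>k\<in>{n}. v ^ k / fact k)" by simp
  also have "\<dots> \<le> (\<Sum>k<Suc n. v ^ k / fact k)" using assms by (intro sum_mono2) auto
  also have "\<dots> \<le> exp v" by (rule exp_ge_Taylor[OF assms])
  finally show ?thesis by (simp add: exp_minus field_simps)
qed

text \<open>A crude bound suffices because slice \<open>m\<close> carries the further factor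
  \<open>exp (- (pi * s * y * m\<^sup>2))\<close>. The bounds
  \<open>w ^ n * exp (- w) \<le> fact n\<close> for \<open>n = 2, 3\<close> trade the Gaussian for
  \<open>1 / k\<^sup>2\<close>, while the factor \<open>dcos x 1\<close> shared with the first slice
  is kept.\<close>

lemma theta_slice_diff_lower:
  assumes T: "T > 0" and a: "a \<ge> 0"
  shows "(th' T (of_int m * (1/2)) - a * th T (of_int m * (1/2))) - (th' T (of_int m * x) - a * th T (of_int m * x))
    \<ge> - ((of_int m)\<^sup>2 * dcos x 1 * (T\<^sup>2 / 3 * (6 + 2 * a)))"
proof -
  let ?e = "\<lambda>k::int. exp (- pi * (of_int k)\<^sup>2 / T)"
  let ?w = "\<lambda>k::int. pi * (of_int k)\<^sup>2 / T"
  define C where "C = (of_int m)\<^sup>2 * dcos x 1 * (6 + 2 * a) * (T / pi)\<^sup>2"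
  have d1: "0 \<le> dcos x 1" using cos_ge_minus_one[of "2 * pi * x"] unfolding dcos_bounds by linarith
  let ?D = "\<lambda>k::int. (?w k * ?e k * cos (2 * pi * of_int k * (of_int m * x)) + - (a * (?e k * cos (2 * pi * of_int k * (of_int m * x)))))
        + - (?w k * ?e k * cos (2 * pi * of_int k * (of_int m * (1/2))) + - (a * (?e k * cos (2 * pi * of_int k * (of_int m * (1/2))))))"
  have "(?D has_sum ((th' T (of_int m * x) + - (a * th T (of_int m * x))) + - (th' T (of_int m * (1/2)) + - (a * th T (of_int m * (1/2)))))) UNIV"
    by (intro has_sum_add has_sum_uminusI has_sum_cmult_right th_has_sum th'_has_sum T)
  moreover have "((\<lambda>k::int. C * (1 / (of_int k)\<^sup>2)) has_sum C * (pi\<^sup>2 / 3)) UNIV"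
    by (intro has_sum_cmult_right has_sum_inverse_square_int)
  ultimately have "(th' T (of_int m * x) + - (a * th T (of_int m * x))) + - (th' T (of_int m * (1/2)) + - (a * th T (of_int m * (1/2)))) \<le> C * (pi\<^sup>2 / 3)"
  proof (rule has_sum_mono)
    fix k :: int
    have alg: "(w * e * c1 + - (a * (e * c1))) + - (w * e * c2 + - (a * (e * c2))) = (w - a) * e * (c1 - c2)" for w e c1 c2 :: real
      by (simp add: algebra_simps)
    have dc: "dcos x (k * m) = cos (2 * pi * of_int k * (of_int m * x)) - cos (2 * pi * of_int k * (of_int m * (1/2)))"
      by (simp add: dcos_def mult_ac)
    have "?D k = (?w k - a) * ?e k * dcos x (k * m)"
      unfolding dc by (rule alg)
    also have "\<dots> \<le> \<bar>(?w k - a) * ?e k\<bar> * \<bar>dcos x (k * m)\<bar>" by (metis abs_ge_self abs_mult)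
    also have "\<dots> \<le> ((?w k + a) * ?e k) * ((of_int (k * m))\<^sup>2 * dcos x 1)"
      using T a by (intro mult_mono dcos_bounds) (auto simp: abs_mult abs_le_iff intro!: mult_right_mono add_nonneg_nonneg mult_nonneg_nonneg)
    also have "\<dots> \<le> C * (1 / (of_int k)\<^sup>2)"
    proof (cases "k = 0")
      case False
      have "(?w k) ^ 3 * exp (- ?w k) \<le> 6" "(?w k) ^ 2 * exp (- ?w k) \<le> 2"
        using power_exp_le_fact[of "?w k" 3] power_exp_le_fact[of "?w k" 2] T by (simp_all add: fact_numeral)
      then have "(?w k) ^ 3 * ?e k + a * ((?w k) ^ 2 * ?e k) \<le> 6 + a * 2" using a by (intro add_mono mult_left_mono) auto
      then have "((of_int m)\<^sup>2 * dcos x 1 * (T / pi)\<^sup>2 / (of_int k)\<^sup>2) * ((?w k) ^ 3 * ?e k + a * ((?w k) ^ 2 * ?e k))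
          \<le> ((of_int m)\<^sup>2 * dcos x 1 * (T / pi)\<^sup>2 / (of_int k)\<^sup>2) * (6 + a * 2)"
        using d1 by (intro mult_left_mono) auto
      moreover have "((of_int m)\<^sup>2 * dcos x 1 * (T / pi)\<^sup>2 / (of_int k)\<^sup>2) * ((?w k) ^ 3 * ?e k + a * ((?w k) ^ 2 * ?e k))
         = ((?w k + a) * ?e k) * ((of_int (k * m))\<^sup>2 * dcos x 1)"
      proof -
        have X: "(T / pi)\<^sup>2 / (of_int k)\<^sup>2 * (?w k)\<^sup>2 = (of_int k)\<^sup>2"
          using False T by (simp add: power2_eq_square field_simps)
        have "(M * d * P / Kk) * (w ^ 3 * e + a * (w\<^sup>2 * e)) = ((w + a) * e) * ((P / Kk * w\<^sup>2) * M * d)" for M d P Kk w e :: real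
          by (simp add: power3_eq_cube power2_eq_square algebra_simps add_divide_distrib)
        then show ?thesis by (simp only: X of_int_mult power_mult_distrib)
      qed
      ultimately show ?thesis by (simp add: C_def mult_ac)
    qed simp
    finally show "?D k \<le> C * (1 / (of_int k)\<^sup>2)" .
  qed
  also have "C * (pi\<^sup>2 / 3) = (of_int m)\<^sup>2 * dcos x 1 * (T\<^sup>2 / 3 * (6 + 2 * a))"
    by (simp add: C_def power_divide)
  finally show ?thesis by simp
qed

lemma th_even: "th T (- x) = th T x" "th' T (- x) = th' T x" by (simp_all add: th_def th'_def)

text \<open>Measures slice \<open>m\<close> against the lower bound for the first slice: the surplus
  exponent \<open>a * (m\<^sup>2 - 1)\<close> has to pay for a cubic in \<open>a\<close>, for
  \<open>exp (- (pi * T / 4))\<close> and for the decay in \<open>m\<close>. Since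
  \<open>pi * T = a / y\<^sup>2\<close>, the constants \<open>9/4\<close> and \<open>18/25\<close>
  reflect \<open>y \<ge> 2/3\<close>, and \<open>398/100\<close> then follows from
  \<open>pi * T \<ge> 224/25\<close>.\<close>

lemma outer_slice_bound:
  fixes a T :: real and m :: nat
  assumes m: "2 \<le> m" and T: "1 \<le> T" "T \<le> 18/25 * a" and p: "pi * T \<le> 9/4 * a" and a: "398/100 \<le> a"
  shows "exp (- (a * (real m)\<^sup>2)) * ((real m)\<^sup>2 * (T\<^sup>2 / 3 * (6 + 2 * (a * (real m)\<^sup>2))))
    \<le> 2 * uwt m * (exp (- a) * sqrt T * ((a - 5/2) * exp (- (pi * T / 4)) / 5))"
proof -
  define M where "M = (real m)\<^sup>2"
  define n where "n = M - 1"
  have M4: "4 \<le> M" using power_mono[of 2 "real m" 2] m by (simp add: M_def)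
  have n3: "3 \<le> n" using M4 by (simp add: n_def)
  have aM: "398/100 * 4 \<le> a * M" using a M4 by (intro mult_mono) auto
  have "T\<^sup>2 \<le> (18/25 * a)\<^sup>2" using T by (intro power_mono) auto
  moreover have "6 + 2 * (a * M) \<le> 24/10 * (a * M)" using aM by linarith
  ultimately have "T\<^sup>2 / 3 * (6 + 2 * (a * M)) \<le> (18/25 * a)\<^sup>2 / 3 * (24/10 * (a * M))"
    using aM by (intro mult_mono divide_right_mono) auto
  also have "\<dots> \<le> 415/1000 * a ^ 3 * M"
    using a M4 by (simp add: power2_eq_square power3_eq_cube)
  finally have 1: "T\<^sup>2 / 3 * (6 + 2 * (a * M)) \<le> 415/1000 * a ^ 3 * M" .
  \<comment> \<open>The tangent bound \<open>u \<le> exp (u - 1)\<close> at \<open>u = a / 4\<close>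
    is sharp at \<open>a = 4\<close>, close to the least admissible \<open>a\<close>.\<close>
  have 2: "a\<^sup>2 \<le> 217/100 * exp (a / 2)"
  proof -
    have "a / 4 \<le> exp (a / 4 - 1)" using exp_ge_add_one_self[of "a / 4 - 1"] by simp
    then have "(a / 4)\<^sup>2 \<le> (exp (a / 4 - 1))\<^sup>2" using a by (intro power_mono) auto
    also have "\<dots> = exp (a / 2) * exp (- 2)" by (simp add: power2_eq_square exp_add[symmetric])
    also have "\<dots> \<le> exp (a / 2) * (1354/10000)"
      by (intro mult_left_mono exp_minus_le[of 0 _ 2]) (auto simp: power2_eq_square)
    finally have "a\<^sup>2 / 16 \<le> exp (a / 2) * (1354/10000)" by (simp add: power_divide)
    moreover have "0 \<le> exp (a / 2)" by simp
    ultimately show ?thesis by linarith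
  qed
  have "exp (- (a * M)) * (M * (T\<^sup>2 / 3 * (6 + 2 * (a * M)))) \<le> exp (- (a * M)) * (M * (415/1000 * a ^ 3 * M))"
    using M4 1 by (intro mult_left_mono) auto
  also have "\<dots> = 415/1000 * a * M\<^sup>2 * exp (- (a * M)) * a\<^sup>2" by (simp add: power2_eq_square power3_eq_cube)
  also have "\<dots> \<le> 415/1000 * a * M\<^sup>2 * exp (- (a * M)) * (217/100 * exp (a / 2))"
    using a M4 by (intro mult_left_mono 2) auto
  also have "\<dots> = (415/1000 * (217/100) * a) * (M\<^sup>2 * exp (a / 2 - a * n)) * exp (- a)"
    by (simp add: n_def exp_add[symmetric] exp_diff algebra_simps exp_minus field_simps)
  also have "\<dots> \<le> (415/1000 * (217/100) * a) * (M\<^sup>2 * (exp (- (pi * T / 4)) * exp (- (5/2 * n)))) * exp (- a)"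
  proof (intro mult_right_mono mult_left_mono)
    have "a * 3 \<le> a * n" using n3 a by (intro mult_left_mono) auto
    moreover have "398/100 * n \<le> a * n" using n3 a by (intro mult_right_mono) auto
    ultimately have "a / 2 - a * n \<le> - (pi * T / 4) - 5/2 * n" using p n3 by linarith
    then show "exp (a / 2 - a * n) \<le> exp (- (pi * T / 4)) * exp (- (5/2 * n))"
      by (simp add: exp_add[symmetric])
  qed (use a in auto)
  also have "\<dots> = (415/1000 * (217/100) * a) * exp (- (pi * T / 4)) * exp (- a) * ((real m) ^ 4 * exp (- (5/2 * ((real m)\<^sup>2 - 1))))"
    by (simp add: n_def M_def flip: power_mult)
  also have "\<dots> \<le> (415/1000 * (217/100) * a) * exp (- (pi * T / 4)) * exp (- a) * (64/1000 * (1/2) ^ m)"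
  proof (intro mult_left_mono gauss_power_decay[OF _ _ _ _ m])
    have "exp (- (25/2)) \<le> exp (- 10 :: real)" by simp
    then have "exp (- (25/2)) \<le> (1/20000 :: real)" using exp_num(5) by linarith
    then show "(3/2) ^ 4 * exp (- (5 * (5/2))) \<le> (1/2 :: real)" by (simp add: power_divide)
  qed (use a exp_num(7) in \<open>simp_all add: power2_eq_square power_divide\<close>)
  also have "\<dots> = (exp (- (pi * T / 4)) * exp (- a)) * (415/1000 * (217/100) * a * (64/1000) * (1/2) ^ m)"
    by (simp add: mult_ac)
  also have "\<dots> \<le> (exp (- (pi * T / 4)) * exp (- a)) * (2 * uwt m * (a - 5/2) / 5)"
    using a m by (intro mult_left_mono) (auto simp: uwt_ge2)
  also have "\<dots> = (2 * uwt m * (a - 5/2) / 5 * (exp (- (pi * T / 4)) * exp (- a))) * 1" by simp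
  also have "\<dots> \<le> (2 * uwt m * (a - 5/2) / 5 * (exp (- (pi * T / 4)) * exp (- a))) * sqrt T"
    using a T uwt_nonneg[of m] by (intro mult_left_mono) auto
  also have "\<dots> = 2 * uwt m * (exp (- a) * sqrt T * ((a - 5/2) * exp (- (pi * T / 4)) / 5))"
    by (simp only: mult_ac times_divide_eq_right times_divide_eq_left)
  finally show ?thesis unfolding M_def .
qed

text \<open>The slice \<open>m = 0\<close> does not depend on \<open>x\<close>, so the slices
  \<open>1\<close> and \<open>-1\<close> are the leading ones: they gain by convexity, and the outer
  slices are charged to that gain.\<close>

theorem ntheta'_less_half_gauss:
  assumes s: "s > 0" and y: "y \<ge> 2/3" and b: "y / s \<le> 35/100" and x: "0 \<le> x" "x < 1/2"
  shows "ntheta' s x y < ntheta' s (1/2) y"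
proof -
  define T where "T = s / y"
  define a where "a = pi * s * y"
  have y0: "y > 0" using y by simp
  have T1: "20/7 \<le> T" using b s y0 by (simp add: T_def field_simps)
  have pT: "224/25 \<le> pi * T" using mult_mono[of "3.14" pi "20/7" T] pi_gt_314 T1 by simp
  have ap: "a = pi * T * y\<^sup>2" using y0 by (simp add: a_def T_def power2_eq_square)
  have "(2/3)\<^sup>2 \<le> y\<^sup>2" using y by (intro power_mono) auto
  then have y2: "4/9 \<le> y\<^sup>2" by (simp add: power2_eq_square)
  have "pi * T * (4/9) \<le> a" unfolding ap using T1 y2 by (intro mult_left_mono) auto
  then have pa: "pi * T \<le> 9/4 * a" and a: "398/100 \<le> a" using pT by auto
  have Ta: "T \<le> 18/25 * a"
  proof -
    have "3.14 * T \<le> pi * T" using pi_gt_314 T1 by (intro mult_right_mono) auto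
    then show ?thesis using pa a by simp
  qed
  define d1 where "d1 = dcos x 1"
  have d1: "d1 > 0"
  proof -
    have "\<bar>2 * pi * x\<bar> \<le> pi" using x by simp
    moreover have "2 * pi * x < pi" using x by simp
    ultimately have "cos (2 * pi * x) > cos pi" using x by (intro cos_monotone_0_pi) auto
    then show ?thesis by (simp add: d1_def dcos_bounds)
  qed
  define G where "G = (\<lambda>m::int. \<lambda>x. exp (- (a * (of_int m)\<^sup>2)) * (th' T (of_int m * x) - a * (of_int m)\<^sup>2 * th T (of_int m * x)))"
  have G: "((\<lambda>m. G m x) has_sum ntheta' s x y / sqrt y) UNIV" for x
    using ntheta_slices(2)[OF s y0, of x] by (simp add: G_def a_def T_def)
  define c where "c = exp (- a) * sqrt T * ((a - 5/2) * exp (- (pi * T / 4)) / 5) * d1"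
  have c: "c > 0" using a T1 d1 by (auto simp: c_def)
  \<comment> \<open>This equals 1 on the slices \<open>1\<close> and \<open>-1\<close>, and its sum
    \<open>6 - 2 * 14/5 = 2/5\<close> is what remains after all losses.\<close>
  define L where "L = (\<lambda>m::int. 3 * of_bool (m \<in> {1,-1}) - 2 * uwt (nat \<bar>m\<bar>))"
  have "((\<lambda>m::int. 3 * of_bool (m \<in> {1,-1})) has_sum (6::real)) UNIV"
    by (rule has_sum_finite_neutralI[of "{1,-1}"]) auto
  from has_sum_cmult_right[OF has_sum_add[OF this has_sum_uminusI[OF has_sum_cmult_right[OF has_sum_uwt, of 2]]], of c]
  have Ls: "((\<lambda>m. c * L m) has_sum (c * (2/5))) UNIV" by (simp add: L_def)
  have one: "G 1 (1/2) - G 1 x \<ge> c"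
  proof -
    have "(a - 5/2) * exp (- (pi * T / 4)) * (d1 / 5) \<le> (th' T (1/2) - a * th T (1/2)) / sqrt T - (th' T x - a * th T x) / sqrt T"
      unfolding d1_def using chi_sum_diff_lower[OF pT _ x(1)] a x by simp
    then have "exp (- a) * (sqrt T * ((a - 5/2) * exp (- (pi * T / 4)) * (d1 / 5)))
       \<le> exp (- a) * (sqrt T * ((th' T (1/2) - a * th T (1/2)) / sqrt T - (th' T x - a * th T x) / sqrt T))"
      using T1 by (intro mult_left_mono) auto
    also have "sqrt T * ((th' T (1/2) - a * th T (1/2)) / sqrt T - (th' T x - a * th T x) / sqrt T)
       = (th' T (1/2) - a * th T (1/2)) - (th' T x - a * th T x)"
      unfolding diff_divide_distrib[symmetric] using T1 by simp
    also have "exp (- a) * \<dots> = G 1 (1/2) - G 1 x" by (simp add: G_def right_diff_distrib)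
    also have "exp (- a) * (sqrt T * ((a - 5/2) * exp (- (pi * T / 4)) * (d1 / 5))) = c" by (simp add: c_def)
    finally show ?thesis .
  qed
  have "c * (2/5) \<le> ntheta' s (1/2) y / sqrt y + - (ntheta' s x y / sqrt y)"
  proof (rule has_sum_mono[OF Ls has_sum_add[OF G[of "1/2"] has_sum_uminusI[OF G[of x]]]])
    fix m :: int
    define k where "k = nat \<bar>m\<bar>"
    have mk: "(of_int m)\<^sup>2 = (real k)\<^sup>2" by (simp add: k_def)
    consider "m = 0" | "m = 1" | "m = -1" | "2 \<le> k" unfolding k_def by linarith
    then show "c * L m \<le> G m (1/2) + - G m x"
    proof cases
      case 1 then show ?thesis by (simp add: L_def G_def uwt_def)
    next
      case 2 then show ?thesis using one by (simp add: L_def uwt_def)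
    next
      case 3
      have "G (-1) x = G 1 x" for x by (simp add: G_def th_even)
      then show ?thesis using one 3 by (simp add: L_def uwt_def)
    next
      case 4
      have "- ((of_int m)\<^sup>2 * dcos x 1 * (T\<^sup>2 / 3 * (6 + 2 * (a * (of_int m)\<^sup>2)))) \<le>
         (th' T (of_int m * (1/2)) - a * (of_int m)\<^sup>2 * th T (of_int m * (1/2))) - (th' T (of_int m * x) - a * (of_int m)\<^sup>2 * th T (of_int m * x))"
        by (rule theta_slice_diff_lower) (use T1 a in auto)
      then have "exp (- (a * (of_int m)\<^sup>2)) * - ((of_int m)\<^sup>2 * d1 * (T\<^sup>2 / 3 * (6 + 2 * (a * (of_int m)\<^sup>2)))) \<le>
         exp (- (a * (of_int m)\<^sup>2)) * ((th' T (of_int m * (1/2)) - a * (of_int m)\<^sup>2 * th T (of_int m * (1/2))) - (th' T (of_int m * x) - a * (of_int m)\<^sup>2 * th T (of_int m * x)))"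
        unfolding d1_def by (intro mult_left_mono) auto
      also have "\<dots> = G m (1/2) + - G m x" by (simp add: G_def right_diff_distrib)
      finally have g: "- (d1 * (exp (- (a * (real k)\<^sup>2)) * ((real k)\<^sup>2 * (T\<^sup>2 / 3 * (6 + 2 * (a * (real k)\<^sup>2)))))) \<le> G m (1/2) + - G m x"
        unfolding mk by (simp add: mult_ac)
      have "d1 * (exp (- (a * (real k)\<^sup>2)) * ((real k)\<^sup>2 * (T\<^sup>2 / 3 * (6 + 2 * (a * (real k)\<^sup>2)))))
         \<le> d1 * (2 * uwt k * (exp (- a) * sqrt T * ((a - 5/2) * exp (- (pi * T / 4)) / 5)))"
        using d1 outer_slice_bound[OF 4 _ Ta pa a] T1 by (intro mult_left_mono) auto
      also have "\<dots> = c * (2 * uwt k)" by (simp add: c_def)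
      finally have "- (c * (2 * uwt k)) \<le> G m (1/2) + - G m x" using g by linarith
      moreover have "L m = - (2 * uwt k)" using 4 by (auto simp: L_def k_def)
      ultimately show ?thesis by simp
    qed
  qed
  then have "ntheta' s x y / sqrt y < ntheta' s (1/2) y / sqrt y" using c by linarith
  then show ?thesis using y0 by (simp add: divide_less_cancel)
qed

corollary ntheta'_less_half:
  assumes "s > 1" "y \<ge> 2/3" "0 \<le> x" "x < 1/2"
  shows "ntheta' s x y < ntheta' s (1/2) y"
proof (cases "y / s \<le> 35/100")
  case True then show ?thesis using ntheta'_less_half_gauss assms by auto
next
  case False
  have "cos (2 * pi * x) > cos pi" using assms by (intro cos_monotone_0_pi) auto
  then show ?thesis using ntheta'_less_half_fourier[of s y x] assms False by simp
qed

section \<open>Positivity of the derivative\<close>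

text \<open>The inversion formula at \<open>x = 0\<close> and its derivative. For
  \<open>\<rho> T = th' T 0 / th T 0\<close> they combine to the reflection
  \<open>\<rho> (1 / T) = 1/2 - \<rho> T\<close>.\<close>

lemma th0_inverse:
  assumes "T > 0"
  shows "th (1 / T) 0 = th T 0 / sqrt T" "th (1 / T) 0 / 2 - th' (1 / T) 0 = th' T 0 / sqrt T"
proof -
  have g: "((\<lambda>n::int. exp (- pi * T * (of_int n)\<^sup>2)) has_sum th (1/T) 0) UNIV"
    using th_has_sum[of "1/T" 0] assms by (simp add: mult_ac)
  then show "th (1 / T) 0 = th T 0 / sqrt T"
    using th_gauss_has_sum[OF assms, of 0] has_sum_unique by fastforce
  have "((\<lambda>n::int. pi * T * (of_int n)\<^sup>2 * exp (- pi * T * (of_int n)\<^sup>2)) has_sum th' (1/T) 0) UNIV"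
    using th'_has_sum[of "1/T" 0] assms by (simp add: mult_ac)
  from has_sum_add[OF has_sum_cmult_right[OF g, of "1/2"] has_sum_uminusI[OF this]]
  have "((\<lambda>n::int. (1/2 - pi * T * (of_int n)\<^sup>2) * exp (- pi * T * (of_int n)\<^sup>2)) has_sum (th (1/T) 0 / 2 - th' (1/T) 0)) UNIV"
    by (simp add: left_diff_distrib)
  then show "th (1 / T) 0 / 2 - th' (1 / T) 0 = th' T 0 / sqrt T"
    using th'_gauss_has_sum[OF assms, of 0] has_sum_unique by fastforce
qed

lemma th0_pos: "T > 0 \<Longrightarrow> th T 0 \<ge> 1"
  using has_sum_mono[OF has_sum_finite_neutralI[of "{0::int}" UNIV "\<lambda>k. of_bool (k = 0) :: real" 1] th_has_sum[of T 0]] by simp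

lemma th'0_nonneg: "T > 0 \<Longrightarrow> th' T 0 \<ge> 0"
  unfolding th'_def by (intro infsum_nonneg) auto

lemma th'0_le: "T > 0 \<Longrightarrow> th' T 0 \<le> th T 0 / 2"
  using th0_inverse(2)[of "1/T"] divide_nonneg_nonneg[OF th'0_nonneg[of "1/T"], of "sqrt (1/T)"] by simp

lemma has_sum_less:
  fixes f g :: "'a \<Rightarrow> real"
  assumes "(f has_sum S) UNIV" "(g has_sum R) UNIV" "\<And>x. f x \<le> g x" "f i < g i"
  shows "S < R"
proof -
  have "((\<lambda>x. (g i - f i) * of_bool (x = i)) has_sum (g i - f i)) UNIV"
    by (rule has_sum_finite_neutralI[of "{i}"]) auto
  then have "g i - f i \<le> R + - S"
    by (rule has_sum_mono[OF _ has_sum_add[OF assms(2) has_sum_uminusI[OF assms(1)]]]) (use assms(3) in auto)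
  then show ?thesis using assms(4) by simp
qed

lemma linear_exp_decreasing:
  fixes u v :: real assumes "3/2 \<le> u" "u < v"
  shows "(v - 1/2) * exp (- v) < (u - 1/2) * exp (- u)"
proof -
  have uv: "1 * (v - u) \<le> (u - 1/2) * (v - u)" by (rule mult_right_mono) (use assms in auto)
  have "(v - 1/2) = (u - 1/2) + (v - u)" by simp
  also have "\<dots> \<le> (u - 1/2) + (u - 1/2) * (v - u)" using uv by (simp only: mult_1 add_le_cancel_left)
  also have "\<dots> = (u - 1/2) * (1 + (v - u))" by (simp only: distrib_left mult_1_right)
  also have "\<dots> < (u - 1/2) * exp (v - u)"
  proof (rule mult_strict_left_mono)
    have "0 < (v - u)\<^sup>2 / 2" using assms by simp
    then show "1 + (v - u) < exp (v - u)" using exp_lower_Taylor_quadratic[of "v - u"] assms by linarith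
  qed (use assms in auto)
  finally have "(v - 1/2) * exp (- v) < (u - 1/2) * exp (v - u) * exp (- v)" by (intro mult_strict_right_mono) auto
  then show ?thesis by (simp add: mult.assoc exp_add[symmetric])
qed

text \<open>In other words, \<open>th' / th\<close> at \<open>x = 0\<close> is strictly increasing.
  Up to \<open>t2 = 1\<close> every nonconstant term has argument
  \<open>pi * k\<^sup>2 / t > 3\<close>, where \<open>(u - 1/2) * exp (- u)\<close> decreases in
  \<open>u\<close>, so \<open>th' - th / 2\<close> increases term by term; with
  \<open>th' \<le> th / 2\<close> this is enough. The reflection of \<open>\<rho>\<close> carries
  the result to larger parameters.\<close>

lemma th0_cross:
  assumes "0 < t1" "t1 < t2"
  shows "th' t1 0 * th t2 0 < th' t2 0 * th t1 0"
proof -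
  have small: "th' t1 0 * th t2 0 < th' t2 0 * th t1 0" if t: "0 < t1" "t1 < t2" "t2 \<le> 1" for t1 t2
  proof -
    have w: "pi * (of_int k)\<^sup>2 / t2 < pi * (of_int k)\<^sup>2 / t1" "3/2 \<le> pi * (of_int k)\<^sup>2 / t2" if "k \<noteq> 0" for k :: int
    proof -
      have k1: "1 \<le> (of_int k :: real)\<^sup>2" using that by (metis of_int_1_le_iff of_int_power zero_less_power2 int_one_le_iff_zero_less)
      then show "pi * (of_int k)\<^sup>2 / t2 < pi * (of_int k)\<^sup>2 / t1"
        using t by (intro divide_strict_left_mono mult_pos_pos) auto
      have "3 * 1 \<le> pi * (of_int k)\<^sup>2" using pi_gt3 k1 by (intro mult_mono) auto
      also have "\<dots> \<le> pi * (of_int k)\<^sup>2 / t2" using t by (simp add: pos_le_divide_eq mult_left_le)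
      finally show "3/2 \<le> pi * (of_int k)\<^sup>2 / t2" by linarith
    qed
    have hs: "((\<lambda>k::int. (pi * (of_int k)\<^sup>2 / t - 1/2) * exp (- (pi * (of_int k)\<^sup>2 / t))) has_sum (th' t 0 - th t 0 / 2)) UNIV" if "t > 0" for t
      using has_sum_add[OF th'_has_sum[OF that, of 0] has_sum_uminusI[OF has_sum_cmult_right[OF th_has_sum[OF that, of 0], of "1/2"]]]
      by (simp add: left_diff_distrib)
    have "th' t1 0 - th t1 0 / 2 < th' t2 0 - th t2 0 / 2"
    proof (rule has_sum_less[where i = 1])
      show "(pi * (of_int k)\<^sup>2 / t1 - 1/2) * exp (- (pi * (of_int k)\<^sup>2 / t1)) \<le> (pi * (of_int k)\<^sup>2 / t2 - 1/2) * exp (- (pi * (of_int k)\<^sup>2 / t2))" for k :: int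
        using linear_exp_decreasing[OF w(2,1), of k] by (cases "k = 0") auto
      show "(pi * (of_int 1)\<^sup>2 / t1 - 1/2) * exp (- (pi * (of_int 1)\<^sup>2 / t1)) < (pi * (of_int 1)\<^sup>2 / t2 - 1/2) * exp (- (pi * (of_int 1)\<^sup>2 / t2))"
        using linear_exp_decreasing[OF w(2,1), of 1] by simp
    qed (use hs t in auto)
    moreover have "th t1 0 \<le> th t2 0"
      by (rule has_sum_mono[OF th_has_sum[of t1 0] th_has_sum[of t2 0]])
         (use t in \<open>auto intro!: divide_left_mono\<close>)
    moreover have "1 \<le> th t1 0" "th' t1 0 \<le> th t1 0 / 2" using th0_pos[of t1] th'0_le[of t1] t by auto
    ultimately have "(th t2 0 - th t1 0) / 2 < th' t2 0 - th' t1 0" "0 < th t1 0" "0 \<le> th t2 0 - th t1 0"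
      and le: "th' t1 0 \<le> th t1 0 / 2" by simp_all
    then have "(th t1 0) * ((th t2 0 - th t1 0) / 2) < th t1 0 * (th' t2 0 - th' t1 0)"
      and "th' t1 0 * (th t2 0 - th t1 0) \<le> th t1 0 / 2 * (th t2 0 - th t1 0)"
      by (metis mult_strict_left_mono) (metis mult_right_mono \<open>0 \<le> th t2 0 - th t1 0\<close> le)
    then have "th' t1 0 * (th t2 0 - th t1 0) < th t1 0 * (th' t2 0 - th' t1 0)" by simp
    then show ?thesis by (simp add: algebra_simps)
  qed
  define \<rho> where "\<rho> t = th' t 0 / th t 0" for t
  have inv: "\<rho> (1 / t) = 1/2 - \<rho> t" if "t > 0" for t
  proof -
    have "th' (1/t) 0 = th t 0 / sqrt t / 2 - th' t 0 / sqrt t" using th0_inverse[OF that] by simp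
    moreover have "(X / q / 2 - Z / q) / (X / q) = 1/2 - Z / X" if "X > 0" "q > 0" for X q Z :: real
      using that by (simp add: field_simps)
    ultimately show ?thesis using th0_inverse(1)[OF that] th0_pos[OF that] that by (simp add: \<rho>_def)
  qed
  have sm: "\<rho> t1 < \<rho> t2" if "0 < t1" "t1 < t2" "t2 \<le> 1" for t1 t2
    using small[OF that] th0_pos[of t1] th0_pos[of t2] that by (simp add: \<rho>_def field_simps)
  have r1: "\<rho> 1 = 1/4" using inv[of 1] by simp
  have "\<rho> t1 < \<rho> t2"
  proof (cases "t2 \<le> 1")
    case True then show ?thesis using sm assms by simp
  next
    case False
    have "\<rho> (1/t2) < 1/4" using sm[of "1/t2" 1] False r1 by simp
    then have t2: "\<rho> t2 > 1/4" using inv[of t2] False by simp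
    show ?thesis
    proof (cases "t1 \<le> 1")
      case True
      then have "\<rho> t1 \<le> 1/4" using sm[of t1 1] r1 assms by (cases "t1 = 1") auto
      then show ?thesis using t2 by simp
    next
      case f1: False
      then have "\<rho> (1/t2) < \<rho> (1/t1)" using assms by (intro sm) (auto simp: field_simps)
      then show ?thesis using inv[of t1] inv[of t2] assms False by simp
    qed
  qed
  then show ?thesis using th0_pos[of t1] th0_pos[of t2] assms by (simp add: \<rho>_def field_simps)
qed

text \<open>On the imaginary axis the double sum factors into one-variable theta functions with
  parameters \<open>s / y\<close> and \<open>1 / (s * y)\<close>, and \<open>ntheta'\<close> becomes
  the expression of \<open>th0_cross\<close>. The parameters are in the right order exactly because
  \<open>s > 1\<close>.\<close>

lemma ntheta'_pos_0:
  assumes s: "s > 1" and y: "y > 0" shows "ntheta' s 0 y > 0"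
proof -
  have s0: "s > 0" using s by simp
  define t where "t = 1 / (s * y)"
  have t: "t > 0" "t < s / y" using s y mult_strict_mono[of 1 s 1 s] by (auto simp: t_def field_simps)
  have 1: "((\<lambda>m::int. exp (- pi * s * y * (of_int m)\<^sup>2)) has_sum th t 0) UNIV"
    using th_has_sum[OF t(1), of 0] by (simp add: t_def mult_ac)
  have 2: "((\<lambda>m::int. pi * s * y * (of_int m)\<^sup>2 * exp (- pi * s * y * (of_int m)\<^sup>2)) has_sum th' t 0) UNIV"
    using th'_has_sum[OF t(1), of 0] by (simp add: t_def mult_ac)
  have "((\<lambda>m::int. th' (s/y) 0 * exp (- pi * s * y * (of_int m)\<^sup>2) + - (th (s/y) 0 * (pi * s * y * (of_int m)\<^sup>2 * exp (- pi * s * y * (of_int m)\<^sup>2))))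
    has_sum (th' (s/y) 0 * th t 0 + - (th (s/y) 0 * th' t 0))) UNIV"
    by (intro has_sum_add has_sum_uminusI has_sum_cmult_right 1 2)
  then have "((\<lambda>m::int. exp (- pi * s * y * (of_int m)\<^sup>2) * (th' (s / y) 0 - pi * s * y * (of_int m)\<^sup>2 * th (s / y) 0))
    has_sum (th' (s/y) 0 * th t 0 - th (s/y) 0 * th' t 0)) UNIV"
    by (simp add: algebra_simps)
  then have "ntheta' s 0 y / sqrt y = th' (s/y) 0 * th t 0 - th (s/y) 0 * th' t 0"
    using has_sum_unique ntheta_slices(2)[OF s0 y, of 0] by simp
  then have "ntheta' s 0 y / sqrt y > 0" using th0_cross[OF t] by (simp add: mult.commute)
  then show ?thesis using y by (simp add: zero_less_divide_iff)
qed

section \<open>Positivity off the imaginary axis\<close>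

lemma gauss_tail_term:
  fixes w w0 :: real and k :: int
  assumes "k \<noteq> 0" "w0 \<le> w" "4 \<le> w0"
  shows "(1/2 + w * (of_int k)\<^sup>2) * exp (- (w * (of_int k)\<^sup>2)) \<le> 2 * ((1/2 + w0) * exp (- w0)) * (1/2) ^ nat \<bar>k\<bar>"
proof -
  define m where "m = nat \<bar>k\<bar>"
  have k: "(of_int k)\<^sup>2 = (real m)\<^sup>2" and m: "1 \<le> m" using assms by (auto simp: m_def)
  have m2: "1 \<le> (real m)\<^sup>2" using m by simp
  have e: "(real m)\<^sup>2 * exp (- (w * ((real m)\<^sup>2 - 1))) \<le> 2 * (1/2) ^ m"
  proof (cases "m = 1")
    case False
    have "w \<ge> 4" using assms by linarith
    then have "exp (- (5 * w)) \<le> exp (- 10)" "exp (- (w * 3)) \<le> exp (- 10)" by simp_all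
    then have e: "exp (- (5 * w)) \<le> 1/20000" "exp (- (w * 3)) \<le> 1/20000" using exp_num(5) by linarith+
    show ?thesis
    proof (rule gauss_power_decay[of w 2 2])
      show "(3/2)\<^sup>2 * exp (- (5 * w)) \<le> 1/2" using e(1) by (simp add: power2_eq_square)
      show "(real 2)\<^sup>2 * exp (- (w * ((real 2)\<^sup>2 - 1))) \<le> 2 * (1/2)\<^sup>2" using e(2) by (simp add: power2_eq_square)
    qed (use \<open>w \<ge> 4\<close> m False in auto)
  qed simp
  have w0e: "(1/2 + w) * exp (- w) \<le> (1/2 + w0) * exp (- w0)"
  proof -
    have "exp (- w) \<le> exp (- w0)" using assms by simp
    moreover have "w * exp (- w) \<le> w0 * exp (- w0)" using linear_exp_antimono[of w0 w 1] assms by simp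
    ultimately show ?thesis unfolding distrib_right by linarith
  qed
  have "(1/2 + w * (real m)\<^sup>2) * exp (- (w * (real m)\<^sup>2)) \<le> ((1/2 + w) * (real m)\<^sup>2) * exp (- (w * (real m)\<^sup>2))"
    using m2 by (intro mult_right_mono) (auto simp: distrib_right)
  also have "\<dots> = ((1/2 + w) * exp (- w)) * ((real m)\<^sup>2 * exp (- (w * ((real m)\<^sup>2 - 1))))"
  proof -
    have "exp (- (w * (real m)\<^sup>2)) = exp (- w) * exp (- (w * ((real m)\<^sup>2 - 1)))"
      by (simp add: exp_add[symmetric] right_diff_distrib)
    then show ?thesis by simp
  qed
  also have "\<dots> \<le> ((1/2 + w0) * exp (- w0)) * (2 * (1/2) ^ m)"
    by (rule mult_mono[OF w0e e]) (use assms in auto)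
  finally show ?thesis unfolding k m_def[symmetric] by simp
qed

lemma has_sum_half_int_nonzero: "((\<lambda>k::int. of_bool (k \<noteq> 0) * (1/2) ^ nat \<bar>k\<bar>) has_sum (2::real)) UNIV"
proof -
  have "((\<lambda>k::int. - of_bool (k = 0)) has_sum (-1 :: real)) UNIV"
    by (rule has_sum_finite_neutralI[of "{0}"]) auto
  moreover have "of_bool (k \<noteq> 0) * (1/2) ^ nat \<bar>k\<bar> = (1/2) ^ nat \<bar>k\<bar> + (- of_bool (k = 0) :: real)" for k :: int
    by auto
  ultimately show ?thesis using has_sum_add[OF has_sum_half_int] by fastforce
qed

text \<open>For large \<open>y / s\<close>, \<open>ntheta'\<close> is least at \<open>x = 0\<close>,
  where it is positive. Otherwise, with \<open>A = th (s / y) 0\<close>, the slice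
  \<open>m = 0\<close> is at least \<open>0.392 * A\<close> and the other slices cost at most
  \<open>0.32 * A\<close> together; \<open>y\<^sup>2 \<ge> 3/4\<close> enters through
  \<open>pi * s * y \<ge> 4.05\<close>.\<close>

theorem ntheta'_pos:
  assumes s: "s > 1" and y: "y > 0" "3/4 \<le> y\<^sup>2"
  shows "ntheta' s x y > 0"
proof (cases "y / s \<ge> 58/100")
  case True
  have "2/3 \<le> y"
  proof (rule power2_le_imp_le)
    show "(2/3)\<^sup>2 \<le> y\<^sup>2" using y by (simp add: power2_eq_square)
  qed (use y in simp)
  then show ?thesis using ntheta'_zero_le_fourier[OF s _ True, of x] ntheta'_pos_0[OF s y(1)] by simp
next
  case False
  define T where "T = s / y"
  define a where "a = pi * s * y"
  have s0: "s > 0" using s by simp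
  have T1: "50/29 \<le> T" using False s0 y by (simp add: T_def field_simps)
  have T0: "T > 0" using T1 by simp
  have "3.14 * (50/29) \<le> pi * T" using pi_gt_314 T1 by (intro mult_mono) auto
  then have pT: "541/100 \<le> pi * T" by simp
  have "a = pi * T * y\<^sup>2" using y by (simp add: a_def T_def power2_eq_square)
  then have "pi * T * (3/4) \<le> a" using T0 y by (simp add: mult_left_mono)
  then have a: "405/100 \<le> a" using pT by simp
  define A where "A = th T 0"
  have A1: "A > 0" using th0_pos[OF T0] by (simp add: A_def)
  have thb: "th T z \<le> A" "th' T z \<ge> - (A / 2)" for z
  proof -
    show "th T z \<le> A" unfolding A_def
      by (rule has_sum_mono[OF th_has_sum[OF T0] th_has_sum[OF T0]]) auto
    have "- th' T 0 \<le> th' T z"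
    proof (rule has_sum_mono[OF has_sum_uminusI[OF th'_has_sum[OF T0]] th'_has_sum[OF T0]])
      fix k :: int
      have "pi * (of_int k)\<^sup>2 / T * exp (- pi * (of_int k)\<^sup>2 / T) * - 1 \<le> pi * (of_int k)\<^sup>2 / T * exp (- pi * (of_int k)\<^sup>2 / T) * cos (2 * pi * of_int k * z)"
        using T0 by (intro mult_left_mono) auto
      then show "- (pi * (of_int k)\<^sup>2 / T * exp (- pi * (of_int k)\<^sup>2 / T) * cos (2 * pi * of_int k * 0)) \<le>
         pi * (of_int k)\<^sup>2 / T * exp (- pi * (of_int k)\<^sup>2 / T) * cos (2 * pi * of_int k * z)" by simp
    qed
    then show "th' T z \<ge> - (A / 2)" using th'0_le[OF T0] by (simp add: A_def)
  qed
  define E where "E = (2 * ((1/2 + 541/100) * exp (- (541/100))) :: real)"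
  define E2 where "E2 = (2 * ((1/2 + 405/100) * exp (- (405/100))) :: real)"
  have E: "E \<le> 54/1000" and E2: "E2 \<le> 16/100"
    unfolding E_def E2_def using exp_minus_le[of "41/100" "541/100" 5 "4512/1000000"] exp_minus_le[of "5/100" "405/100" 4 "1744/100000"]
    by (simp_all add: power2_eq_square power_divide)
  \<comment> \<open>Inversion gives \<open>th' T 0 = A / 2 - sqrt T * th' (1 / T) 0\<close>, where
    the last factor is a Gaussian tail of size at most \<open>0.108\<close> and
    \<open>sqrt T \<le> A\<close>.\<close>
  have th'0: "th' T 0 \<ge> A * (392/1000)"
  proof -
    have "th' (1 / T) 0 \<le> E * 2"
    proof (rule has_sum_mono[OF _ has_sum_cmult_right[OF has_sum_half_int_nonzero]])
      show "((\<lambda>n::int. (pi * T * (of_int n)\<^sup>2) * exp (- (pi * T * (of_int n)\<^sup>2))) has_sum th' (1/T) 0) UNIV"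
        using th'_has_sum[of "1/T" 0] T0 by (simp add: mult_ac)
      fix n :: int
      show "(pi * T * (of_int n)\<^sup>2) * exp (- (pi * T * (of_int n)\<^sup>2)) \<le> E * (of_bool (n \<noteq> 0) * (1/2) ^ nat \<bar>n\<bar>)"
      proof (cases "n = 0")
        case False
        have "(pi * T * (of_int n)\<^sup>2) * exp (- (pi * T * (of_int n)\<^sup>2)) \<le> (1/2 + pi * T * (of_int n)\<^sup>2) * exp (- (pi * T * (of_int n)\<^sup>2))"
          by (intro mult_right_mono) auto
        also have "\<dots> \<le> E * (1/2) ^ nat \<bar>n\<bar>" unfolding E_def using False pT by (intro gauss_tail_term) auto
        finally show ?thesis using False by simp
      qed simp
    qed
    then have 1: "sqrt T * th' (1 / T) 0 \<le> sqrt T * (108/1000)" using E T0 by (intro mult_left_mono) auto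
    have 2: "sqrt T * (108/1000) \<le> A * (108/1000)"
    proof (intro mult_right_mono)
      have "sqrt T * 1 \<le> sqrt T * th (1/T) 0" using th0_pos[of "1/T"] T0 by (intro mult_left_mono) auto
      then show "sqrt T \<le> A" using th0_inverse(1)[OF T0] T0 by (simp add: A_def)
    qed simp
    have "th' T 0 = sqrt T * (th (1/T) 0 / 2) - sqrt T * th' (1/T) 0"
    proof -
      have "th' T 0 = sqrt T * (th' T 0 / sqrt T)" using T0 by simp
      then show ?thesis unfolding th0_inverse(2)[OF T0, symmetric] right_diff_distrib .
    qed
    also have "sqrt T * (th (1/T) 0 / 2) = A / 2" using th0_inverse(1)[OF T0] T0 by (simp add: A_def)
    finally show ?thesis using 1 2 by linarith
  qed
  have h: "((\<lambda>m::int. th' T 0 * of_bool (m = 0) + - (A * E2) * (of_bool (m \<noteq> 0) * (1/2) ^ nat \<bar>m\<bar>)) has_sum (th' T 0 + - (A * E2) * 2)) UNIV"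
    by (intro has_sum_add has_sum_cmult_right has_sum_half_int_nonzero has_sum_finite_neutralI[of "{0}"]) auto
  have "th' T 0 + - (A * E2) * 2 \<le> ntheta' s x y / sqrt y"
  proof (rule has_sum_mono[OF h ntheta_slices(2)[OF s0 y(1), of x]])
    fix m :: int
    show "th' T 0 * of_bool (m = 0) + - (A * E2) * (of_bool (m \<noteq> 0) * (1/2) ^ nat \<bar>m\<bar>)
      \<le> exp (- pi * s * y * (of_int m)\<^sup>2) * (th' (s / y) (of_int m * x) - pi * s * y * (of_int m)\<^sup>2 * th (s / y) (of_int m * x))"
    proof (cases "m = 0")
      case True then show ?thesis by (simp add: T_def)
    next
      case False
      have "a * (of_int m)\<^sup>2 * th T (of_int m * x) \<le> a * (of_int m)\<^sup>2 * A" using a thb by (intro mult_left_mono) auto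
      then have "- (A * (1/2 + a * (of_int m)\<^sup>2)) \<le> th' T (of_int m * x) - a * (of_int m)\<^sup>2 * th T (of_int m * x)"
        using thb(2)[of "of_int m * x"] by (simp add: algebra_simps)
      then have "exp (- (a * (of_int m)\<^sup>2)) * - (A * (1/2 + a * (of_int m)\<^sup>2)) \<le> exp (- (a * (of_int m)\<^sup>2)) * (th' T (of_int m * x) - a * (of_int m)\<^sup>2 * th T (of_int m * x))"
        by (intro mult_left_mono) auto
      moreover have "A * ((1/2 + a * (of_int m)\<^sup>2) * exp (- (a * (of_int m)\<^sup>2))) \<le> A * (E2 * (1/2) ^ nat \<bar>m\<bar>)"
        unfolding E2_def using A1 a False by (intro mult_left_mono gauss_tail_term) auto
      ultimately have "- (A * (E2 * (1/2) ^ nat \<bar>m\<bar>)) \<le> exp (- (a * (of_int m)\<^sup>2)) * (th' T (of_int m * x) - a * (of_int m)\<^sup>2 * th T (of_int m * x))"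
        by (simp add: mult_ac)
      then show ?thesis using False by (simp add: a_def T_def)
    qed
  qed
  moreover have "A * E2 \<le> A * (16/100)" using A1 E2 by (intro mult_left_mono) auto
  ultimately have "ntheta' s x y / sqrt y > 0" using th'0 A1 by linarith
  then show ?thesis using y by (simp add: zero_less_divide_iff)
qed

section \<open>Decrease of the derivative along the line of real part one half\<close>

text \<open>Minus the derivative of \<open>(w - 1/2) * exp (- w)\<close>; also, with
  \<open>w = \<omega> * y\<close>, the derivative in \<open>y\<close> of
  \<open>y * sqrt y * exp (- (\<omega> * y))\<close> up to the factor \<open>- sqrt y\<close>. It
  thus governs monotonicity in \<open>y\<close> in both regimes.\<close>

definition nu :: "real \<Rightarrow> real" where "nu w = (w - 3/2) * exp (- w)"

text \<open>The third inequality is the one that \<open>pair_bounds\<close> demands of its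
  weights.\<close>

lemma nu_bounds:
  assumes "5/2 \<le> v" "v \<le> w"
  shows "0 \<le> nu w" "nu w \<le> nu v" "nu v - nu w \<le> (w - v) * nu v"
proof -
  show "0 \<le> nu w" using assms by (simp add: nu_def)
  have e: "exp (- v) * exp (v - w) = exp (- w)" by (simp add: exp_add[symmetric])
  have "1 * (w - v) \<le> (v - 3/2) * (w - v)" by (rule mult_right_mono) (use assms in auto)
  moreover have "w - 3/2 = (v - 3/2) + (w - v)" by simp
  ultimately have "w - 3/2 \<le> (v - 3/2) * (1 + (w - v))" by (simp only: distrib_left mult_1_right add_le_cancel_left mult_1)
  also have "\<dots> \<le> (v - 3/2) * exp (w - v)" using assms by (intro mult_left_mono exp_ge_add_one_self) auto
  finally have "nu w \<le> (v - 3/2) * exp (w - v) * exp (- w)" unfolding nu_def by (rule mult_right_mono) simp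
  then show "nu w \<le> nu v" by (simp add: nu_def mult.assoc exp_add[symmetric])
  have "nu v * (1 + (v - w)) \<le> nu v * exp (v - w)"
    using assms by (intro mult_left_mono exp_ge_add_one_self) (auto simp: nu_def)
  also have "\<dots> = (v - 3/2) * exp (- w)" by (simp add: nu_def mult.assoc e)
  also have "\<dots> \<le> nu w" unfolding nu_def using assms by (intro mult_right_mono) auto
  finally show "nu v - nu w \<le> (w - v) * nu v" by (simp add: algebra_simps)
qed

text \<open>Away from the zero \<open>3/2\<close> of \<open>nu\<close>, its linear factor grows at a
  relative rate of at most \<open>c\<close>, so it costs only that share of the exponential
  decay.\<close>

lemma nu_decay:
  assumes "3/2 \<le> v" "v \<le> w" "1 \<le> (v - 3/2) * c" shows "nu w \<le> nu v * exp (- ((1 - c) * (w - v)))"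
proof -
  have "1 * (w - v) \<le> (v - 3/2) * c * (w - v)" by (rule mult_right_mono) (use assms in auto)
  moreover have "w - 3/2 = (v - 3/2) + (w - v)" by simp
  ultimately have "w - 3/2 \<le> (v - 3/2) * (1 + c * (w - v))" by (simp only: distrib_left mult_1_right add_le_cancel_left mult.assoc mult_1)
  also have "\<dots> \<le> (v - 3/2) * exp (c * (w - v))" using assms by (intro mult_left_mono exp_ge_add_one_self) auto
  finally have "nu w \<le> (v - 3/2) * exp (c * (w - v)) * exp (- w)" unfolding nu_def by (rule mult_right_mono) simp
  also have "\<dots> = nu v * exp (- ((1 - c) * (w - v)))"
  proof -
    have "exp (c * (w - v)) * exp (- w) = exp (- v) * exp (- ((1 - c) * (w - v)))"
      unfolding exp_add[symmetric] by (rule arg_cong[of _ _ exp]) (simp add: algebra_simps)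
    then show ?thesis by (simp add: nu_def mult.assoc)
  qed
  finally show ?thesis .
qed

section \<open>Vertical monotonicity in the Fourier regime\<close>

lemma mult_nu_deriv: "((\<lambda>v. v * nu v) has_real_derivative (- ((v - 3) * (v - 1/2)) * exp (- v))) (at v)"
  unfolding nu_def by (auto intro!: derivative_eq_intros simp: field_simps)

lemma mult_nu_antimono: "3 \<le> u \<Longrightarrow> u \<le> v \<Longrightarrow> v * nu v \<le> u * nu u"
proof (rule DERIV_nonpos_imp_nonincreasing[of u v "\<lambda>v. v * nu v"])
  fix x assume "3 \<le> u" "u \<le> x"
  then have "- ((x - 3) * (x - 1/2)) * exp (- x) \<le> 0" by (simp add: mult_nonneg_nonneg)
  then show "\<exists>y. ((\<lambda>v. v * nu v) has_real_derivative y) (at x) \<and> y \<le> 0" using mult_nu_deriv by blast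
qed auto

lemma mult_nu_mono: "1/2 \<le> u \<Longrightarrow> v \<le> 3 \<Longrightarrow> u \<le> v \<Longrightarrow> u * nu u \<le> v * nu v"
proof (rule DERIV_nonneg_imp_nondecreasing[of u v "\<lambda>v. v * nu v"])
  fix x assume "1/2 \<le> u" "v \<le> 3" "u \<le> x" "x \<le> v"
  then have "0 \<le> - ((x - 3) * (x - 1/2))" by (simp add: mult_nonpos_nonneg)
  then have "0 \<le> - ((x - 3) * (x - 1/2)) * exp (- x)" by (intro mult_nonneg_nonneg) auto
  then show "\<exists>y. ((\<lambda>v. v * nu v) has_real_derivative y) (at x) \<and> 0 \<le> y" using mult_nu_deriv by blast
qed

text \<open>Settles the pairs with one zero index. The function \<open>v * nu v\<close> rises up to
  \<open>3\<close> and falls beyond. If \<open>\<beta> * K < 3\<close>, then \<open>K = 1\<close>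
  and the product hypothesis pushes \<open>\<alpha>\<close> past \<open>555/100 = 16.65 / 3\<close>,
  where explicit values decide. The constants lie just below \<open>3.14 * 0.6\<close> and
  \<open>(3.14 * 1.3)^2\<close>.\<close>

lemma mult_nu_compare:
  assumes "188/100 \<le> \<beta>" "\<beta> \<le> \<alpha>" "1665/100 \<le> \<alpha> * \<beta>" "K = 1 \<or> 4 \<le> K" "1 \<le> K"
  shows "(\<alpha> * K) * nu (\<alpha> * K) \<le> (\<beta> * K) * nu (\<beta> * K)"
proof (cases "3 \<le> \<beta> * K")
  case True
  then show ?thesis using assms by (intro mult_nu_antimono mult_right_mono) auto
next
  case False
  have "\<not> 4 \<le> K"
  proof
    assume "4 \<le> K"
    then have "188/100 * 4 \<le> \<beta> * K" using assms(1) by (intro mult_mono) auto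
    then show False using False by simp
  qed
  then have K: "K = 1" using assms(4) by simp
  then have b3: "\<beta> < 3" using False by simp
  have a: "555/100 \<le> \<alpha>"
  proof (rule ccontr)
    assume "\<not> ?thesis"
    then have "\<alpha> * \<beta> < 555/100 * 3" using b3 assms(1) by (intro mult_strict_mono) auto
    then show False using assms(3) by simp
  qed
  have "\<alpha> * nu \<alpha> \<le> 555/100 * nu (555/100)" using a by (intro mult_nu_antimono) auto
  also have "\<dots> \<le> 95/1000"
    using exp_minus_le[of "55/100" "555/100" 5 "398/100000"] by (simp add: nu_def power2_eq_square power_divide)
  also have "\<dots> \<le> 188/100 * nu (188/100)"
  proof -
    have "exp (188/100) \<le> exp (2::real)" by simp
    also have "exp (2::real) = exp 1 * exp 1" by (simp add: exp_add[symmetric])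
    also have "\<dots> \<le> (272/100) * (272/100)" using e_less_272 by (intro mult_mono) auto
    finally have "inverse (74/10) \<le> inverse (exp (188/100 :: real))" by (intro le_imp_inverse_le) auto
    then show ?thesis by (simp add: nu_def exp_minus)
  qed
  also have "\<dots> \<le> \<beta> * nu \<beta>" using assms b3 by (intro mult_nu_mono) auto
  finally show ?thesis using K by simp
qed

text \<open>Up to \<open>pi\<close> and a cosine, the \<open>(m, k)\<close> term of the Fourier series of \<open>ntheta' s x y\<close> is \<open>mode W \<omega> y\<close> with
  \<open>W = k\<^sup>2 / s - s * m\<^sup>2\<close> and \<open>\<omega> = k\<^sup>2 / s + s * m\<^sup>2\<close>.\<close>

definition mode :: "real \<Rightarrow> real \<Rightarrow> real \<Rightarrow> real" where
  "mode W \<omega> y = y * sqrt y * W * exp (- (pi * \<omega> * y))"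

lemma mode_deriv: "y > 0 \<Longrightarrow> (mode W \<omega> has_real_derivative - (sqrt y * (W * nu (pi * \<omega> * y)))) (at y)"
proof -
  assume y: "y > 0"
  have "(mode W \<omega> has_real_derivative (1 * sqrt y + y * (inverse (sqrt y) / 2)) * W * exp (- (pi * \<omega> * y)) + y * sqrt y * W * (exp (- (pi * \<omega> * y)) * - (pi * \<omega>))) (at y)"
    unfolding mode_def using y by (auto intro!: derivative_eq_intros)
  moreover have "y * (inverse (sqrt y) / 2) = sqrt y / 2"
  proof -
    have "y * inverse (sqrt y) = sqrt y" using real_div_sqrt[of y] y unfolding divide_inverse by simp
    then show ?thesis by simp
  qed
  moreover have "(1 * sqrt y + sqrt y / 2) * W * E + y * sqrt y * W * (E * - (pi * \<omega>)) = - (sqrt y * (W * ((pi * \<omega> * y - 3/2) * E)))" for E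
    by (simp add: field_simps)
  ultimately show ?thesis unfolding nu_def by (simp only:)
qed

text \<open>Works with three modes at a time, so the double series never has to be differentiated in
  \<open>y\<close>; a multiple \<open>u\<close> of the dominant mode pays for a swapped
  pair.\<close>

lemma mode_antimonoI:
  assumes y: "0 < y1" "y1 \<le> y2"
    and h: "\<And>y. y1 \<le> y \<Longrightarrow> y \<le> y2 \<Longrightarrow> 0 \<le> c * (W * nu (pi * \<omega> * y) + W' * nu (pi * \<omega>' * y)) + u * (W1 * nu (pi * \<omega>1 * y))"
  shows "c * (mode W \<omega> y2 + mode W' \<omega>' y2) + u * mode W1 \<omega>1 y2 \<le> c * (mode W \<omega> y1 + mode W' \<omega>' y1) + u * mode W1 \<omega>1 y1"
proof (rule DERIV_nonpos_imp_nonincreasing[of y1 y2 "\<lambda>y. c * (mode W \<omega> y + mode W' \<omega>' y) + u * mode W1 \<omega>1 y"])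
  fix y assume yy: "y1 \<le> y" "y \<le> y2"
  then have y0: "y > 0" using y by simp
  have "((\<lambda>y. c * (mode W \<omega> y + mode W' \<omega>' y) + u * mode W1 \<omega>1 y) has_real_derivative
     (c * (- (sqrt y * (W * nu (pi * \<omega> * y))) + - (sqrt y * (W' * nu (pi * \<omega>' * y)))) + u * - (sqrt y * (W1 * nu (pi * \<omega>1 * y))))) (at y)"
    by (intro DERIV_add DERIV_cmult mode_deriv y0)
  moreover have "(c * (- (sqrt y * (W * nu (pi * \<omega> * y))) + - (sqrt y * (W' * nu (pi * \<omega>' * y)))) + u * - (sqrt y * (W1 * nu (pi * \<omega>1 * y))))
     = - (sqrt y * (c * (W * nu (pi * \<omega> * y) + W' * nu (pi * \<omega>' * y)) + u * (W1 * nu (pi * \<omega>1 * y))))" by (simp add: algebra_simps)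
  moreover have "0 \<le> sqrt y * (c * (W * nu (pi * \<omega> * y) + W' * nu (pi * \<omega>' * y)) + u * (W1 * nu (pi * \<omega>1 * y)))"
    using h[OF yy] y0 by (intro mult_nonneg_nonneg) auto
  ultimately show "\<exists>D. ((\<lambda>y. c * (mode W \<omega> y + mode W' \<omega>' y) + u * mode W1 \<omega>1 y) has_real_derivative D) (at y) \<and> D \<le> 0" by auto
qed (use y in auto)

text \<open>The counterpart for \<open>nu\<close> of the pair estimates for exponentials. All
  arguments are at least \<open>585/100\<close>, so \<open>nu_decay\<close> applies with
  \<open>c = 23/100\<close> and leaves \<open>77/100\<close> of each rate.\<close>

lemma far_pair_bound:
  fixes p q :: nat and a b \<sigma> :: real
  assumes pq: "1 \<le> p" "p \<le> q" "2 \<le> q" and ab: "6/10 \<le> b" "b \<le> a" "13/10 \<le> a" and \<sigma>: "\<bar>\<sigma>\<bar> = 1"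
  defines "M \<equiv> (real p)\<^sup>2" and "K \<equiv> (real q)\<^sup>2"
  shows "0 \<le> \<sigma> / 2 * ((b * K - a * M) * nu (pi * (a * M + b * K)) + (b * M - a * K) * nu (pi * (a * K + b * M)))
      + uwt p * uwt q * ((a - b) * nu (pi * (a + b)))"
proof -
  define \<alpha> \<beta> where "\<alpha> = pi * a" and "\<beta> = pi * b"
  have \<beta>: "188/100 \<le> \<beta>"
    using mult_mono[of "3.14" pi "6/10" b] pi_gt_314 ab by (simp add: \<beta>_def)
  have \<alpha>: "408/100 \<le> \<alpha>"
    using mult_mono[of "3.14" pi "13/10" a] pi_gt_314 ab by (simp add: \<alpha>_def)
  have ba: "\<beta> \<le> \<alpha>" using ab by (simp add: \<alpha>_def \<beta>_def)
  have MK: "1 \<le> M" "M \<le> K" using pq by (auto simp: M_def K_def power_mono)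
  define w1 wA wB where "w1 = \<alpha> + \<beta>" and "wA = pi * (a * M + b * K)" and "wB = pi * (a * K + b * M)"
  have w1: "585/100 \<le> w1" using \<alpha> \<beta> by (simp add: w1_def)
  have wA: "wA - w1 = \<alpha> * (M - 1) + \<beta> * (K - 1)" and wB: "wB - w1 = \<alpha> * (K - 1) + \<beta> * (M - 1)"
    by (simp_all add: wA_def wB_def w1_def \<alpha>_def \<beta>_def algebra_simps)
  have "0 \<le> \<alpha> * (M - 1) + \<beta> * (K - 1)" using \<alpha> \<beta> MK by (intro add_nonneg_nonneg mult_nonneg_nonneg) auto
  then have w1A: "w1 \<le> wA" using wA by linarith
  have "wB - wA = (\<alpha> - \<beta>) * (K - M)" by (simp add: wA_def wB_def \<alpha>_def \<beta>_def algebra_simps)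
  then have AB: "wA \<le> wB" using mult_nonneg_nonneg[of "\<alpha> - \<beta>" "K - M"] ba MK by linarith
  have b0: "0 < b" and M0: "0 \<le> M" using ab MK by auto
  have nA0: "0 \<le> nu wB" "nu wB \<le> nu wA" "nu wA - nu wB \<le> (wB - wA) * nu wA"
    using nu_bounds[of wA wB] AB w1 w1A by auto
  have n1: "0 \<le> nu w1" using nu_bounds(1)[of w1 w1] w1 by simp
  define S where "S = (a * M - b * K) * nu wA + (a * K - b * M) * nu wB"
  define X1 X2 where "X1 = exp (- (77/100 * \<alpha> * (M - 1) + 77/100 * \<beta> * (K - 1)))" and "X2 = exp (- (77/100 * \<alpha> * (K - 1) + 77/100 * \<beta> * (M - 1)))"
  have nA: "nu wA \<le> nu w1 * X1" and nB: "nu wB \<le> nu w1 * X2"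
  proof -
    have d: "nu w \<le> nu w1 * exp (- (77/100 * (w - w1)))" if "w1 \<le> w" for w
      using nu_decay[of w1 w "23/100"] w1 that by simp
    show "nu wA \<le> nu w1 * X1" "nu wB \<le> nu w1 * X2"
      using d[OF w1A] d[OF order_trans[OF w1A AB]] unfolding wA wB X1_def X2_def
      by (simp_all only: distrib_left mult.assoc)
  qed
  have Sb: "S \<le> (a - b) * (M * nu wA + (M + K) * nu wB)" "- S \<le> (a - b) * (pi * b * (K - M)\<^sup>2 * nu wA)"
    unfolding S_def using pair_bounds[OF b0 ab(2) M0 MK(2) nA0[unfolded wA_def wB_def]] by (simp_all add: wA_def wB_def)
  have nn: "0 \<le> (a - b) * (M * nu wA + (M + K) * nu wB)" "0 \<le> (a - b) * (pi * b * (K - M)\<^sup>2 * nu wA)"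
    using ab MK nA0 by (auto intro!: mult_nonneg_nonneg add_nonneg_nonneg)
  have "\<bar>S\<bar> \<le> (a - b) * (M * nu wA + (M + K) * nu wB) + (a - b) * (pi * b * (K - M)\<^sup>2 * nu wA)"
    using Sb nn by linarith
  also have "\<dots> = (a - b) * ((\<beta> * (K - M)\<^sup>2 + M) * nu wA + (M + K) * nu wB)"
    by (simp add: \<beta>_def algebra_simps)
  also have "\<dots> \<le> (a - b) * ((\<beta> * (K - M)\<^sup>2 + M) * (nu w1 * X1) + (M + K) * (nu w1 * X2))"
    using ab MK \<beta> nA nB by (intro mult_left_mono add_mono) auto
  finally have S: "\<bar>S\<bar> \<le> (a - b) * nu w1 * ((\<beta> * (K - M)\<^sup>2 + M) * X1 + (M + K) * X2)" by (simp add: algebra_simps)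
  have "((\<beta> * (K - M)\<^sup>2 + M) * X1 + (M + K) * X2) / 2 \<le> uwt p * uwt q"
  proof -
    consider "p = q" | "p = 1" "q = 2" | "p < q" "3 \<le> q" using pq by linarith
    then show ?thesis
    proof cases
      case 1
      then have KM: "K = M" by (simp add: K_def M_def)
      have "2 \<le> p" using 1 pq by simp
      have "((\<beta> * (K - M)\<^sup>2 + M) * X1 + (M + K) * X2) / 2 = 3/2 * M * exp (- (77/100 * w1 * (M - 1)))"
      proof -
        have e: "77/100 * \<alpha> * (M - 1) + 77/100 * \<beta> * (M - 1) = 77/100 * w1 * (M - 1)"
          by (simp only: w1_def distrib_left distrib_right)
        show ?thesis unfolding X1_def X2_def KM e by simp
      qed
      also have "\<dots> \<le> M ^ 3 * exp (- (77/100 * w1 * (M - 1)))"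
      proof (rule mult_right_mono)
        have "4 \<le> M" using power_mono[of 2 "real p" 2] \<open>2 \<le> p\<close> by (simp add: M_def)
        then have "4 * 4 \<le> M * M" by (intro mult_mono) auto
        then have "3/2 * M \<le> (M * M) * M" using \<open>4 \<le> M\<close> by (intro mult_right_mono) auto
        then show "3/2 * M \<le> M ^ 3" by (simp add: power3_eq_cube)
      qed simp
      also have "\<dots> = (real p) ^ 6 * exp (- ((77/100 * w1) * ((real p)\<^sup>2 - 1)))"
        by (simp add: M_def flip: power_mult)
      also have "\<dots> \<le> uwt p * uwt p" using w1 \<open>2 \<le> p\<close> by (intro uwt_bound_cube) auto
      finally show ?thesis using 1 by simp
    next
      case 2
      then have MK': "M = 1" "K = 4" by (auto simp: M_def K_def)
      have X1: "X1 = exp (- (\<beta> * (231/100)))" unfolding X1_def MK' by simp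
      have "exp (- (188/100 * (231/100))) \<le> exp (- (434/100) :: real)" by simp
      also have "\<dots> \<le> 132/10000" by (rule exp_minus_le[of "34/100" _ 4]) (simp_all add: power2_eq_square power_divide)
      finally have e: "exp (- (188/100 * (231/100))) \<le> (132/10000 :: real)" .
      have "X1 \<le> exp (- (188/100 * (231/100)))" unfolding X1 using \<beta> by simp
      then have x1: "X1 \<le> 132/10000" using e by linarith
      have "\<beta> * X1 \<le> 188/100 * exp (- (188/100 * (231/100)))" unfolding X1 using \<beta> by (intro linear_exp_antimono) auto
      then have x2: "\<beta> * X1 \<le> 188/100 * (132/10000)" using e by linarith
      have "X2 \<le> exp (- 6)" unfolding X2_def MK' using \<alpha> by simp
      then have "X2 \<le> 1/400" using exp_num(4) by linarith
      then show ?thesis using x1 x2 unfolding MK' by (simp add: 2 uwt_def power_divide algebra_simps)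
    next
      case 3
      \<comment> \<open>The sign \<open>\<sigma>\<close> has modulus 1, so no factor
        \<open>M * K\<close> has to be paid for here; its value of at least 9 in the borrowed
        estimate absorbs the loss of replacing \<open>\<beta>\<close> by
        \<open>77/100 * \<beta>\<close> in the prefactor.\<close>
      have u: "M * K / 2 * ((77/100 * \<beta> * (K - M)\<^sup>2 + M) * X1 + (M + K) * X2) \<le> uwt p * uwt q"
        unfolding X1_def X2_def M_def K_def by (rule fourier_pair_weight) (use 3 pq \<alpha> \<beta> ba in auto)
      have "9 \<le> K" using power_mono[of 3 "real q" 2] 3 by (simp add: K_def)
      then have MK9: "9 \<le> M * K" using MK mult_mono[of 1 M 9 K] by simp
      have "((\<beta> * (K - M)\<^sup>2 + M) * X1 + (M + K) * X2) / 2 \<le> 9 / 2 * ((77/100 * \<beta> * (K - M)\<^sup>2 + M) * X1 + (M + K) * X2)"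
      proof -
        have "0 \<le> \<beta> * (K - M)\<^sup>2 * X1" "0 \<le> M * X1" "0 \<le> (M + K) * X2"
          using \<beta> MK by (auto simp: X1_def X2_def)
        moreover have "(Y + Z + V) / 2 \<le> 9 / 2 * (77/100 * Y + Z + V)" if "0 \<le> Y" "0 \<le> Z" "0 \<le> V" for Y Z V :: real
          using that by simp
        ultimately have "(\<beta> * (K - M)\<^sup>2 * X1 + M * X1 + (M + K) * X2) / 2 \<le> 9 / 2 * (77/100 * (\<beta> * (K - M)\<^sup>2 * X1) + M * X1 + (M + K) * X2)" by blast
        then show ?thesis by (simp only: distrib_right mult.assoc)
      qed
      also have "\<dots> \<le> M * K / 2 * ((77/100 * \<beta> * (K - M)\<^sup>2 + M) * X1 + (M + K) * X2)"
        using MK9 \<beta> MK by (intro mult_right_mono add_nonneg_nonneg mult_nonneg_nonneg) (auto simp: X1_def X2_def)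
      finally show ?thesis using u by linarith
    qed
  qed
  then have "(a - b) * nu w1 * (((\<beta> * (K - M)\<^sup>2 + M) * X1 + (M + K) * X2) / 2) \<le> (a - b) * nu w1 * (uwt p * uwt q)"
    using ab n1 by (intro mult_left_mono mult_nonneg_nonneg) auto
  then have "\<bar>S\<bar> / 2 \<le> uwt p * uwt q * ((a - b) * nu w1)" using S by (simp add: mult_ac)
  moreover have "\<sigma> / 2 * (- S) \<ge> - (\<bar>S\<bar> / 2)"
  proof -
    have "\<bar>\<sigma> / 2 * (- S)\<bar> = \<bar>S\<bar> / 2" using \<sigma> by (simp add: abs_mult)
    then show ?thesis by linarith
  qed
  moreover have "(b * K - a * M) * nu (pi * (a * M + b * K)) + (b * M - a * K) * nu (pi * (a * K + b * M)) = - S"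
    by (simp add: S_def wA_def wB_def algebra_simps)
  moreover have "pi * (a + b) = w1" by (simp add: w1_def \<alpha>_def \<beta>_def algebra_simps)
  ultimately show ?thesis by simp
qed

text \<open>Unlike in the horizontal comparison, terms with one zero index survive and must decrease
  by themselves. All remaining pairs are charged to the decrease \<open>c\<close> of the dominant
  mode.\<close>

theorem ntheta'_half_antimono_fourier:
  assumes s: "s > 1" and y: "13/10 \<le> y1" "y1 < y2" "6/10 \<le> y1 / s"
  shows "ntheta' s (1/2) y2 < ntheta' s (1/2) y1"
proof -
  have s0: "s > 0" using s by simp
  define om where "om M K = s * M + K / s" for M K
  define W where "W M K = K / s - s * M" for M K
  have hs: "((\<lambda>(m,k). pi * mode (W ((of_int m)\<^sup>2) ((of_int k)\<^sup>2)) (om ((of_int m)\<^sup>2) ((of_int k)\<^sup>2)) y * cos (pi * of_int (m * k))) has_sum ntheta' s (1/2) y) UNIV"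
    if "y > 0" for y
  proof -
    from has_sum_cmult_right[OF ntheta_fourier(2)[OF s0 that, of "1/2"], of "sqrt y"]
    have "((\<lambda>p. sqrt y * (case p of (m,k) \<Rightarrow> pi * (y / s * (of_int k)\<^sup>2 - s * y * (of_int m)\<^sup>2) * efun (s * y) (y / s) m k * cos (2 * pi * (of_int m * of_int k) * (1/2)))) has_sum ntheta' s (1/2) y) UNIV"
      using that by simp
    then show ?thesis
      by (rule has_sum_cong[THEN iffD1, rotated]) (auto simp: mode_def W_def om_def efun_def algebra_simps)
  qed
  define f where "f m k = pi * (mode (W ((of_int m)\<^sup>2) ((of_int k)\<^sup>2)) (om ((of_int m)\<^sup>2) ((of_int k)\<^sup>2)) y1
     - mode (W ((of_int m)\<^sup>2) ((of_int k)\<^sup>2)) (om ((of_int m)\<^sup>2) ((of_int k)\<^sup>2)) y2) * cos (pi * of_int (m * k))" for m k :: int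
  define c where "c = pi * (mode (s - 1/s) (om 1 1) y1 - mode (s - 1/s) (om 1 1) y2)"
  have yy: "13/10 \<le> y" "6/10 \<le> y / s" "y / s \<le> s * y" "13/10 \<le> s * y" "y > 0" if "y1 \<le> y" for y
  proof -
    show "13/10 \<le> y" using that y by simp
    show "6/10 \<le> y / s" using divide_right_mono[OF that, of s] s y(3) by linarith
    show y0: "y > 0" using that y by simp
    have "y \<le> s * y" "y / s \<le> y" using s y0 by (simp_all add: field_simps)
    then show "y / s \<le> s * y" "13/10 \<le> s * y" using that y by linarith+
  qed
  have ss: "s - 1 / s > 0" using s mult_strict_mono[of 1 s 1 s] by (simp add: field_simps)
  have sc: "y * W M K = (y / s) * K - (s * y) * M" "om M K * y = (s * y) * M + (y / s) * K" for y M K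
    by (simp_all add: W_def om_def algebra_simps)
  have c: "c > 0"
  proof -
    have "mode (s - 1/s) (om 1 1) y2 < mode (s - 1/s) (om 1 1) y1"
    proof (rule DERIV_neg_imp_decreasing[OF y(2)])
      fix t assume t: "y1 \<le> t" "t \<le> y2"
      have "3/2 < (3 * (13/10 + 6/10) :: real)" by simp
      also have "\<dots> \<le> pi * (s * t + t / s)" using yy[OF t(1)] pi_gt3 by (intro mult_mono add_mono) auto
      also have "\<dots> = pi * om 1 1 * t" by (simp add: om_def algebra_simps)
      finally have "3/2 < pi * om 1 1 * t" .
      then have "0 < nu (pi * om 1 1 * t)" by (simp add: nu_def)
      then have "0 < sqrt t * ((s - 1/s) * nu (pi * om 1 1 * t))" using yy[OF t(1)] ss by (intro mult_pos_pos) auto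
      then show "\<exists>D. (mode (s - 1/s) (om 1 1) has_real_derivative D) (at t) \<and> D < 0"
        using mode_deriv[of t "s - 1/s" "om 1 1"] yy[OF t(1)] by (intro exI[of _ "- (sqrt t * ((s - 1/s) * nu (pi * om 1 1 * t)))"]) auto
    qed
    then show ?thesis by (simp add: c_def)
  qed
  have "((\<lambda>(m,k). f m k) has_sum (ntheta' s (1/2) y1 + - ntheta' s (1/2) y2)) UNIV"
  proof -
    have "y1 > 0" "y2 > 0" using y by auto
    from has_sum_add[OF hs[OF this(1)] has_sum_uminusI[OF hs[OF this(2)]]] show ?thesis
      by (rule has_sum_cong[THEN iffD1, rotated]) (auto simp: f_def algebra_simps)
  qed
  then have "ntheta' s (1/2) y1 + - ntheta' s (1/2) y2 > 0"
  proof (rule symmetrised_sum_pos[OF _ c])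
    show "f (- m) k = f m k" "f m (- k) = f m k" for m k by (simp_all add: f_def)
    fix m k :: int assume mk: "0 \<le> m" "0 \<le> k" "m \<le> k"
    define p q where "p = nat m" and "q = nat k"
    have pq: "m = int p" "k = int q" "p \<le> q" using mk by (auto simp: p_def q_def)
    define M K where "M = (real p)\<^sup>2" and "K = (real q)\<^sup>2"
    have MKi: "(of_int m)\<^sup>2 = M" "(of_int k)\<^sup>2 = K" by (simp_all add: pq M_def K_def)
    define \<sigma> where "\<sigma> = cos (pi * of_int (m * k))"
    have \<sigma>: "\<bar>\<sigma>\<bar> = 1" unfolding \<sigma>_def by (cases "even (m * k)") (auto simp: cos_int_times_real mult.commute simp del: of_int_mult)
    have lw: "lwt m k = 2 * of_bool (p = 1 \<and> q = 1) - uwt p * uwt q" by (simp add: lwt_def pq)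
    have fk: "(f m k + f k m) / 2 = pi * (\<sigma> / 2 * (mode (W M K) (om M K) y1 + mode (W K M) (om K M) y1) - \<sigma> / 2 * (mode (W M K) (om M K) y2 + mode (W K M) (om K M) y2))"
    proof -
      have "f m k = pi * (mode (W M K) (om M K) y1 - mode (W M K) (om M K) y2) * \<sigma>" by (simp only: f_def MKi \<sigma>_def)
      moreover have "f k m = pi * (mode (W K M) (om K M) y1 - mode (W K M) (om K M) y2) * \<sigma>"
        by (simp only: f_def MKi \<sigma>_def mult.commute[of k m])
      ultimately show ?thesis by (simp only:) (simp add: algebra_simps add_divide_distrib diff_divide_distrib)
    qed
    have key: "C / 2 * (mode (W M K) (om M K) y2 + mode (W K M) (om K M) y2) + u * mode (s - 1/s) (om 1 1) y2
       \<le> C / 2 * (mode (W M K) (om M K) y1 + mode (W K M) (om K M) y1) + u * mode (s - 1/s) (om 1 1) y1"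
      if h: "\<And>t. y1 \<le> t \<Longrightarrow> 0 \<le> C / 2 * (((t / s) * K - (s * t) * M) * nu (pi * ((s * t) * M + (t / s) * K)) + ((t / s) * M - (s * t) * K) * nu (pi * ((s * t) * K + (t / s) * M)))
        + u * ((s * t - t / s) * nu (pi * (s * t + t / s)))" for C u
    proof (rule mode_antimonoI)
      fix t assume t: "y1 \<le> t" "t \<le> y2"
      have t0: "t > 0" using yy[OF t(1)] by simp
      have "0 \<le> t * (C / 2 * (W M K * nu (pi * om M K * t) + W K M * nu (pi * om K M * t)) + u * ((s - 1/s) * nu (pi * om 1 1 * t)))"
        using h[OF t(1)] unfolding sc[symmetric] by (simp add: om_def algebra_simps)
      then show "0 \<le> C / 2 * (W M K * nu (pi * om M K * t) + W K M * nu (pi * om K M * t)) + u * ((s - 1/s) * nu (pi * om 1 1 * t))"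
        using t0 by (simp add: zero_le_mult_iff)
    qed (use y in auto)
    consider "p = 0" "q = 0" | "p = 0" "1 \<le> q" | "p = 1" "q = 1" | "1 \<le> p" "2 \<le> q" using pq(3) by linarith
    then show "(f m k + f k m) / 2 \<ge> c * lwt m k"
    proof cases
      case 1
      then show ?thesis unfolding fk lw by (simp add: M_def K_def W_def mode_def uwt_def)
    next
      case 2
      have K: "K = 1 \<or> 4 \<le> K" "1 \<le> K"
        using 2 power_mono[of 2 "real q" 2] by (auto simp: K_def) (cases "q = 1"; auto)
      have M: "M = 0" using 2 by (simp add: M_def)
      have "1 / 2 * (mode (W M K) (om M K) y2 + mode (W K M) (om K M) y2) + 0 * mode (s - 1/s) (om 1 1) y2
       \<le> 1 / 2 * (mode (W M K) (om M K) y1 + mode (W K M) (om K M) y1) + 0 * mode (s - 1/s) (om 1 1) y1"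
      proof (rule key)
        fix t assume t: "y1 \<le> t"
        define \<alpha> \<beta> where "\<alpha> = pi * (s * t)" and "\<beta> = pi * (t / s)"
        have "3.14 * (6/10) \<le> \<beta>" unfolding \<beta>_def using pi_gt_314 yy[OF t] by (intro mult_mono) auto
        then have "188/100 \<le> \<beta>" by simp
        moreover have "1665/100 \<le> \<alpha> * \<beta>"
        proof -
          have "(3.14 * (13/10)) \<le> pi * t" using yy[OF t] pi_gt_314 by (intro mult_mono) auto
          then have "(3.14 * (13/10))\<^sup>2 \<le> (pi * t)\<^sup>2" by (intro power_mono) auto
          also have "(pi * t)\<^sup>2 = \<alpha> * \<beta>" using s by (simp add: \<alpha>_def \<beta>_def power2_eq_square)
          finally show ?thesis by (simp add: power2_eq_square)
        qed
        moreover have "\<beta> \<le> \<alpha>" unfolding \<alpha>_def \<beta>_def using yy[OF t] by (intro mult_left_mono) auto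
        ultimately have "(\<alpha> * K) * nu (\<alpha> * K) \<le> (\<beta> * K) * nu (\<beta> * K)" by (intro mult_nu_compare K)
        then have "pi * ((s * t) * K * nu (\<alpha> * K)) \<le> pi * ((t / s) * K * nu (\<beta> * K))" by (simp add: \<alpha>_def \<beta>_def mult_ac)
        then have "(s * t) * K * nu (\<alpha> * K) \<le> (t / s) * K * nu (\<beta> * K)" by (simp only: mult_le_cancel_left_pos pi_gt_zero)
        then show "0 \<le> 1 / 2 * (((t / s) * K - (s * t) * M) * nu (pi * ((s * t) * M + (t / s) * K)) + ((t / s) * M - (s * t) * K) * nu (pi * ((s * t) * K + (t / s) * M)))
          + 0 * ((s * t - t / s) * nu (pi * (s * t + t / s)))"
          by (simp add: M \<alpha>_def \<beta>_def mult_ac)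
      qed
      moreover have "\<sigma> = 1" using 2 by (simp add: \<sigma>_def pq)
      ultimately show ?thesis unfolding fk lw using 2 by (simp add: uwt_def)
    next
      case 3
      \<comment> \<open>The cosine is \<open>-1\<close> at the dominant indices, which turns the
        negative coefficient \<open>1 / s - s\<close> into \<open>s - 1 / s\<close>.\<close>
      then have "M = 1" "K = 1" "\<sigma> = -1" by (auto simp: M_def K_def \<sigma>_def pq)
      moreover have "mode (W 1 1) z t = - mode (s - 1/s) z t" for z t by (simp add: mode_def W_def algebra_simps)
      ultimately show ?thesis unfolding fk lw using 3 by (simp add: uwt_def c_def algebra_simps)
    next
      case 4
      have "\<sigma> / 2 * (mode (W M K) (om M K) y2 + mode (W K M) (om K M) y2) + uwt p * uwt q * mode (s - 1/s) (om 1 1) y2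
       \<le> \<sigma> / 2 * (mode (W M K) (om M K) y1 + mode (W K M) (om K M) y1) + uwt p * uwt q * mode (s - 1/s) (om 1 1) y1"
        by (rule key, unfold M_def K_def, rule far_pair_bound) (use 4 pq yy \<sigma> in auto)
      then have "pi * - (uwt p * uwt q * (mode (s - 1/s) (om 1 1) y1 - mode (s - 1/s) (om 1 1) y2)) \<le> (f m k + f k m) / 2"
        unfolding fk by (intro mult_left_mono) (auto simp: algebra_simps)
      moreover have "lwt m k = - (uwt p * uwt q)" unfolding lw using 4 by auto
      ultimately show ?thesis by (simp add: c_def algebra_simps)
    qed
  qed
  then show ?thesis by simp
qed

section \<open>Vertical monotonicity in the Gaussian regime\<close>

text \<open>Minus the summand of \<open>ntheta'\<close> as a function of
  \<open>w = pi * s * quad x y m n\<close>.\<close>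

definition energy :: "real \<Rightarrow> real" where "energy w = (w - 1/2) * exp (- w)"

lemma energy_deriv: "(energy has_real_derivative - nu w) (at w)"
  unfolding energy_def nu_def by (auto intro!: derivative_eq_intros simp: field_simps)

lemma energy_antimono: "3/2 \<le> u \<Longrightarrow> u \<le> v \<Longrightarrow> energy v \<le> energy u"
  using linear_exp_decreasing[of u v] by (cases "u = v") (auto simp: energy_def)

lemma one_le_of_int_power2: "m \<noteq> 0 \<Longrightarrow> 1 \<le> (of_int m :: real)\<^sup>2"
proof -
  assume "m \<noteq> 0"
  then have "1 \<le> \<bar>of_int m :: real\<bar>" by linarith
  then show ?thesis using power_mono[of 1 "\<bar>of_int m :: real\<bar>" 2] by simp
qed

text \<open>The exponent exceeds \<open>p\<close> by \<open>p * (A + Y - 1)\<close>. Of this rate,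
  \<open>268/1000\<close> pays for the linear factor of \<open>nu\<close> and
  \<open>192/1000\<close> for the factor \<open>Y\<close>, which leaves \<open>54/100\<close>. As
  \<open>5233/1000\<close> is below \<open>3.14 / 0.6\<close> and
  \<open>0.54 * 5.233 > 2.82\<close>, what remains separates into a factor in \<open>m\<close> and
  one in \<open>n\<close>.\<close>

lemma far_gauss_weight:
  assumes p: "5233/1000 \<le> p" and y: "13/10 \<le> y" and m: "m \<noteq> 0"
  shows "nu (p * ((of_int m / 2 + of_int n)\<^sup>2 + (of_int m)\<^sup>2 * y\<^sup>2)) * ((of_int m)\<^sup>2 * y\<^sup>2)
     \<le> 29/100 * uwt (nat \<bar>m\<bar>) * (of_bool (n = 0) + 1/4 * uwt (nat \<bar>n\<bar>)) * nu p"
proof -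
  define A M Y where "A = (of_int m / 2 + of_int n :: real)\<^sup>2" and "M = (of_int m :: real)\<^sup>2" and "Y = M * y\<^sup>2"
  define w where "w = p * (A + Y)"
  have y2: "169/100 \<le> y\<^sup>2" using power_mono[of "13/10" y 2] y by (simp add: power2_eq_square)
  have A0: "0 \<le> A" by (simp add: A_def)
  have m1: "1 \<le> nat \<bar>m\<bar>" using m by simp
  have M1: "1 \<le> M" unfolding M_def by (rule one_le_of_int_power2[OF m])
  have Y1: "169/100 * M \<le> Y" unfolding Y_def using y2 M1 by simp
  then have Y2: "1 \<le> Y" using M1 by linarith
  have An: "(of_int n)\<^sup>2 / 2 - M / 4 \<le> A"
    using zero_le_power2[of "of_int n + of_int m :: real"] unfolding A_def M_def by (simp add: power2_eq_square field_simps)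
  \<comment> \<open>The coefficient is \<open>144/100 = 169/100 - 1/4\<close>: completing the square
    in \<open>A\<close> costs a quarter of \<open>M\<close>.\<close>
  define z where "z = (of_int n)\<^sup>2 / 2 + 144/100 * M - 1"
  have z: "z \<le> A + Y - 1" using An Y1 unfolding z_def by simp
  have AY: "0 \<le> A + Y - 1" using A0 Y2 by linarith
  have wp: "w - p = p * (A + Y - 1)" by (simp add: w_def algebra_simps)
  have "0 \<le> p * (A + Y - 1)" using AY p by (intro mult_nonneg_nonneg) auto
  then have pw: "p \<le> w" using wp by linarith
  have n0: "0 \<le> nu p" using nu_bounds(1)[of p p] p by simp
  have "nu w \<le> nu p * exp (- ((1 - 268/1000) * (w - p)))"
    using p by (intro nu_decay pw) auto
  moreover have "Y \<le> exp (192/1000 * (w - p))"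
  proof -
    have "1 * (A + Y - 1) \<le> 192/1000 * p * (A + Y - 1)" using p AY by (intro mult_right_mono) auto
    then have "Y \<le> 1 + 192/1000 * (w - p)" using A0 unfolding wp by simp
    then show ?thesis using exp_ge_add_one_self[of "192/1000 * (w - p)"] by linarith
  qed
  ultimately have "nu w * Y \<le> (nu p * exp (- ((1 - 268/1000) * (w - p)))) * exp (192/1000 * (w - p))"
    using n0 Y2 by (intro mult_mono) auto
  also have "\<dots> = nu p * exp (- (54/100 * (w - p)))"
  proof -
    have "- (54/100 * d) = - ((1 - 268/1000) * d) + 192/1000 * d" for d :: real by simp
    from this[of "w - p"] show ?thesis by (simp only: exp_add mult.assoc)
  qed
  also have "\<dots> \<le> nu p * exp (- (282/100 * z))"
  proof (intro mult_left_mono n0)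
    have "282/100 * z \<le> 282/100 * (A + Y - 1)" using z by simp
    also have "\<dots> \<le> 54/100 * p * (A + Y - 1)" using p AY by (intro mult_right_mono) auto
    finally show "exp (- (54/100 * (w - p))) \<le> exp (- (282/100 * z))" unfolding wp by simp
  qed
  also have "exp (- (282/100 * z)) \<le> (29/100 * uwt (nat \<bar>m\<bar>)) * (of_bool (n = 0) + 1/4 * uwt (nat \<bar>n\<bar>))"
  proof -
    have "exp (- (282/100 * z)) \<le> exp (- (124/100)) * exp (- (4 * (M - 1))) * exp (- (141/100 * (of_int n)\<^sup>2))"
      unfolding exp_add[symmetric] z_def using M1 by (simp add: field_simps)
    also have "\<dots> \<le> (29/100 * uwt (nat \<bar>m\<bar>)) * (of_bool (n = 0) + 1/4 * uwt (nat \<bar>n\<bar>))"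
    proof (intro mult_mono)
      show "exp (- (124/100)) \<le> (29/100 :: real)" by (rule exp_minus_le[of "24/100" _ 1]) (simp_all add: power2_eq_square)
      have "1 * exp (- (4 * (M - 1))) \<le> M * exp (- (4 * (M - 1)))" using M1 by (intro mult_right_mono) auto
      also have "\<dots> \<le> uwt (nat \<bar>m\<bar>)" using uwt_bound_sq[OF m1, of 4] by (simp add: M_def)
      finally show "exp (- (4 * (M - 1))) \<le> uwt (nat \<bar>m\<bar>)" by simp
      show "exp (- (141/100 * (of_int n)\<^sup>2)) \<le> of_bool (n = 0) + 1/4 * uwt (nat \<bar>n\<bar>)"
      proof (cases "n = 0")
        case False
        define N where "N = (of_int n :: real)\<^sup>2"
        have n1: "1 \<le> nat \<bar>n\<bar>" using False by simp
        have N1: "1 \<le> N" unfolding N_def by (rule one_le_of_int_power2[OF False])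
        have "1 * exp (- (141/100 * (N - 1))) \<le> N * exp (- (141/100 * (N - 1)))" using N1 by (intro mult_right_mono) auto
        also have "\<dots> \<le> uwt (nat \<bar>n\<bar>)" using uwt_bound_sq[OF n1, of "141/100"] by (simp add: N_def)
        finally have 1: "exp (- (141/100 * (N - 1))) \<le> uwt (nat \<bar>n\<bar>)" by simp
        have 2: "exp (- (141/100)) \<le> (1/4 :: real)" by (rule exp_minus_le[of "41/100" _ 1]) (simp_all add: power2_eq_square)
        have "exp (- (141/100 * N)) = exp (- (141/100)) * exp (- (141/100 * (N - 1)))" unfolding exp_add[symmetric] by (simp add: field_simps)
        also have "\<dots> \<le> 1/4 * uwt (nat \<bar>n\<bar>)" by (intro mult_mono 1 2) auto
        finally show ?thesis using False by (simp add: N_def)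
      qed (simp add: uwt_def)
    qed (auto simp: uwt_nonneg)
    finally show ?thesis .
  qed
  finally have "nu w * Y \<le> nu p * ((29/100 * uwt (nat \<bar>m\<bar>)) * (of_bool (n = 0) + 1/4 * uwt (nat \<bar>n\<bar>)))"
    using n0 by (simp add: mult_left_mono)
  then show ?thesis by (simp add: w_def A_def Y_def M_def mult_ac)
qed

text \<open>For \<open>m = 0\<close> no term increases with \<open>y\<close>, and those with
  \<open>n = 1\<close> and \<open>n = -1\<close> each lose \<open>\<delta>\<close>. For
  \<open>m \<noteq> 0\<close> only the growing part \<open>m\<^sup>2 * t\<close> of the exponent is
  harmful, and its effect is bounded by a multiple of the loss of the dominant terms.\<close>

theorem ntheta'_half_antimono_gauss:
  assumes s: "s > 0" and y: "13/10 \<le> y1" "y1 \<le> y2" "y2 / s \<le> 6/10"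
  shows "ntheta' s (1/2) y2 \<le> ntheta' s (1/2) y1"
proof -
  define w where "w m n y = pi * s * quad (1/2) y m n" for m n y
  define p where "p y = pi * s / y" for y
  define f where "f m n = energy (w m n y2) - energy (w m n y1)" for m n
  define \<delta> where "\<delta> = energy (p y2) - energy (p y1)"
  have y0: "y1 > 0" "y2 > 0" using y by auto
  have pb: "5233/1000 \<le> p t" if "y1 \<le> t" "t \<le> y2" for t
  proof -
    have t0: "t > 0" using that y0 by simp
    have "t / s \<le> 6/10" using divide_right_mono[OF that(2), of s] s y(3) by linarith
    then have "10/6 \<le> s / t" using t0 s by (simp add: field_simps)
    then have "3.14 * (10/6) \<le> pi * (s / t)" using pi_gt_314 by (intro mult_mono) auto
    then show ?thesis by (simp add: p_def)
  qed
  have p21: "p y2 \<le> p y1" unfolding p_def using y y0 s by (intro divide_left_mono) auto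
  have \<delta>: "0 \<le> \<delta>" unfolding \<delta>_def using energy_antimono[OF _ p21] pb[of y2] y by simp
  have hs: "((\<lambda>(m,n). - energy (w m n t)) has_sum ntheta' s (1/2) t / sqrt s) UNIV" if "t > 0" for t
  proof -
    have "((\<lambda>(m,n). (1/2 - pi * s * quad (1/2) t m n) * exp (- (pi * s * quad (1/2) t m n))) has_sum ntheta' s (1/2) t / sqrt s) UNIV"
      using summable_ntheta'[OF s that, of "1/2"] s by (simp add: ntheta'_def has_sum_infsum)
    moreover have "(1/2 - pi * s * quad (1/2) t m n) * exp (- (pi * s * quad (1/2) t m n)) = - energy (w m n t)" for m n
      by (simp add: energy_def w_def left_diff_distrib)
    ultimately show ?thesis by simp
  qed
  have F: "((\<lambda>(m,n). f m n) has_sum (ntheta' s (1/2) y1 / sqrt s + - (ntheta' s (1/2) y2 / sqrt s))) UNIV"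
    using has_sum_add[OF hs[OF y0(1)] has_sum_uminusI[OF hs[OF y0(2)]]]
    by (simp add: f_def case_prod_unfold)
  \<comment> \<open>The sum is \<open>2 - 29/100 * 14/5 * (1 + 1/4 * 14/5) = 6196/10000\<close>, so
    the two dominant terms pay for everything else.\<close>
  define L where "L m n = of_bool (m = 0 \<and> (n = 1 \<or> n = -1)) - 29/100 * uwt (nat \<bar>m\<bar>) * (of_bool (n = 0) + 1/4 * uwt (nat \<bar>n\<bar>))" for m n :: int
  have L: "((\<lambda>(m,n). L m n) has_sum (6196/10000)) UNIV"
  proof -
    have 1: "((\<lambda>(m::int,n::int). of_bool (m = 0 \<and> (n = 1 \<or> n = -1))) has_sum (2::real)) UNIV"
      by (rule has_sum_finite_neutralI[of "{(0,1),(0,-1)}"]) auto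
    have 2: "((\<lambda>m::int. 29/100 * uwt (nat \<bar>m\<bar>)) has_sum (29/100 * (14/5))) UNIV"
      by (intro has_sum_cmult_right has_sum_uwt)
    have 3: "((\<lambda>n::int. of_bool (n = 0) + 1/4 * uwt (nat \<bar>n\<bar>)) has_sum (1 + 1/4 * (14/5))) UNIV"
      by (intro has_sum_add has_sum_cmult_right has_sum_uwt has_sum_finite_neutralI[of "{0}"]) auto
    have "((\<lambda>(m::int,n::int). (29/100 * uwt (nat \<bar>m\<bar>)) * (of_bool (n = 0) + 1/4 * uwt (nat \<bar>n\<bar>))) has_sum (13804/10000)) UNIV"
    proof -
      note P = summable_on_product[of "\<lambda>m::int. 29/100 * uwt (nat \<bar>m\<bar>)" "\<lambda>n::int. of_bool (n = 0) + 1/4 * uwt (nat \<bar>n\<bar>)",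
          OF has_sum_imp_summable[OF 2] has_sum_imp_summable[OF 3]]
      have "13804/10000 = 29/100 * (14/5) * (1 + 1/4 * (14/5) :: real)" by simp
      then show ?thesis using P infsumI[OF 2] infsumI[OF 3] uwt_nonneg by (simp only: has_sum_iff mult_nonneg_nonneg add_nonneg_nonneg) auto
    qed
    from has_sum_add[OF 1 has_sum_uminusI[OF this]] show ?thesis by (simp add: L_def case_prod_unfold)
  qed
  have key: "\<delta> * L m n \<le> f m n" for m n :: int
  proof (cases "m = 0")
    case True
    have w0: "w 0 n t = p t * (of_int n)\<^sup>2" for n t by (simp add: w_def p_def quad_def)
    consider "n = 0" | "n = 1 \<or> n = -1" | "2 \<le> \<bar>n\<bar>" by linarith
    then show ?thesis
    proof cases
      case 1 then show ?thesis by (simp add: True L_def f_def w0 uwt_def)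
    next
      case 2 then show ?thesis by (auto simp: True L_def f_def w0 uwt_def \<delta>_def)
    next
      case 3
      then have n1: "1 \<le> (of_int n :: real)\<^sup>2" by (simp add: abs_le_square_iff[symmetric, of 1, simplified])
      have "energy (w 0 n y1) \<le> energy (w 0 n y2)"
        unfolding w0
      proof (rule energy_antimono)
        have "5233/1000 * 1 \<le> p y2 * (of_int n)\<^sup>2" using pb[of y2] y n1 by (intro mult_mono) auto
        then show "3/2 \<le> p y2 * (of_int n)\<^sup>2" by simp
        show "p y2 * (of_int n)\<^sup>2 \<le> p y1 * (of_int n)\<^sup>2" using p21 by (intro mult_right_mono) auto
      qed
      moreover have "L 0 n = 0" using 3 by (auto simp: L_def uwt_def)
      ultimately show ?thesis by (simp add: True f_def)
    qed
  next
    case False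
    define \<epsilon> where "\<epsilon> = 29/100 * uwt (nat \<bar>m\<bar>) * (of_bool (n = 0) + 1/4 * uwt (nat \<bar>n\<bar>))"
    define A where "A = (of_int m / 2 + of_int n :: real)\<^sup>2"
    have we: "w m n t = pi * s * ((of_int m)\<^sup>2 * t + A / t)" if "t > 0" for t
      using that by (simp add: w_def quad_def A_def power2_eq_square add_divide_distrib)
    have "energy (w m n y1) + \<epsilon> * energy (p y1) \<le> energy (w m n y2) + \<epsilon> * energy (p y2)"
    proof -
      have "energy (pi * s * ((of_int m)\<^sup>2 * y1 + A / y1)) + \<epsilon> * energy (p y1) \<le> energy (pi * s * ((of_int m)\<^sup>2 * y2 + A / y2)) + \<epsilon> * energy (p y2)"
      proof (rule DERIV_nonneg_imp_nondecreasing[OF y(2), of "\<lambda>t. energy (pi * s * ((of_int m)\<^sup>2 * t + A / t)) + \<epsilon> * energy (p t)"])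
        fix t assume t: "y1 \<le> t" "t \<le> y2"
        have t0: "t > 0" using t y0 by simp
        let ?w = "pi * s * ((of_int m)\<^sup>2 * t + A / t)"
        have dw: "((\<lambda>t. pi * s * ((of_int m)\<^sup>2 * t + A / t)) has_real_derivative pi * s * ((of_int m)\<^sup>2 - A / t\<^sup>2)) (at t)"
          using t0 by (auto intro!: derivative_eq_intros simp: power2_eq_square)
        have dp: "(p has_real_derivative - (pi * s / t\<^sup>2)) (at t)"
          unfolding p_def using t0 by (auto intro!: derivative_eq_intros simp: power2_eq_square)
        have D: "((\<lambda>t. energy (pi * s * ((of_int m)\<^sup>2 * t + A / t)) + \<epsilon> * energy (p t)) has_real_derivative
          (- nu ?w * (pi * s * ((of_int m)\<^sup>2 - A / t\<^sup>2)) + \<epsilon> * (- nu (p t) * - (pi * s / t\<^sup>2)))) (at t)"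
          by (intro DERIV_add DERIV_cmult DERIV_chain2[OF energy_deriv dw] DERIV_chain2[OF energy_deriv dp])
        have wp: "?w = p t * (A + (of_int m)\<^sup>2 * t\<^sup>2)" using t0 by (simp add: p_def power2_eq_square field_simps)
        have "13/10 \<le> t" using t y by simp
        from far_gauss_weight[OF pb[OF t] this False, of n] have b: "nu ?w * ((of_int m)\<^sup>2 * t\<^sup>2) \<le> \<epsilon> * nu (p t)"
          unfolding wp unfolding A_def \<epsilon>_def .
        have nw: "0 \<le> nu ?w"
        proof -
          have "5233/1000 * 1 \<le> p t * (A + (of_int m)\<^sup>2 * t\<^sup>2)"
          proof (intro mult_mono pb[OF t])
            have "1 * 1 \<le> (of_int m)\<^sup>2 * t\<^sup>2"
              using one_le_of_int_power2[OF False] t y by (intro mult_mono) (auto simp: one_le_power)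
            then show "1 \<le> A + (of_int m)\<^sup>2 * t\<^sup>2" by (simp add: A_def add_nonneg_pos add_increasing)
          qed (use pb[OF t] in auto)
          then show ?thesis unfolding wp nu_def by (intro mult_nonneg_nonneg) auto
        qed
        have "0 \<le> pi * s / t\<^sup>2 * (\<epsilon> * nu (p t) - nu ?w * ((of_int m)\<^sup>2 * t\<^sup>2) + nu ?w * A)"
          using b nw s by (intro mult_nonneg_nonneg add_nonneg_nonneg) (auto simp: A_def)
        also have "\<dots> = - nu ?w * (pi * s * ((of_int m)\<^sup>2 - A / t\<^sup>2)) + \<epsilon> * (- nu (p t) * - (pi * s / t\<^sup>2))"
          using t0 by (simp add: field_simps)
        finally show "\<exists>D. ((\<lambda>t. energy (pi * s * ((of_int m)\<^sup>2 * t + A / t)) + \<epsilon> * energy (p t)) has_real_derivative D) (at t) \<and> 0 \<le> D"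
          using D by blast
      qed
      then show ?thesis using we[OF y0(1)] we[OF y0(2)] by simp
    qed
    moreover have "L m n = - \<epsilon>" using False by (simp add: L_def \<epsilon>_def)
    ultimately show ?thesis by (simp add: f_def \<delta>_def algebra_simps)
  qed
  have "\<delta> * (6196/10000) \<le> ntheta' s (1/2) y1 / sqrt s + - (ntheta' s (1/2) y2 / sqrt s)"
    by (rule has_sum_mono[OF has_sum_cmult_right[OF L, of \<delta>] F]) (use key in auto)
  then have "ntheta' s (1/2) y2 / sqrt s \<le> ntheta' s (1/2) y1 / sqrt s" using \<delta> by linarith
  then show ?thesis using s by (simp add: divide_le_cancel)
qed

text \<open>For fixed \<open>s\<close> the heights may lie on both sides of \<open>6/10 * s\<close>;
  the two regimes are chained at that point.\<close>

corollary ntheta'_half_antimono: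
  assumes s: "s > 1" and y: "13/10 \<le> y1" "y1 \<le> y2"
  shows "ntheta' s (1/2) y2 \<le> ntheta' s (1/2) y1"
proof -
  have F: "ntheta' s (1/2) u2 \<le> ntheta' s (1/2) u1" if "13/10 \<le> u1" "u1 \<le> u2" "6/10 * s \<le> u1" for u1 u2
    using ntheta'_half_antimono_fourier[OF s that(1), of u2] that s by (cases "u1 = u2") (auto simp: field_simps)
  have G: "ntheta' s (1/2) u2 \<le> ntheta' s (1/2) u1" if "13/10 \<le> u1" "u1 \<le> u2" "u2 \<le> 6/10 * s" for u1 u2
    using ntheta'_half_antimono_gauss[OF _ that(1,2)] that s by (auto simp: field_simps)
  consider "6/10 * s \<le> y1" | "y2 \<le> 6/10 * s" | "y1 \<le> 6/10 * s" "6/10 * s \<le> y2" by linarith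
  then show ?thesis
  proof cases
    case 3
    then show ?thesis using F[of "6/10 * s" y2] G[of y1 "6/10 * s"] y by simp
  qed (use F G y in auto)
qed

section \<open>The modular group\<close>

lemma of_int_times_plus: "of_int m * z + of_int n = Complex (of_int m * Re z + of_int n) (of_int m * Im z)"
  by (simp add: complex_eq_iff)

lemma theta_conv_ntheta:
  assumes "s > 0"
  shows "theta s z = ntheta s (Re z) (Im z) / sqrt s"
proof -
  have "- pi * s * ((cmod (of_int m * z + of_int n))\<^sup>2 / Im z) = - (pi * s * quad (Re z) (Im z) m n)" for m n
    by (simp add: cmod_power2 quad_def)
  then show ?thesis using assms by (simp add: theta_def ntheta_def)
qed

lemma SL2Z_iff: "A \<in> SL2Z \<longleftrightarrow> A $ 1 $ 1 * A $ 2 $ 2 - A $ 1 $ 2 * A $ 2 $ 1 = 1"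
  by (simp add: SL2Z_def det_2)

lemma moebius_denom_nonzero:
  assumes "A \<in> SL2Z" "Im z > 0"
  shows "of_int (A $ 2 $ 1) * z + of_int (A $ 2 $ 2) \<noteq> 0"
  using assms by (auto simp: SL2Z_iff of_int_times_plus complex_eq_iff)

lemma Im_moebius_act:
  assumes "A \<in> SL2Z" "Im z > 0"
  shows "Im (moebius_act A z) = Im z / (cmod (of_int (A $ 2 $ 1) * z + of_int (A $ 2 $ 2)))\<^sup>2" "Im (moebius_act A z) > 0"
proof -
  define a b c d where "a = (of_int (A $ 1 $ 1) :: real)" and "b = (of_int (A $ 1 $ 2) :: real)"
    and "c = (of_int (A $ 2 $ 1) :: real)" and "d = (of_int (A $ 2 $ 2) :: real)"
  have det: "a * d - b * c = 1" using assms(1) unfolding SL2Z_iff a_def b_def c_def d_def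
    by (simp flip: of_int_mult of_int_diff)
  have num: "a * Im z * (c * Re z + d) - (a * Re z + b) * (c * Im z) = Im z * (a * d - b * c)" by algebra
  show I: "Im (moebius_act A z) = Im z / (cmod (of_int (A $ 2 $ 1) * z + of_int (A $ 2 $ 2)))\<^sup>2"
    unfolding moebius_act_def of_int_times_plus Im_divide cmod_power2 complex.sel
    using num[unfolded det] by (simp add: a_def b_def c_def d_def)
  show "Im (moebius_act A z) > 0" unfolding I using moebius_denom_nonzero[OF assms] assms(2) by simp
qed

lemma moebius_act_compose:
  assumes "B \<in> SL2Z" "Im z > 0"
  shows "moebius_act A (moebius_act B z) = moebius_act (A ** B) z"
  using moebius_denom_nonzero[OF assms]
  by (simp add: moebius_act_def matrix_matrix_mult_def sum_2 add_frac_eq divide_simps) (simp add: algebra_simps)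

lemma SL2Z_mult: "A \<in> SL2Z \<Longrightarrow> B \<in> SL2Z \<Longrightarrow> A ** B \<in> SL2Z"
  by (simp add: SL2Z_def det_mul)

lemma moebius_act_inverse:
  assumes "A \<in> SL2Z" "Im z > 0"
  obtains B where "B \<in> SL2Z" "moebius_act B (moebius_act A z) = z"
proof
  let ?B = "vector [vector [A $ 2 $ 2, - A $ 1 $ 2], vector [- A $ 2 $ 1, A $ 1 $ 1]] :: int ^ 2 ^ 2"
  have BA: "?B ** A = mat 1" using assms(1)
    by (simp add: SL2Z_iff vec_eq_iff forall_2 matrix_matrix_mult_def sum_2 mat_def algebra_simps)
  show "?B \<in> SL2Z" using assms(1) by (simp add: SL2Z_iff algebra_simps)
  show "moebius_act ?B (moebius_act A z) = z"
    unfolding moebius_act_compose[OF assms] BA by (simp add: moebius_act_def mat_def)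
qed

text \<open>Clearing the denominator expresses the quadratic form at the image through the form at
  \<open>z\<close> with indices transformed by \<open>A\<close>, a bijection of the index lattice
  because the determinant is 1.\<close>

lemma theta_moebius_act:
  assumes A: "A \<in> SL2Z" and z: "Im z > 0"
  shows "theta s (moebius_act A z) = theta s z"
proof -
  define a b c d where "a = A $ 1 $ 1" and "b = A $ 1 $ 2" and "c = A $ 2 $ 1" and "d = A $ 2 $ 2"
  have det: "a * d - b * c = 1" using A by (simp add: SL2Z_iff a_def b_def c_def d_def)
  define D where "D = of_int c * z + of_int d"
  have D: "D \<noteq> 0" using moebius_denom_nonzero[OF A z] by (simp add: D_def c_def d_def)
  have I: "Im (moebius_act A z) = Im z / (cmod D)\<^sup>2" using Im_moebius_act(1)[OF A z] by (simp add: D_def c_def d_def)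
  have q: "(cmod (of_int m * moebius_act A z + of_int n))\<^sup>2 / Im (moebius_act A z)
     = (cmod (of_int (m * a + n * c) * z + of_int (m * b + n * d)))\<^sup>2 / Im z" for m n
  proof -
    have "moebius_act A z = (of_int a * z + of_int b) / D" by (simp add: moebius_act_def D_def a_def b_def c_def d_def)
    moreover have "u * (X / D) + v = (u * X + v * D) / D" for u v X using D by (simp add: field_simps)
    ultimately have "of_int m * moebius_act A z + of_int n = (of_int m * (of_int a * z + of_int b) + of_int n * D) / D"
      by simp
    also have "of_int m * (of_int a * z + of_int b) + of_int n * D = of_int (m * a + n * c) * z + of_int (m * b + n * d)"
      by (simp add: D_def algebra_simps)
    finally show ?thesis using D unfolding I by (simp add: norm_divide power_divide)
  qed
  have e1: "m * a * d - m * b * c = m" "n * a * d - n * b * c = n" for m n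
    using det by (metis mult.assoc mult.right_neutral right_diff_distrib)+
  let ?f = "\<lambda>(m, n). exp (- pi * s * ((cmod (of_int m * z + of_int n))\<^sup>2 / Im z))"
  have "theta s (moebius_act A z) = (\<Sum>\<^sub>\<infinity>(m, n). ?f (m * a + n * c, m * b + n * d))"
    unfolding theta_def q by simp
  also have "\<dots> = theta s z"
    unfolding theta_def
    by (rule infsum_reindex_bij_witness[where i = "\<lambda>(p,q). (p * d - q * c, q * a - p * b)" and j = "\<lambda>(m,n). (m * a + n * c, m * b + n * d)"])
       (use e1 in \<open>auto simp: algebra_simps\<close>)
  finally show ?thesis .
qed

lemma ntheta_moebius_act:
  assumes "A \<in> SL2Z" "Im z > 0" "s > 0"
  shows "ntheta s (Re (moebius_act A z)) (Im (moebius_act A z)) = ntheta s (Re z) (Im z)"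
  using theta_moebius_act[OF assms(1,2), of s] assms(3) by (simp add: theta_conv_ntheta)

lemma ntheta_translate:
  assumes "y > 0" "s > 0" shows "ntheta s (x + 1) y = ntheta s x y"
  using ntheta_moebius_act[of "vector [vector [1, 1], vector [0, 1]]" "Complex x y" s] assms
  by (simp add: SL2Z_iff moebius_act_def)

section \<open>Representatives in the fundamental domain\<close>

lemma finite_quad_le:
  assumes "y > 0" shows "finite {(m, n). quad x y m n \<le> C}"
proof -
  obtain \<kappa> where k: "\<kappa> > 0" "\<And>m n. \<kappa> * ((of_int m)\<^sup>2 + (of_int n)\<^sup>2) \<le> quad x y m n"
    by (rule quad_lower[of y y x]) (use assms in \<open>auto intro: that\<close>)
  define K where "K = \<lfloor>C / \<kappa>\<rfloor>"
  have "(m, n) \<in> {-K..K} \<times> {-K..K}" if "quad x y m n \<le> C" for m n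
  proof -
    from that have "\<kappa> * ((of_int m)\<^sup>2 + (of_int n)\<^sup>2) \<le> C" using k(2)[of m n] by linarith
    then have "of_int (m\<^sup>2 + n\<^sup>2) \<le> C / \<kappa>" using k(1) by (simp add: field_simps)
    then have *: "m\<^sup>2 + n\<^sup>2 \<le> K" by (simp add: K_def le_floor_iff)
    have "\<bar>i\<bar> \<le> i\<^sup>2" for i :: int using self_le_power[of "\<bar>i\<bar>" 2] by (cases "i = 0") auto
    then have "\<bar>m\<bar> \<le> m\<^sup>2" "\<bar>n\<bar> \<le> n\<^sup>2" by blast+
    then have "\<bar>m\<bar> \<le> K" "\<bar>n\<bar> \<le> K" using * by linarith+
    then show ?thesis by (simp add: abs_le_iff)
  qed
  then have "{(m, n). quad x y m n \<le> C} \<subseteq> {-K..K} \<times> {-K..K}" by blast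
  then show ?thesis by (rule finite_subset) simp
qed

text \<open>Minimising \<open>quad\<close> over all bottom rows maximises the height of the image.
  Only finitely many rows do at least as well as \<open>(0, 1)\<close>, so a minimum exists; the top
  row is then adjusted by the translation \<open>k\<close>.\<close>

lemma SL2Z_representative:
  assumes z: "Im z > 0"
  obtains A where "A \<in> SL2Z" "\<bar>Re (moebius_act A z)\<bar> \<le> 1 / 2" "1 \<le> cmod (moebius_act A z)"
proof -
  define N where "N c d = quad (Re z) (Im z) c d" for c d
  define R where "R = {(c, d). (\<exists>a b. a * d - b * c = (1::int)) \<and> N c d \<le> N 0 1}"
  have "finite R" unfolding R_def N_def by (rule finite_subset[OF _ finite_quad_le[OF z]]) auto
  moreover have "(0, 1) \<in> R" by (auto simp: R_def)
  ultimately obtain c d where cd: "(c, d) \<in> R" "\<And>c' d'. (c', d') \<in> R \<Longrightarrow> N c d \<le> N c' d'"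
    using ex_is_arg_min_if_finite[of R "\<lambda>(c,d). N c d"] unfolding is_arg_min_def by (auto simp: not_less)
  have min: "N c d \<le> N c' d'" if "a * d' - b * c' = 1" for a b c' d'
  proof (cases "N c' d' \<le> N 0 1")
    case True then show ?thesis using cd(2) that by (auto simp: R_def)
  next
    case False then show ?thesis using cd(1) by (auto simp: R_def)
  qed
  obtain a b where ab: "a * d - b * c = 1" using cd(1) by (auto simp: R_def)
  define D where "D = of_int c * z + of_int d"
  have N: "N m n = (cmod (of_int m * z + of_int n))\<^sup>2 / Im z" for m n
    by (simp add: N_def quad_def cmod_power2)
  define k where "k = - round (Re ((of_int a * z + of_int b) / D))"
  define A where "A = (vector [vector [a + k * c, b + k * d], vector [c, d]] :: int ^ 2 ^ 2)"
  have A: "A \<in> SL2Z" using ab by (simp add: A_def SL2Z_iff algebra_simps)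
  have D: "D \<noteq> 0" using moebius_denom_nonzero[OF A z] by (simp add: A_def D_def)
  have m: "moebius_act A z = (of_int (a + k * c) * z + of_int (b + k * d)) / D"
    by (simp add: A_def moebius_act_def D_def)
  have "of_int (a + k * c) * z + of_int (b + k * d) = (of_int a * z + of_int b) + of_int k * D"
    by (simp add: D_def algebra_simps)
  then have "moebius_act A z = (of_int a * z + of_int b) / D + of_int k"
    unfolding m using D by (simp only: add_divide_distrib nonzero_mult_div_cancel_right not_False_eq_True)
  then have 1: "\<bar>Re (moebius_act A z)\<bar> \<le> 1 / 2"
    using of_int_round_abs_le[of "Re ((of_int a * z + of_int b) / D)"] by (simp add: k_def abs_minus_commute)
  \<comment> \<open>The top row is itself the bottom row of a matrix of determinant 1 with
    \<open>- c\<close>, \<open>- d\<close> above it. This is the inversion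
    \<open>z \<mapsto> - 1 / z\<close>, and minimality makes the numerator at least as large as the
    denominator.\<close>
  have "N c d \<le> N (a + k * c) (b + k * d)"
    by (rule min[of "- c" _ "- d"]) (use ab in \<open>simp add: algebra_simps\<close>)
  then have "(cmod D)\<^sup>2 \<le> (cmod (of_int (a + k * c) * z + of_int (b + k * d)))\<^sup>2"
    using z unfolding N D_def by (simp add: divide_le_cancel)
  then have "cmod D \<le> cmod (of_int (a + k * c) * z + of_int (b + k * d))" by (rule power2_le_imp_le) simp
  then have 2: "1 \<le> cmod (moebius_act A z)" using D unfolding m norm_divide by simp
  show thesis using that[OF A 1 2] .
qed

section \<open>The maximum of the ratio\<close>

text \<open>Applied to the squares of integers and to the hexagonal form, both of which are at least
  1 off the origin.\<close>

lemma gauss_sum_le: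
  fixes q :: "'i \<Rightarrow> real"
  assumes s: "1 \<le> s" and q: "q i0 = 0" "\<And>i. i \<noteq> i0 \<Longrightarrow> 1 \<le> q i"
    and sum: "(\<lambda>i. exp (- (pi * q i))) summable_on UNIV" "(\<lambda>i. exp (- (pi * s * q i))) summable_on UNIV"
  shows "(\<Sum>\<^sub>\<infinity>i. exp (- (pi * s * q i))) \<le> 1 + exp (- (pi * (s - 1))) * (\<Sum>\<^sub>\<infinity>i. exp (- (pi * q i)))"
proof (rule has_sum_mono[OF has_sum_infsum[OF sum(2)]])
  show "((\<lambda>i. of_bool (i = i0) + exp (- (pi * (s - 1))) * exp (- (pi * q i))) has_sum
      (1 + exp (- (pi * (s - 1))) * (\<Sum>\<^sub>\<infinity>i. exp (- (pi * q i))))) UNIV"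
    by (intro has_sum_add has_sum_cmult_right has_sum_infsum sum(1) has_sum_finite_neutralI[of "{i0}"]) auto
  fix i :: 'i
  show "exp (- (pi * s * q i)) \<le> of_bool (i = i0) + exp (- (pi * (s - 1))) * exp (- (pi * q i))"
  proof (cases "i = i0")
    case True then show ?thesis using q(1) by simp
  next
    case False
    have "pi * (s - 1) * 1 \<le> pi * (s - 1) * q i" using s by (intro mult_left_mono q(2)[OF False]) auto
    then have "- (pi * s * q i) \<le> - (pi * (s - 1)) + - (pi * q i)" by (simp add: algebra_simps)
    then have "exp (- (pi * s * q i)) \<le> exp (- (pi * (s - 1)) + - (pi * q i))" by simp
    then show ?thesis using False unfolding exp_add by simp
  qed
qed

lemma exp_minus_pi_le:
  assumes "1 \<le> s" shows "exp (- (pi * (s - 1))) \<le> 1 / s\<^sup>2"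
proof -
  have "s\<^sup>2 \<le> (exp (s - 1))\<^sup>2" using exp_ge_add_one_self[of "s - 1"] assms by (intro power_mono) auto
  also have "\<dots> = exp (2 * (s - 1))" by (simp only: exp_double)
  also have "\<dots> \<le> exp (pi * (s - 1))" using assms pi_gt3 by (intro iffD2[OF exp_le_cancel_iff] mult_right_mono) auto
  finally show ?thesis using assms unfolding exp_minus by (simp add: field_simps)
qed

lemma th0_le:
  assumes "0 < T" "T \<le> 1" shows "th T 0 \<le> 1 + T * th 1 0"
proof -
  have "th T 0 = (\<Sum>\<^sub>\<infinity>k::int. exp (- (pi * (1 / T) * (of_int k)\<^sup>2)))" by (simp add: th_def)
  also have "\<dots> \<le> 1 + exp (- (pi * (1 / T - 1))) * (\<Sum>\<^sub>\<infinity>k::int. exp (- (pi * (of_int k)\<^sup>2)))"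
  proof (rule gauss_sum_le[of _ _ 0])
    show "1 \<le> (of_int k :: real)\<^sup>2" if "k \<noteq> 0" for k by (rule one_le_of_int_power2[OF that])
  qed (use assms th_has_sum[of T 0] th_has_sum[of 1 0] in \<open>simp_all add: has_sum_iff\<close>)
  also have "(\<Sum>\<^sub>\<infinity>k::int. exp (- (pi * (of_int k)\<^sup>2))) = th 1 0" by (simp add: th_def)
  also have "exp (- (pi * (1 / T - 1))) * th 1 0 \<le> T * th 1 0"
  proof (rule mult_right_mono)
    have "exp (- (pi * (1 / T - 1))) \<le> T\<^sup>2" using exp_minus_pi_le[of "1 / T"] assms by (simp add: power_divide)
    also have "\<dots> \<le> T" using assms by (simp add: power2_eq_square mult_left_le)
    finally show "exp (- (pi * (1 / T - 1))) \<le> T" .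
  qed (use th0_pos[of 1] in auto)
  finally show ?thesis by simp
qed

section \<open>Behaviour at the cusp\<close>

lemma ntheta_0: "s > 0 \<Longrightarrow> y > 0 \<Longrightarrow> ntheta s 0 y = sqrt y * (th (1 / (s * y)) 0 * th (s / y) 0)"
proof -
  assume s: "s > 0" and y: "y > 0"
  have "((\<lambda>m::int. exp (- pi * s * y * (of_int m)\<^sup>2) * th (s / y) 0) has_sum th (1 / (s * y)) 0 * th (s / y) 0) UNIV"
    using has_sum_cmult_left[OF th_has_sum[of "1 / (s * y)" 0], of "th (s / y) 0"] s y by (simp add: mult_ac)
  from has_sum_unique[OF this] ntheta_slices(1)[OF s y, of 0] s y show ?thesis by (simp add: field_simps)
qed

text \<open>Along the imaginary axis \<open>ntheta s 0 y / sqrt y\<close> is a product of two values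
  of \<open>th\<close> whose parameters tend to 0, hence it tends to 1. The numerator is bounded
  above by \<open>th0_le\<close>, while \<open>th \<ge> 1\<close> suffices for the
  denominator.\<close>

lemma ntheta_ratio_near_1:
  assumes "\<alpha> > 0" "\<beta> > 0" "c > 1"
  obtains y where "y > 0" "ntheta \<beta> 0 y / ntheta \<alpha> 0 y < c"
proof -
  define f where "f y = (1 + 1 / (\<beta> * y) * th 1 0) * (1 + \<beta> / y * th 1 0)" for y
  have "(f \<longlongrightarrow> (1 + 0 * th 1 0) * (1 + 0 * th 1 0)) at_top"
    unfolding f_def
    by (intro tendsto_intros tendsto_divide_0[OF tendsto_const] filterlim_at_top_imp_at_infinity
          filterlim_tendsto_pos_mult_at_top[OF tendsto_const assms(2)] filterlim_ident)
  then have "eventually (\<lambda>y. f y < c) at_top" using assms(3) by (auto dest: order_tendstoD)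
  then have "eventually (\<lambda>y. f y < c \<and> y \<ge> max \<beta> (1 / \<beta>)) at_top" using eventually_ge_at_top eventually_conj by blast
  then obtain y where y: "f y < c" "\<beta> \<le> y" "1 / \<beta> \<le> y" by (auto simp: eventually_at_top_linorder)
  have y0: "y > 0" using y assms by linarith
  have "ntheta \<beta> 0 y \<le> sqrt y * f y"
    unfolding ntheta_0[OF assms(2) y0] f_def using y y0 assms th0_pos[of "\<beta> / y"] th0_pos[of "1/(\<beta> * y)"] th0_pos[of 1]
    by (intro mult_left_mono mult_mono th0_le) (auto simp: field_simps)
  moreover have "sqrt y * 1 \<le> ntheta \<alpha> 0 y"
    unfolding ntheta_0[OF assms(1) y0] using y0 assms th0_pos[of "\<alpha> / y"] th0_pos[of "1/(\<alpha> * y)"]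
    by (intro mult_left_mono) (auto intro: mult_ge1_I)
  moreover have "0 \<le> f y" using y0 assms th0_pos[of 1] by (simp add: f_def)
  ultimately have "ntheta \<beta> 0 y / ntheta \<alpha> 0 y \<le> (sqrt y * f y) / (sqrt y * 1)" using y0 by (intro frac_le) auto
  then show thesis using that[OF y0] y y0 by simp
qed

lemma ntheta_pos: "s > 0 \<Longrightarrow> y > 0 \<Longrightarrow> sqrt s \<le> ntheta s x y"
proof -
  assume s: "s > 0" and y: "y > 0"
  have "((\<lambda>(m,n). exp (- (pi * s * quad x y m n))) has_sum (\<Sum>\<^sub>\<infinity>(m,n). exp (- (pi * s * quad x y m n)))) UNIV"
    using summable_exp_quad[of "pi * s" y x] s y by (simp add: has_sum_infsum)
  then have "1 \<le> (\<Sum>\<^sub>\<infinity>(m,n). exp (- (pi * s * quad x y m n)))"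
    by (rule has_sum_mono[OF has_sum_finite_neutralI[of "{(0,0)}" UNIV "\<lambda>i. of_bool (i = (0::int,0::int)) :: real" 1], rotated 4])
       (auto simp: quad_def)
  then show ?thesis using s by (simp add: ntheta_def)
qed

section \<open>The hexagonal point for large parameters\<close>

text \<open>Multiplied by \<open>sqrt 3 / 2\<close>, which is at most 1, the form takes the integer
  values \<open>m\<^sup>2 + m * n + n\<^sup>2\<close>.\<close>

lemma hexagonal_quad_ge_1:
  assumes "(m, n) \<noteq> (0, 0)" shows "1 \<le> quad (1/2) (sqrt 3 / 2) m n"
proof -
  have "0 < (2 * n + m)\<^sup>2 + 3 * m\<^sup>2" using assms by (cases "m = 0") (auto intro: add_nonneg_pos)
  moreover have "(2 * n + m)\<^sup>2 + 3 * m\<^sup>2 = 4 * (m\<^sup>2 + m * n + n\<^sup>2)" by algebra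
  ultimately have "0 < 4 * (m\<^sup>2 + m * n + n\<^sup>2)" by (simp only:)
  moreover have "0 < 4 * k \<Longrightarrow> 1 \<le> k" for k :: int by simp
  ultimately have "1 \<le> m\<^sup>2 + m * n + n\<^sup>2" by blast
  then have "1 \<le> (of_int (m\<^sup>2 + m * n + n\<^sup>2) :: real)" by (simp only: of_int_1_le_iff)
  also have "\<dots> = (of_int m * (1/2) + of_int n)\<^sup>2 + (of_int m * (sqrt 3 / 2))\<^sup>2"
    by (simp add: power_mult_distrib power_divide power2_eq_square algebra_simps)
  finally have 1: "1 \<le> (of_int m * (1/2) + of_int n)\<^sup>2 + (of_int m * (sqrt 3 / 2))\<^sup>2" .
  have "sqrt 3 / 2 \<le> 1" by (rule power2_le_imp_le) (auto simp: power_divide)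
  with 1 have "sqrt 3 / 2 \<le> (of_int m * (1/2) + of_int n)\<^sup>2 + (of_int m * (sqrt 3 / 2))\<^sup>2" by linarith
  then show ?thesis by (simp add: quad_def le_divide_eq)
qed

text \<open>The origin of the lattice forces the value \<open>sqrt s\<close> at every point. The
  essential information is that the excess over it tends to 0 as \<open>s\<close> grows.\<close>

lemma ntheta_hexagonal_le:
  assumes "1 \<le> s"
  shows "ntheta s (1/2) (sqrt 3 / 2) \<le> sqrt s + ntheta 1 (1/2) (sqrt 3 / 2) / s"
proof -
  let ?q = "\<lambda>(m,n). quad (1/2) (sqrt 3 / 2) m n"
  have "(\<Sum>\<^sub>\<infinity>i. exp (- (pi * s * ?q i))) \<le> 1 + exp (- (pi * (s - 1))) * (\<Sum>\<^sub>\<infinity>i. exp (- (pi * ?q i)))"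
  proof (rule gauss_sum_le[OF assms])
    show "?q (0, 0) = 0" by (simp add: quad_def)
    show "1 \<le> ?q i" if "i \<noteq> (0, 0)" for i using hexagonal_quad_ge_1[of "fst i" "snd i"] that by (cases i) simp
  qed (use assms summable_exp_quad[of pi "sqrt 3 / 2" "1/2"] summable_exp_quad[of "pi * s" "sqrt 3 / 2" "1/2"] in \<open>simp_all add: case_prod_unfold\<close>)
  also have "(\<Sum>\<^sub>\<infinity>i. exp (- (pi * ?q i))) = ntheta 1 (1/2) (sqrt 3 / 2)" by (simp add: ntheta_def case_prod_unfold)
  also have "exp (- (pi * (s - 1))) * ntheta 1 (1/2) (sqrt 3 / 2) \<le> 1 / s\<^sup>2 * ntheta 1 (1/2) (sqrt 3 / 2)"
    using ntheta_pos[of 1 "sqrt 3 / 2" "1/2"] by (intro mult_right_mono exp_minus_pi_le assms) auto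
  finally have "sqrt s * (\<Sum>\<^sub>\<infinity>i. exp (- (pi * s * ?q i))) \<le> sqrt s * (1 + 1 / s\<^sup>2 * ntheta 1 (1/2) (sqrt 3 / 2))"
    using assms by (intro mult_left_mono) auto
  also have "sqrt s * (\<Sum>\<^sub>\<infinity>i. exp (- (pi * s * ?q i))) = ntheta s (1/2) (sqrt 3 / 2)" by (simp add: ntheta_def case_prod_unfold)
  also have "sqrt s * (1 + 1 / s\<^sup>2 * ntheta 1 (1/2) (sqrt 3 / 2)) = sqrt s + sqrt s / s\<^sup>2 * ntheta 1 (1/2) (sqrt 3 / 2)"
    by (simp add: algebra_simps)
  also have "\<dots> \<le> sqrt s + 1 / s * ntheta 1 (1/2) (sqrt 3 / 2)"
  proof (intro add_left_mono mult_right_mono)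
    have "sqrt s \<le> s" using assms self_le_power[of s 2] by (intro real_le_lsqrt) auto
    then show "sqrt s / s\<^sup>2 \<le> 1 / s" using assms by (simp add: power2_eq_square divide_le_eq)
  qed (use ntheta_pos[of 1 "sqrt 3 / 2" "1/2"] in auto)
  finally show ?thesis by simp
qed

section \<open>Passage from the derivative to differences\<close>

text \<open>The mean value theorem takes the place of integration in \<open>s\<close>. Its
  intermediate point lies strictly above \<open>\<alpha>\<close>, so estimates for
  \<open>s > 1\<close> apply even when \<open>\<alpha> = 1\<close>.\<close>

lemma ntheta_diff_mean_value:
  assumes "1 \<le> \<alpha>" "\<alpha> < \<beta>" "y1 > 0" "y2 > 0"
  obtains s where "s > 1"
    "(ntheta \<beta> x2 y2 - ntheta \<alpha> x2 y2) - (ntheta \<beta> x1 y1 - ntheta \<alpha> x1 y1) = (\<beta> - \<alpha>) / s * (ntheta' s x2 y2 - ntheta' s x1 y1)"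
proof -
  have "\<exists>s. \<alpha> < s \<and> s < \<beta> \<and> (ntheta \<beta> x2 y2 - ntheta \<beta> x1 y1) - (ntheta \<alpha> x2 y2 - ntheta \<alpha> x1 y1)
      = (\<beta> - \<alpha>) * (ntheta' s x2 y2 / s - ntheta' s x1 y1 / s)"
    by (rule MVT2[OF assms(2)]) (use assms in \<open>auto intro!: DERIV_diff ntheta_has_derivative\<close>)
  then obtain s where s: "\<alpha> < s" "(ntheta \<beta> x2 y2 - ntheta \<beta> x1 y1) - (ntheta \<alpha> x2 y2 - ntheta \<alpha> x1 y1)
      = (\<beta> - \<alpha>) * (ntheta' s x2 y2 / s - ntheta' s x1 y1 / s)" by blast
  show thesis using that[of s] s assms by (simp add: diff_divide_distrib[symmetric])
qed

lemma ntheta_strict_mono: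
  assumes "1 \<le> \<alpha>" "\<alpha> < \<beta>" "y > 0" "3/4 \<le> y\<^sup>2" shows "ntheta \<alpha> x y < ntheta \<beta> x y"
proof -
  obtain s where s: "\<alpha> < s" "ntheta \<beta> x y - ntheta \<alpha> x y = (\<beta> - \<alpha>) * (ntheta' s x y / s)"
    using MVT2[OF assms(2), of "\<lambda>s. ntheta s x y" "\<lambda>s. ntheta' s x y / s"] ntheta_has_derivative assms by auto
  then have "0 < (\<beta> - \<alpha>) * (ntheta' s x y / s)" using ntheta'_pos[OF _ assms(3,4)] assms by simp
  then show ?thesis using s by linarith
qed

text \<open>Real parts between \<open>1/2\<close> and \<open>1\<close> are covered by the reflection
  \<open>x \<mapsto> 1 - x\<close>; they occur as images of the segment under
  \<open>z \<mapsto> 1 / (1 - z)\<close>.\<close>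

lemma ntheta_diff_less_half:
  assumes \<alpha>: "1 \<le> \<alpha>" "\<alpha> < \<beta>" and y: "2/3 \<le> y" and x: "0 \<le> x" "x \<le> 1" "x \<noteq> 1/2"
  shows "ntheta \<beta> x y - ntheta \<alpha> x y < ntheta \<beta> (1/2) y - ntheta \<alpha> (1/2) y"
proof -
  have L: "ntheta \<beta> x y - ntheta \<alpha> x y < ntheta \<beta> (1/2) y - ntheta \<alpha> (1/2) y" if x: "0 \<le> x" "x < 1/2" for x
  proof -
    have y0: "y > 0" using y by simp
    obtain s where s: "s > 1" "(ntheta \<beta> (1/2) y - ntheta \<alpha> (1/2) y) - (ntheta \<beta> x y - ntheta \<alpha> x y) = (\<beta> - \<alpha>) / s * (ntheta' s (1/2) y - ntheta' s x y)"
      by (rule ntheta_diff_mean_value[OF \<alpha> y0 y0])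
    have "0 < (\<beta> - \<alpha>) / s * (ntheta' s (1/2) y - ntheta' s x y)"
      using \<alpha> s(1) ntheta'_less_half[OF s(1) y x] by (intro mult_pos_pos) auto
    then show ?thesis using s(2) by linarith
  qed
  have "ntheta s (1 - x) y = ntheta s x y" if "s > 0" for s
    using ntheta_translate[of y s "- x"] ntheta_uminus_x[of s y x] that y by (simp add: add.commute)
  then show ?thesis using L[of x] L[of "1 - x"] x \<alpha> by (cases "x < 1/2") auto
qed

lemma ntheta_diff_half_antimono:
  assumes \<alpha>: "1 \<le> \<alpha>" "\<alpha> < \<beta>" and y: "13/10 \<le> y1" "y1 \<le> y2"
  shows "ntheta \<beta> (1/2) y2 - ntheta \<alpha> (1/2) y2 \<le> ntheta \<beta> (1/2) y1 - ntheta \<alpha> (1/2) y1"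
proof -
  obtain s where s: "s > 1" "(ntheta \<beta> (1/2) y1 - ntheta \<alpha> (1/2) y1) - (ntheta \<beta> (1/2) y2 - ntheta \<alpha> (1/2) y2) = (\<beta> - \<alpha>) / s * (ntheta' s (1/2) y1 - ntheta' s (1/2) y2)"
    by (rule ntheta_diff_mean_value[OF \<alpha>, of y2 y1]) (use y in auto)
  have "0 \<le> (\<beta> - \<alpha>) / s * (ntheta' s (1/2) y1 - ntheta' s (1/2) y2)"
    using \<alpha> s(1) ntheta'_half_antimono[OF s(1) y] by (intro mult_nonneg_nonneg) auto
  then show ?thesis using s(2) by linarith
qed

text \<open>For real part one half, \<open>1 - z\<close> is the complex conjugate of
  \<open>z\<close>, so \<open>1 / (1 - z)\<close> is \<open>z\<close> divided by its squared
  modulus.\<close>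

lemma ntheta_half_line_map:
  assumes "y > 0" "s > 0"
  shows "ntheta s ((1/2) / (1/4 + y\<^sup>2)) (y / (1/4 + y\<^sup>2)) = ntheta s (1/2) y"
proof -
  let ?A = "vector [vector [0, 1], vector [- 1, 1]] :: int ^ 2 ^ 2" and ?z = "Complex (1/2) y"
  have "moebius_act ?A ?z = Complex ((1/2) / (1/4 + y\<^sup>2)) (y / (1/4 + y\<^sup>2))"
    using assms by (simp add: moebius_act_def complex_eq_iff Re_divide Im_divide power2_eq_square)
  then show ?thesis using ntheta_moebius_act[of ?A ?z s] assms by (simp add: SL2Z_iff)
qed

text \<open>The map \<open>z \<mapsto> 1 / (1 - z)\<close> sends a point of the segment off the segment, but to a height that
  still belongs to it, so only its fixed point can maximise the difference on the segment.\<close>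

lemma ntheta_diff_half_less:
  assumes \<alpha>: "1 \<le> \<alpha>" "\<alpha> < \<beta>" and y: "2/3 \<le> y" "y \<noteq> sqrt 3 / 2"
  shows "ntheta \<beta> (1/2) y - ntheta \<alpha> (1/2) y < ntheta \<beta> (1/2) (sqrt 3 / 2) - ntheta \<alpha> (1/2) (sqrt 3 / 2)"
proof -
  define G where "G y = ntheta \<beta> (1/2) y - ntheta \<alpha> (1/2) y" for y
  have "continuous_on {2/3..13/10} G"
    unfolding G_def using \<alpha> by (intro continuous_at_imp_continuous_on ballI continuous_diff ntheta_continuous_y) auto
  then obtain u where u: "u \<in> {2/3..13/10}" "\<And>v. v \<in> {2/3..13/10} \<Longrightarrow> G v \<le> G u"
    using continuous_attains_sup[of "{2/3..13/10::real}" G] by auto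
  have eq: "v = sqrt 3 / 2" if v: "v \<in> {2/3..13/10}" "G v = G u" for v
  proof (rule ccontr)
    assume ne: "v \<noteq> sqrt 3 / 2"
    define X T where "X = (1/2) / (1/4 + v\<^sup>2)" and "T = v / (1/4 + v\<^sup>2)"
    have v0: "v > 0" and v13: "v \<le> 13/10" using v by auto
    have sq: "(2/3)\<^sup>2 \<le> v\<^sup>2" using v by (intro power_mono) auto
    \<comment> \<open>The image height \<open>v / (1/4 + v\<^sup>2)\<close> stays above
      \<open>2/3\<close> up to about \<open>v = 1.309\<close>. Membership of \<open>v\<close> in the
      segment supplies the upper bound for \<open>v\<^sup>2\<close> used to see this up to
      \<open>13/10\<close>.\<close>
    have "0 \<le> (v - 2/3) * (13/10 - v)" using v by simp
    also have "\<dots> = 59/30 * v - 26/30 - v\<^sup>2" by (simp add: field_simps power2_eq_square)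
    finally have "2/3 * (1/4 + v\<^sup>2) \<le> v" using v13 unfolding distrib_left by linarith
    then have T1: "2/3 \<le> T" using sq by (simp add: T_def pos_le_divide_eq add_pos_nonneg)
    have "0 \<le> (v - 4/10)\<^sup>2" by simp
    then have T2: "T \<le> 13/10" using v sq by (simp add: T_def field_simps power2_eq_square)
    have X: "0 \<le> X" "X \<le> 1" using sq by (simp_all add: X_def field_simps power2_eq_square)
    have "X \<noteq> 1/2"
    proof
      assume "X = 1/2"
      then have "v\<^sup>2 = 3/4" using sq by (simp add: X_def field_simps)
      then have "v = sqrt (3/4)" using v0 by (simp add: real_sqrt_unique)
      then show False using ne by (simp add: real_sqrt_divide)
    qed
    from ntheta_diff_less_half[OF \<alpha> T1 X this] have "ntheta \<beta> X T - ntheta \<alpha> X T < G T" by (simp add: G_def)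
    moreover have "ntheta s X T = ntheta s (1/2) v" if "s > 0" for s
      unfolding X_def T_def by (rule ntheta_half_line_map[OF v0 that])
    ultimately have "G v < G T" using \<alpha> by (simp add: G_def)
    with u(2)[of T] T1 T2 v(2) show False by simp
  qed
  have h: "sqrt 3 / 2 \<in> {2/3..13/10}" using eq u(1) by blast
  have lt: "G v < G (sqrt 3 / 2)" if "v \<in> {2/3..13/10}" "v \<noteq> sqrt 3 / 2" for v
    using u(2)[OF that(1)] eq[OF that(1)] that(2) eq[OF u(1)] by fastforce
  show ?thesis
  proof (cases "y \<le> 13/10")
    case True then show ?thesis using lt[of y] y by (simp add: G_def)
  next
    case False
    have "sqrt 3 / 2 < 1" by (simp add: real_less_lsqrt)
    then have "G (13/10) < G (sqrt 3 / 2)" by (intro lt) auto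
    moreover have "G y \<le> G (13/10)" unfolding G_def using False by (intro ntheta_diff_half_antimono \<alpha>) auto
    ultimately show ?thesis by (simp add: G_def)
  qed
qed

section \<open>Extremality in the fundamental domain\<close>

lemma fundamental_domain_Im:
  assumes "x\<^sup>2 + y\<^sup>2 \<ge> 1" "\<bar>x\<bar> \<le> 1/2" "y > 0" shows "3/4 \<le> y\<^sup>2" "2/3 \<le> (y :: real)"
proof -
  have "\<bar>x\<bar>\<^sup>2 \<le> (1/2)\<^sup>2" using assms by (intro power_mono) auto
  then show 1: "3/4 \<le> y\<^sup>2" using assms by (simp add: power_divide)
  show "2/3 \<le> y" by (rule power2_le_imp_le) (use 1 assms in \<open>auto simp: power_divide\<close>)
qed

lemma ntheta_diff_fundamental_domain:
  assumes \<alpha>: "1 \<le> \<alpha>" "\<alpha> < \<beta>" and z: "0 \<le> x" "x \<le> 1/2" "1 \<le> x\<^sup>2 + y\<^sup>2" "y > 0" "x \<noteq> 1/2 \<or> y \<noteq> sqrt 3 / 2"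
  shows "ntheta \<beta> x y - ntheta \<alpha> x y < ntheta \<beta> (1/2) (sqrt 3 / 2) - ntheta \<alpha> (1/2) (sqrt 3 / 2)"
proof -
  have y: "2/3 \<le> y" using fundamental_domain_Im(2)[of x y] z by simp
  show ?thesis
  proof (cases "x = 1/2")
    case True
    then show ?thesis using ntheta_diff_half_less[OF \<alpha> y] z(5) by metis
  next
    case False
    then have "ntheta \<beta> x y - ntheta \<alpha> x y < ntheta \<beta> (1/2) y - ntheta \<alpha> (1/2) y" using z by (intro ntheta_diff_less_half \<alpha> y) auto
    also have "\<dots> \<le> ntheta \<beta> (1/2) (sqrt 3 / 2) - ntheta \<alpha> (1/2) (sqrt 3 / 2)"
    proof (cases "y = sqrt 3 / 2")
      case True show ?thesis unfolding True by (rule order.refl)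
    next
      case False then show ?thesis by (intro less_imp_le ntheta_diff_half_less \<alpha> y)
    qed
    finally show ?thesis .
  qed
qed

text \<open>The inequality for differences bounds the excess of \<open>ntheta \<alpha>\<close> at
  the hexagonal point by the corresponding excess of \<open>ntheta \<beta>\<close>. The latter is at
  most a constant over \<open>\<beta>\<close>, because the terms \<open>sqrt \<beta>\<close>
  cancel.\<close>

theorem ntheta_hexagonal_minimal:
  assumes \<alpha>: "1 \<le> \<alpha>" and z: "0 \<le> x" "x \<le> 1/2" "1 \<le> x\<^sup>2 + y\<^sup>2" "y > 0"
  shows "ntheta \<alpha> (1/2) (sqrt 3 / 2) \<le> ntheta \<alpha> x y"
proof -
  have "ntheta \<alpha> (1/2) (sqrt 3 / 2) - ntheta \<alpha> x y \<le> ntheta 1 (1/2) (sqrt 3 / 2) / \<beta>" if "\<beta> > \<alpha>" for \<beta>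
  proof -
    have "ntheta \<beta> x y - ntheta \<alpha> x y \<le> ntheta \<beta> (1/2) (sqrt 3 / 2) - ntheta \<alpha> (1/2) (sqrt 3 / 2)"
      using ntheta_diff_fundamental_domain[OF \<alpha> that z] by (metis order.refl order.strict_implies_order)
    then show ?thesis using ntheta_hexagonal_le[of \<beta>] ntheta_pos[of \<beta> y x] that \<alpha> z by linarith
  qed
  with eventually_gt_at_top[of \<alpha>] have "eventually (\<lambda>\<beta>. ntheta \<alpha> (1/2) (sqrt 3 / 2) - ntheta \<alpha> x y \<le> ntheta 1 (1/2) (sqrt 3 / 2) / \<beta>) at_top"
    by (rule eventually_mono)
  moreover have "((\<lambda>\<beta>. ntheta 1 (1/2) (sqrt 3 / 2) / \<beta>) \<longlongrightarrow> 0) at_top"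
    by (intro tendsto_divide_0[OF tendsto_const] filterlim_at_top_imp_at_infinity filterlim_ident)
  ultimately have "ntheta \<alpha> (1/2) (sqrt 3 / 2) - ntheta \<alpha> x y \<le> 0" by (intro tendsto_lowerbound) auto
  then show ?thesis by simp
qed

text \<open>The quotient minus 1 has its numerator maximal and its denominator minimal at the
  hexagonal point. Positivity of the maximal numerator, from \<open>ntheta_strict_mono\<close>, is
  what allows the denominator to be replaced.\<close>

lemma ntheta_ratio_fundamental_domain:
  assumes \<alpha>: "1 \<le> \<alpha>" "\<alpha> < \<beta>" and z: "0 \<le> x" "x \<le> 1/2" "1 \<le> x\<^sup>2 + y\<^sup>2" "y > 0" "x \<noteq> 1/2 \<or> y \<noteq> sqrt 3 / 2"
  shows "ntheta \<beta> x y / ntheta \<alpha> x y < ntheta \<beta> (1/2) (sqrt 3 / 2) / ntheta \<alpha> (1/2) (sqrt 3 / 2)"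
proof -
  define a b a0 b0 where "a = ntheta \<alpha> x y" and "b = ntheta \<beta> x y"
    and "a0 = ntheta \<alpha> (1/2) (sqrt 3 / 2)" and "b0 = ntheta \<beta> (1/2) (sqrt 3 / 2)"
  have "0 < sqrt \<alpha>" using \<alpha> by simp
  then have a0: "0 < a0" using ntheta_pos[of \<alpha> "sqrt 3 / 2" "1/2"] \<alpha> unfolding a0_def by (metis divide_pos_pos less_le_trans real_sqrt_gt_0_iff zero_less_numeral zero_less_one)
  have a: "a0 \<le> a" unfolding a0_def a_def by (rule ntheta_hexagonal_minimal[OF \<alpha>(1) z(1-4)])
  have "(b - a) / a < (b0 - a0) / a"
    using ntheta_diff_fundamental_domain[OF \<alpha> z] a a0 by (intro divide_strict_right_mono) (auto simp: a_def b_def a0_def b0_def)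
  also have "\<dots> \<le> (b0 - a0) / a0"
    using ntheta_strict_mono[OF \<alpha>, of "sqrt 3 / 2" "1/2"] a a0
    by (intro divide_left_mono) (auto simp: a0_def b0_def power_divide)
  finally have "b / a < b0 / a0" using a a0 by (simp add: diff_divide_distrib)
  then show ?thesis by (simp only: a_def b_def a0_def b0_def)
qed

section \<open>From the fundamental domain to the upper half-plane\<close>

definition hexagonal :: complex where "hexagonal = Complex (1/2) (sqrt 3 / 2)"

lemma exp_i_pi_third: "exp (\<i> * of_real pi / 3) = hexagonal"
proof -
  have "exp (\<i> * of_real pi / 3) = cis (pi / 3)" by (simp add: cis_conv_exp)
  then show ?thesis by (simp add: hexagonal_def complex_eq_iff cos_60 sin_60)
qed

text \<open>The reflection in the imaginary axis is not a modular transformation, so it is used for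
  values only. Equality leaves the two lower corners of the fundamental domain, which a translation
  by 1 identifies.\<close>

lemma ntheta_ratio_maximal:
  assumes \<alpha>: "1 \<le> \<alpha>" "\<alpha> < \<beta>" and z: "Im z > 0"
  shows "ntheta \<beta> (Re z) (Im z) / ntheta \<alpha> (Re z) (Im z) < ntheta \<beta> (1/2) (sqrt 3 / 2) / ntheta \<alpha> (1/2) (sqrt 3 / 2)
    \<or> (z \<in> modular_orbit hexagonal \<and>
        ntheta \<beta> (Re z) (Im z) / ntheta \<alpha> (Re z) (Im z) = ntheta \<beta> (1/2) (sqrt 3 / 2) / ntheta \<alpha> (1/2) (sqrt 3 / 2))"
proof -
  obtain A where A: "A \<in> SL2Z" "\<bar>Re (moebius_act A z)\<bar> \<le> 1 / 2" "1 \<le> cmod (moebius_act A z)"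
    by (rule SL2Z_representative[OF z])
  define w where "w = moebius_act A z"
  have w: "Im w > 0" unfolding w_def by (rule Im_moebius_act(2)[OF A(1) z])
  have n: "ntheta s (Re z) (Im z) = ntheta s \<bar>Re w\<bar> (Im w)" if "s > 0" for s
    using ntheta_moebius_act[OF A(1) z that] ntheta_uminus_x[OF that w, of "Re w"] by (simp add: w_def abs_if)
  have "1 \<le> (cmod w)\<^sup>2" using A(3) by (simp add: w_def one_le_power)
  then have sq: "1 \<le> \<bar>Re w\<bar>\<^sup>2 + (Im w)\<^sup>2" by (simp add: cmod_power2)
  show ?thesis
  proof (cases "\<bar>Re w\<bar> \<noteq> 1/2 \<or> Im w \<noteq> sqrt 3 / 2")
    case True
    show ?thesis using ntheta_ratio_fundamental_domain[OF \<alpha> _ _ sq w True] A(2) n \<alpha> by (simp add: w_def)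
  next
    case False
    then have e: "\<bar>Re w\<bar> = 1/2" "Im w = sqrt 3 / 2" by auto
    obtain B where B: "B \<in> SL2Z" "moebius_act B w = z" unfolding w_def by (rule moebius_act_inverse[OF A(1) z])
    have h: "Im hexagonal > 0" by (simp add: hexagonal_def)
    have "\<exists>C \<in> SL2Z. w = moebius_act C hexagonal"
    proof (cases "Re w = 1/2")
      case True
      show ?thesis
        by (rule bexI[of _ "mat 1"]) (use True e in \<open>simp_all add: SL2Z_iff mat_def moebius_act_def hexagonal_def complex_eq_iff\<close>)
    next
      case False
      then have "Re w = - (1/2)" using e by linarith
      then show ?thesis
        by (intro bexI[of _ "vector [vector [1, -1], vector [0, 1]]"]) (use e in \<open>simp_all add: SL2Z_iff moebius_act_def hexagonal_def complex_eq_iff\<close>)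
    qed
    then obtain C where C: "C \<in> SL2Z" "w = moebius_act C hexagonal" by blast
    have "z = moebius_act (B ** C) hexagonal" using B(2) moebius_act_compose[OF C(1) h, of B] C(2) by simp
    then have "z \<in> modular_orbit hexagonal" using SL2Z_mult[OF B(1) C(1)] by (auto simp: modular_orbit_def)
    then show ?thesis using n[of \<alpha>] n[of \<beta>] e \<alpha> by simp
  qed
qed

lemma ntheta_ratio_gt_1:
  assumes \<alpha>: "1 \<le> \<alpha>" "\<alpha> < \<beta>" and z: "Im z > 0"
  shows "1 < ntheta \<beta> (Re z) (Im z) / ntheta \<alpha> (Re z) (Im z)"
proof -
  obtain A where A: "A \<in> SL2Z" "\<bar>Re (moebius_act A z)\<bar> \<le> 1 / 2" "1 \<le> cmod (moebius_act A z)"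
    by (rule SL2Z_representative[OF z])
  define w where "w = moebius_act A z"
  have w: "Im w > 0" unfolding w_def by (rule Im_moebius_act(2)[OF A(1) z])
  have "1 \<le> (cmod w)\<^sup>2" using A(3) by (simp add: w_def one_le_power)
  then have "1 \<le> (Re w)\<^sup>2 + (Im w)\<^sup>2" by (simp add: cmod_power2)
  from fundamental_domain_Im(1)[OF this _ w] A(2) have "3/4 \<le> (Im w)\<^sup>2" by (simp add: w_def)
  from ntheta_strict_mono[OF \<alpha> w this, of "Re w"] have "ntheta \<alpha> (Re z) (Im z) < ntheta \<beta> (Re z) (Im z)"
    using ntheta_moebius_act[OF A(1) z] \<alpha> by (simp add: w_def)
  moreover have "0 < ntheta \<alpha> (Re z) (Im z)" using ntheta_pos[of \<alpha> "Im z" "Re z"] \<alpha> z by (simp add: less_le_trans[of 0 "sqrt \<alpha>"])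
  ultimately show ?thesis by simp
qed

section \<open>Reduction of the four regions\<close>

lemma ntheta_max_inverse:
  assumes "\<alpha> > 0" "Im z > 0" shows "ntheta (max \<alpha> (1 / \<alpha>)) (Re z) (Im z) = ntheta \<alpha> (Re z) (Im z)"
  using ntheta_inverse[OF assms, of "Re z"] by (simp add: max_def)

text \<open>On the logarithmic scale, regions I and III say that \<open>\<beta>\<close> is farther
  from 1 than \<open>\<alpha>\<close>; regions II and IV say the reverse.\<close>

lemma max_inverse_less_iff:
  fixes \<alpha> \<beta> :: real
  assumes "\<alpha> > 0" "\<beta> > 0"
  shows "max \<alpha> (1 / \<alpha>) < max \<beta> (1 / \<beta>) \<longleftrightarrow> \<alpha> < \<beta> \<and> 1 < \<beta> * \<alpha> \<or> \<beta> < \<alpha> \<and> \<beta> * \<alpha> < 1"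
proof -
  have i: "1 / \<alpha> < \<beta> \<longleftrightarrow> 1 < \<beta> * \<alpha>" "\<alpha> < 1 / \<beta> \<longleftrightarrow> \<beta> * \<alpha> < 1" "1 / \<alpha> < 1 / \<beta> \<longleftrightarrow> \<beta> < \<alpha>"
    using assms by (auto simp: field_simps)
  show ?thesis unfolding max_less_iff_conj less_max_iff_disj i by auto
qed

lemma max_inverse_ge_1: "(\<alpha> :: real) > 0 \<Longrightarrow> 1 \<le> max \<alpha> (1 / \<alpha>)"
  by (cases "1 \<le> \<alpha>") (auto simp: le_max_iff_disj)

context
  fixes \<alpha> \<beta> :: real
  assumes pos: "\<alpha> > 0" "\<beta> > 0" and less: "max \<alpha> (1 / \<alpha>) < max \<beta> (1 / \<beta>)"
begin

lemma theta_ratio_conv_ntheta: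
  assumes "Im z > 0"
  shows "theta_ratio \<alpha> \<beta> z = sqrt \<alpha> / sqrt \<beta> * (ntheta (max \<beta> (1 / \<beta>)) (Re z) (Im z) / ntheta (max \<alpha> (1 / \<alpha>)) (Re z) (Im z))"
  using pos ntheta_max_inverse[OF pos(1) assms] ntheta_max_inverse[OF pos(2) assms] by (simp add: theta_ratio_def theta_conv_ntheta)

lemma theta_ratio_pos: "Im z > 0 \<Longrightarrow> 0 < theta_ratio \<alpha> \<beta> z"
  unfolding theta_ratio_conv_ntheta using pos
  by (intro mult_pos_pos less_trans[OF zero_less_one ntheta_ratio_gt_1[OF max_inverse_ge_1[OF pos(1)] less]]) auto

lemma theta_ratio_hexagonal:
  assumes z: "Im z > 0"
  shows "theta_ratio \<alpha> \<beta> z \<le> theta_ratio \<alpha> \<beta> hexagonal"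
    and "theta_ratio \<alpha> \<beta> hexagonal \<le> theta_ratio \<alpha> \<beta> z \<Longrightarrow> z \<in> modular_orbit hexagonal"
proof -
  have c: "0 < sqrt \<alpha> / sqrt \<beta>" using pos by simp
  have h: "theta_ratio \<alpha> \<beta> hexagonal = sqrt \<alpha> / sqrt \<beta> *
      (ntheta (max \<beta> (1 / \<beta>)) (1/2) (sqrt 3 / 2) / ntheta (max \<alpha> (1 / \<alpha>)) (1/2) (sqrt 3 / 2))"
    using theta_ratio_conv_ntheta[of hexagonal] by (simp add: hexagonal_def)
  show "theta_ratio \<alpha> \<beta> z \<le> theta_ratio \<alpha> \<beta> hexagonal"
    unfolding h theta_ratio_conv_ntheta[OF z] mult_le_cancel_left_pos[OF c]
    using ntheta_ratio_maximal[OF max_inverse_ge_1[OF pos(1)] less z] by auto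
  show "z \<in> modular_orbit hexagonal" if "theta_ratio \<alpha> \<beta> hexagonal \<le> theta_ratio \<alpha> \<beta> z"
    using that ntheta_ratio_maximal[OF max_inverse_ge_1[OF pos(1)] less z]
    unfolding h theta_ratio_conv_ntheta[OF z] mult_le_cancel_left_pos[OF c] by auto
qed

text \<open>Every value of the normalised ratio lies strictly above 1, its limit along the imaginary
  axis, so a point high enough on that axis undercuts it.\<close>

lemma theta_ratio_no_minimum:
  assumes z: "Im z > 0"
  obtains w where "Im w > 0" "theta_ratio \<alpha> \<beta> w < theta_ratio \<alpha> \<beta> z"
proof -
  have c: "0 < sqrt \<alpha> / sqrt \<beta>" using pos by simp
  have "max \<alpha> (1 / \<alpha>) > 0" "max \<beta> (1 / \<beta>) > 0" using pos by (auto simp: less_max_iff_disj)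
  from ntheta_ratio_near_1[OF this ntheta_ratio_gt_1[OF max_inverse_ge_1[OF pos(1)] less z]]
  obtain y where y: "y > 0" "ntheta (max \<beta> (1 / \<beta>)) 0 y / ntheta (max \<alpha> (1 / \<alpha>)) 0 y
      < ntheta (max \<beta> (1 / \<beta>)) (Re z) (Im z) / ntheta (max \<alpha> (1 / \<alpha>)) (Re z) (Im z)" by blast
  have "theta_ratio \<alpha> \<beta> (Complex 0 y) < theta_ratio \<alpha> \<beta> z"
    using theta_ratio_conv_ntheta[of "Complex 0 y"] y unfolding theta_ratio_conv_ntheta[OF z] by (simp only: complex.sel mult_less_cancel_left_pos[OF c])
  then show thesis using that[of "Complex 0 y"] y by simp
qed

end

lemma theta_ratio_swap: "theta_ratio \<beta> \<alpha> z = inverse (theta_ratio \<alpha> \<beta> z)"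
  by (simp add: theta_ratio_def)

theorem theorem1p1:
  fixes \<alpha> \<beta> :: real
  assumes "\<alpha> > 0" and "\<beta> > 0"
  shows
    "((\<alpha>, \<beta>) \<in> region_I \<union> region_III \<longrightarrow>
        is_maximizer (theta_ratio \<alpha> \<beta>) (exp (\<i> * of_real pi / 3)) \<and>
        (\<forall>z. is_maximizer (theta_ratio \<alpha> \<beta>) z \<longrightarrow> z \<in> modular_orbit (exp (\<i> * of_real pi / 3)))) \<and>
     ((\<alpha>, \<beta>) \<in> region_II \<union> region_IV \<longrightarrow>
        \<not> (\<exists>z. is_maximizer (theta_ratio \<alpha> \<beta>) z)) \<and>
     ((\<alpha>, \<beta>) \<in> region_II \<union> region_IV \<longrightarrow>
        is_minimizer (theta_ratio \<alpha> \<beta>) (exp (\<i> * of_real pi / 3)) \<and>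
        (\<forall>z. is_minimizer (theta_ratio \<alpha> \<beta>) z \<longrightarrow> z \<in> modular_orbit (exp (\<i> * of_real pi / 3)))) \<and>
     ((\<alpha>, \<beta>) \<in> region_I \<union> region_III \<longrightarrow>
        \<not> (\<exists>z. is_minimizer (theta_ratio \<alpha> \<beta>) z))"
proof -
  have h: "Im hexagonal > 0" by (simp add: hexagonal_def)
  have "is_maximizer (theta_ratio \<alpha> \<beta>) hexagonal"
    "is_maximizer (theta_ratio \<alpha> \<beta>) z \<Longrightarrow> z \<in> modular_orbit hexagonal"
    "\<not> is_minimizer (theta_ratio \<alpha> \<beta>) z" if "(\<alpha>, \<beta>) \<in> region_I \<union> region_III" for z
  proof -
    have less: "max \<alpha> (1 / \<alpha>) < max \<beta> (1 / \<beta>)"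
      using that unfolding max_inverse_less_iff[OF assms] by (auto simp: region_I_def region_III_def)
    note H = theta_ratio_hexagonal[OF assms less]
    show "is_maximizer (theta_ratio \<alpha> \<beta>) hexagonal"
      using H(1) h by (auto simp: is_maximizer_def is_arg_max_linorder upper_halfplane_def)
    show "z \<in> modular_orbit hexagonal" if "is_maximizer (theta_ratio \<alpha> \<beta>) z"
      using that H(2)[of z] h by (auto simp: is_maximizer_def is_arg_max_linorder upper_halfplane_def)
    show "\<not> is_minimizer (theta_ratio \<alpha> \<beta>) z"
      using theta_ratio_no_minimum[OF assms less, of z] by (auto simp: is_minimizer_def is_arg_min_def upper_halfplane_def)
  qed
  moreover have "is_minimizer (theta_ratio \<alpha> \<beta>) hexagonal"
    "is_minimizer (theta_ratio \<alpha> \<beta>) z \<Longrightarrow> z \<in> modular_orbit hexagonal"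
    "\<not> is_maximizer (theta_ratio \<alpha> \<beta>) z" if "(\<alpha>, \<beta>) \<in> region_II \<union> region_IV" for z
  proof -
    have less: "max \<beta> (1 / \<beta>) < max \<alpha> (1 / \<alpha>)"
      using that unfolding max_inverse_less_iff[OF assms(2,1)] by (auto simp: region_II_def region_IV_def mult.commute)
    note H = theta_ratio_hexagonal[OF assms(2,1) less] and P = theta_ratio_pos[OF assms(2,1) less]
    \<comment> \<open>Exchanging the parameters inverts the ratio, and inversion reverses the order
      of positive numbers; maximal and minimal points change roles.\<close>
    have le: "theta_ratio \<alpha> \<beta> u \<le> theta_ratio \<alpha> \<beta> v \<longleftrightarrow> theta_ratio \<beta> \<alpha> v \<le> theta_ratio \<beta> \<alpha> u"
      if "Im u > 0" "Im v > 0" for u v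
      unfolding theta_ratio_swap[of \<alpha> \<beta>] using P[OF that(1)] P[OF that(2)] by simp
    have min: "is_minimizer (theta_ratio \<alpha> \<beta>) u \<longleftrightarrow> Im u > 0 \<and> (\<forall>v. Im v > 0 \<longrightarrow> theta_ratio \<alpha> \<beta> u \<le> theta_ratio \<alpha> \<beta> v)" for u
      by (auto simp: is_minimizer_def is_arg_min_linorder upper_halfplane_def)
    have max: "is_maximizer (theta_ratio \<alpha> \<beta>) u \<longleftrightarrow> Im u > 0 \<and> (\<forall>v. Im v > 0 \<longrightarrow> theta_ratio \<alpha> \<beta> v \<le> theta_ratio \<alpha> \<beta> u)" for u
      by (auto simp: is_maximizer_def is_arg_max_linorder upper_halfplane_def)
    show "is_minimizer (theta_ratio \<alpha> \<beta>) hexagonal" unfolding min using H(1) h le by blast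
    show "z \<in> modular_orbit hexagonal" if "is_minimizer (theta_ratio \<alpha> \<beta>) z"
      using that H(2) h le unfolding min by blast
    show "\<not> is_maximizer (theta_ratio \<alpha> \<beta>) z"
      unfolding max using theta_ratio_no_minimum[OF assms(2,1) less, of z] le by (metis not_le)
  qed
  ultimately show ?thesis unfolding exp_i_pi_third by blast
qed

end
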